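(* Let $G$ be a Lie group of dimension $n$ with a left-invariant affine structure. Then either $G$ is $(n-1)$-convex (in the affine sense), or the universal cover $\tilde G$ is affinely diffeomorphic to the universal cover of the complement of a closed convex set in $\mathbb R^n$ with the induced affine structure.
   Context: Throughout $n\ge 2$. An affine structure on an $n$-manifold is a maximal atlas of charts to $\mathbb R^n$ with transition maps restrictions of affine automorphisms of $\mathbb R^n$. An affine structure on a Lie group is left-invariant if left multiplications preserve it. Affine $m$-convexity ($1\le m<n$): let $T$ be an affine $(m+1)$-simplex in $\mathbb R^n$ with sides (codimension-one faces) $F_1,\dots,F_{m+2}$ and interior $T^o$. An affine $n$-manifold $M$ is $m$-convex if every nondegenerate affine map $T^o\cup F_2\cup\dots\cup F_{m+2}\to M$ extends to an affine map $T\to M$. *)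

theory Defs
  imports "HOL-Analysis.Analysis" "HOL-Algebra.Group"
begin

section \<open>Charts and maximal atlases\<close>

text \<open>
  A chart is a pair \<open>(U, \<phi>)\<close>; only the values of \<open>\<phi>\<close> on \<open>U\<close> matter, so a maximal atlas contains
  with \<open>(U, \<phi>)\<close> all \<open>(U, \<phi>')\<close> such that \<open>\<phi>\<close> and \<open>\<phi>'\<close> agree on \<open>U\<close>.
\<close>

type_synonym ('a, 'v) atlas = "('a set \<times> ('a \<Rightarrow> 'v)) set"

definition chart_on :: "'a topology \<Rightarrow> 'a set \<times> ('a \<Rightarrow> 'v::euclidean_space) \<Rightarrow> bool" where
  "chart_on X = (\<lambda>(U, \<phi>). openin X U \<and> open (\<phi> ` U) \<and>
     homeomorphic_map (subtopology X U) (top_of_set (\<phi> ` U)) \<phi>)"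

definition compatible ::
    "('v set \<Rightarrow> ('v \<Rightarrow> 'v) \<Rightarrow> bool) \<Rightarrow> 'a set \<times> ('a \<Rightarrow> 'v) \<Rightarrow> 'a set \<times> ('a \<Rightarrow> 'v) \<Rightarrow> bool" where
  "compatible P = (\<lambda>(U, \<phi>) (V, \<psi>).
     P (\<phi> ` (U \<inter> V)) (\<psi> \<circ> inv_into U \<phi>) \<and> P (\<psi> ` (U \<inter> V)) (\<phi> \<circ> inv_into V \<psi>))"

definition maximal_atlas ::
    "('v set \<Rightarrow> ('v \<Rightarrow> 'v) \<Rightarrow> bool) \<Rightarrow> 'a topology \<Rightarrow> ('a, 'v::euclidean_space) atlas \<Rightarrow> bool" where
  "maximal_atlas P X A \<longleftrightarrow>
     (\<forall>c\<in>A. chart_on X c) \<and> (\<Union>c\<in>A. fst c) = topspace X \<and>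
     (\<forall>c\<in>A. \<forall>d\<in>A. compatible P c d) \<and>
     (\<forall>c. chart_on X c \<and> (\<forall>d\<in>A. compatible P c d) \<longrightarrow> c \<in> A)"

text \<open>Maps that satisfy \<open>P\<close> when read in charts.\<close>

definition chartwise_map ::
    "('v set \<Rightarrow> ('v \<Rightarrow> 'w) \<Rightarrow> bool) \<Rightarrow> 'a topology \<Rightarrow> ('a, 'v) atlas \<Rightarrow> 'b topology \<Rightarrow> ('b, 'w) atlas
       \<Rightarrow> ('a \<Rightarrow> 'b) \<Rightarrow> bool" where
  "chartwise_map P X A Y B f \<longleftrightarrow> continuous_map X Y f \<and>
     (\<forall>(U, \<phi>)\<in>A. \<forall>(V, \<psi>)\<in>B. P (\<phi> ` (U \<inter> f -` V)) (\<psi> \<circ> f \<circ> inv_into U \<phi>))"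

section \<open>Lie groups\<close>

text \<open>Only meant for open \<open>S\<close>. Being \<open>C\<^sup>k\<close> is expressed through directional derivatives,
  which on finite-dimensional spaces is the usual notion.\<close>

primrec Ck_on :: "nat \<Rightarrow> 'v::euclidean_space set \<Rightarrow> ('v \<Rightarrow> 'w::euclidean_space) \<Rightarrow> bool" where
  "Ck_on 0 S f \<longleftrightarrow> continuous_on S f"
| "Ck_on (Suc k) S f \<longleftrightarrow> (\<forall>x\<in>S. f differentiable (at x)) \<and>
     (\<forall>v. Ck_on k S (\<lambda>x. frechet_derivative f (at x) v))"

definition smooth_on :: "'v::euclidean_space set \<Rightarrow> ('v \<Rightarrow> 'w::euclidean_space) \<Rightarrow> bool" where
  "smooth_on S f \<longleftrightarrow> (\<forall>k. Ck_on k S f)"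

definition smooth_structure :: "'a topology \<Rightarrow> ('a, 'v::euclidean_space) atlas \<Rightarrow> bool" where
  "smooth_structure X S \<longleftrightarrow> Hausdorff_space X \<and> second_countable X \<and> maximal_atlas smooth_on X S"

definition prod_atlas :: "('a, 'v) atlas \<Rightarrow> ('b, 'w) atlas \<Rightarrow> ('a \<times> 'b, 'v \<times> 'w) atlas" where
  "prod_atlas A B = {(U \<times> V, map_prod \<phi> \<psi>) |U \<phi> V \<psi>. (U, \<phi>) \<in> A \<and> (V, \<psi>) \<in> B}"

definition lie_group ::
    "('a, 'm) monoid_scheme \<Rightarrow> 'a topology \<Rightarrow> ('a, 'v::euclidean_space) atlas \<Rightarrow> bool" where
  "lie_group G X S \<longleftrightarrow> group G \<and> topspace X = carrier G \<and> smooth_structure X S \<and>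
     chartwise_map smooth_on (prod_topology X X) (prod_atlas S S) X S (\<lambda>(x, y). x \<otimes>\<^bsub>G\<^esub> y) \<and>
     chartwise_map smooth_on X S X S (\<lambda>x. inv\<^bsub>G\<^esub> x)"

section \<open>Affine structures\<close>

definition affine_map :: "('v::euclidean_space \<Rightarrow> 'w::euclidean_space) \<Rightarrow> bool" where
  "affine_map L \<longleftrightarrow> (\<exists>A b. linear A \<and> L = (\<lambda>x. A x + b))"

definition affine_automorphism :: "('v::euclidean_space \<Rightarrow> 'v) \<Rightarrow> bool" where
  "affine_automorphism L \<longleftrightarrow> affine_map L \<and> bij L"

text \<open>
  Domains of transition maps may be disconnected. As usual for geometric structures, a map is
  accepted if it is locally (equivalently, on each component of an open domain) the restriction
  of an element of \<open>\<Gamma>\<close>.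
\<close>

definition locally_restricts ::
    "('v::topological_space \<Rightarrow> 'w) set \<Rightarrow> 'v set \<Rightarrow> ('v \<Rightarrow> 'w) \<Rightarrow> bool" where
  "locally_restricts \<Gamma> S f \<longleftrightarrow>
     (\<forall>x\<in>S. \<exists>N. open N \<and> x \<in> N \<and> (\<exists>L\<in>\<Gamma>. \<forall>y\<in>N \<inter> S. f y = L y))"

definition affine_structure :: "'a topology \<Rightarrow> ('a, 'v::euclidean_space) atlas \<Rightarrow> bool" where
  "affine_structure X A \<longleftrightarrow> Hausdorff_space X \<and> second_countable X \<and>
     maximal_atlas (locally_restricts {L. affine_automorphism L}) X A"

definition affine_manifold_map ::
    "'a topology \<Rightarrow> ('a, 'v::euclidean_space) atlas \<Rightarrow> 'b topology \<Rightarrow> ('b, 'w::euclidean_space) atlas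
       \<Rightarrow> ('a \<Rightarrow> 'b) \<Rightarrow> bool" where
  "affine_manifold_map = chartwise_map (locally_restricts {L. affine_map L})"

definition affine_diffeomorphism ::
    "'a topology \<Rightarrow> ('a, 'v::euclidean_space) atlas \<Rightarrow> 'b topology \<Rightarrow> ('b, 'v) atlas
       \<Rightarrow> ('a \<Rightarrow> 'b) \<Rightarrow> bool" where
  "affine_diffeomorphism X A Y B f \<longleftrightarrow> bij_betw f (topspace X) (topspace Y) \<and>
     affine_manifold_map X A Y B f \<and> affine_manifold_map Y B X A (inv_into (topspace X) f)"

definition affinely_diffeomorphic ::
    "'a topology \<Rightarrow> ('a, 'v::euclidean_space) atlas \<Rightarrow> 'b topology \<Rightarrow> ('b, 'v) atlas \<Rightarrow> bool" where
  "affinely_diffeomorphic X A Y B \<longleftrightarrow> (\<exists>f. affine_diffeomorphism X A Y B f)"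

definition left_invariant ::
    "('a, 'm) monoid_scheme \<Rightarrow> 'a topology \<Rightarrow> ('a, 'v::euclidean_space) atlas \<Rightarrow> bool" where
  "left_invariant G X A \<longleftrightarrow> (\<forall>g\<in>carrier G. affine_diffeomorphism X A X A (\<lambda>x. g \<otimes>\<^bsub>G\<^esub> x))"

text \<open>
  The affine structure on \<open>Y\<close> induced by a local homeomorphism \<open>p\<close> into the space carrying \<open>A\<close>:
  all charts of \<open>Y\<close> in which \<open>p\<close> is locally an affine automorphism.
\<close>

definition induced_affine_atlas ::
    "'b topology \<Rightarrow> ('b \<Rightarrow> 'a) \<Rightarrow> ('a, 'v::euclidean_space) atlas \<Rightarrow> ('b, 'v) atlas" where
  "induced_affine_atlas Y p A = {(V, \<psi>). chart_on Y (V, \<psi>) \<and>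
     (\<forall>(U, \<phi>)\<in>A. locally_restricts {L. affine_automorphism L}
        (\<psi> ` (V \<inter> p -` U)) (\<phi> \<circ> p \<circ> inv_into V \<psi>))}"

definition open_subset_atlas :: "'v::euclidean_space set \<Rightarrow> ('v, 'v) atlas" where
  "open_subset_atlas S = induced_affine_atlas (top_of_set S) id {(UNIV, id)}"

section \<open>Affine \<open>m\<close>-convexity\<close>

text \<open>Affine maps into an affine manifold from an arbitrary subset \<open>S\<close> of the model space, which
  in charts must be given by elements of \<open>\<Gamma>\<close>.\<close>

definition subset_affine_map ::
    "('v::euclidean_space \<Rightarrow> 'w) set \<Rightarrow> 'v set \<Rightarrow> 'a topology \<Rightarrow> ('a, 'w::euclidean_space) atlas
       \<Rightarrow> ('v \<Rightarrow> 'a) \<Rightarrow> bool" where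
  "subset_affine_map \<Gamma> S X A f \<longleftrightarrow> continuous_map (top_of_set S) X f \<and>
     (\<forall>(U, \<phi>)\<in>A. locally_restricts \<Gamma> (S \<inter> f -` U) (\<phi> \<circ> f))"

definition affine_map_on ::
    "'v::euclidean_space set \<Rightarrow> 'a topology \<Rightarrow> ('a, 'w::euclidean_space) atlas \<Rightarrow> ('v \<Rightarrow> 'a) \<Rightarrow> bool"
  where "affine_map_on = subset_affine_map {L. affine_map L}"

definition nondegenerate_affine_map_on ::
    "'v::euclidean_space set \<Rightarrow> 'a topology \<Rightarrow> ('a, 'w::euclidean_space) atlas \<Rightarrow> ('v \<Rightarrow> 'a) \<Rightarrow> bool"
  where "nondegenerate_affine_map_on S =
     subset_affine_map {L. affine_map L \<and> inj_on L (affine hull S)} S"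

definition m_convex :: "nat \<Rightarrow> 'a topology \<Rightarrow> ('a, 'v::euclidean_space) atlas \<Rightarrow> bool" where
  "m_convex m X A \<longleftrightarrow>
     (\<forall>(T :: 'v set) F1 f. int (m + 1) simplex T \<and> F1 facet_of T \<longrightarrow>
        (let S = rel_interior T \<union> \<Union>{F. F facet_of T \<and> F \<noteq> F1} in
         nondegenerate_affine_map_on S X A f \<longrightarrow>
         (\<exists>g. affine_map_on T X A g \<and> (\<forall>x\<in>S. g x = f x))))"

section \<open>The universal cover\<close>

text \<open>
  The universal cover of a manifold \<open>X\<close> with base point \<open>x\<close>: homotopy classes (relative to
  endpoints) of paths starting at \<open>x\<close>, with the usual topology. The library's \<open>homotopic_paths\<close>
  and \<open>joinpaths\<close> are available only for spaces given by a type class. If \<open>X\<close> is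
  not connected, this is the universal cover of the component of \<open>x\<close>.
\<close>

definition path_class :: "'a topology \<Rightarrow> (real \<Rightarrow> 'a) \<Rightarrow> (real \<Rightarrow> 'a) set" where
  "path_class X p =
     {q. homotopic_with (\<lambda>r. r 0 = p 0 \<and> r 1 = p 1) (top_of_set {0..1}) X p q}"

definition path_concat :: "(real \<Rightarrow> 'a) \<Rightarrow> (real \<Rightarrow> 'a) \<Rightarrow> real \<Rightarrow> 'a" where
  "path_concat p q = (\<lambda>t. if t \<le> 1/2 then p (2 * t) else q (2 * t - 1))"

definition ucover_topology :: "'a topology \<Rightarrow> 'a \<Rightarrow> (real \<Rightarrow> 'a) set topology" where
  "ucover_topology X x = topology_generated_by
     {{path_class X (path_concat p q) |q. pathin (subtopology X U) q \<and> q 0 = p 1} |p U.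
        pathin X p \<and> p 0 = x \<and> openin X U \<and> p 1 \<in> U}"

definition ucover_proj :: "(real \<Rightarrow> 'a) set \<Rightarrow> 'a" where
  "ucover_proj c = (SOME p. p \<in> c) 1"

definition ucover_atlas ::
    "'a topology \<Rightarrow> 'a \<Rightarrow> ('a, 'v::euclidean_space) atlas \<Rightarrow> ((real \<Rightarrow> 'a) set, 'v) atlas" where
  "ucover_atlas X x A = induced_affine_atlas (ucover_topology X x) ucover_proj A"

end

theory Submission
  imports Defs
begin

text \<open>
  Left invariance yields a group \<open>H\<close> covering the identity component of \<open>G\<close>, acting on the model space
  by affine maps, whose orbit map \<open>H \<rightarrow> \<Omega>\<close> at a point \<open>x0\<close> is the developing map and a covering of the
  open orbit \<open>\<Omega>\<close>. Therefore \<open>G\<close> and \<open>\<Omega>\<close> have the same universal cover, and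
  if \<open>G\<close> is not \<open>(n-1)\<close>-convex, some simplex \<open>T\<close> lies in \<open>\<Omega>\<close> except for a nonempty compact set \<open>K\<close> in the
  relative interior of one facet \<open>F\<close>. Choose points \<open>P i \<in> F - K\<close> converging to a point of \<open>K\<close> and affine
  maps \<open>a i\<close> from \<open>H\<close> with \<open>a i x0 = P i\<close>. These leave every compact subset of \<open>H\<close>, whereas the other facets are
  compact subsets of \<open>\<Omega>\<close>; so the preimages of these facets under \<open>a i\<close> leave a neighbourhood of \<open>x0\<close>, and a
  subsequence of the preimages of \<open>T\<close> converges to a polyhedron with interior in \<open>\<Omega>\<close> that has \<open>x0\<close> on its
  boundary. A further wall of this polyhedron would be \<open>H\<close>-invariant, which is impossible because \<open>T\<close> stays
  away from it. Hence the limit is a half-space bounded by a hyperplane through \<open>x0\<close>. By homogeneity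
  every point of \<open>\<Omega>\<close> lies in a closed half-space contained in \<open>\<Omega>\<close>, so the complement is convex.
\<close>

section \<open>Coverings\<close>

text \<open>Left translation by \<open>g\<close> determines an affine map of the model space only up
  to holonomy, so \<open>G\<close> itself need not act there. Pairs of a group element and an affine
  map remove the ambiguity. They carry a leaf topology, because the group they form may return close
  to the unit along other pieces of graph. Both projections of this group are coverings by
  homogeneity: every evenly covered set is a translate of one fixed ball, so the sheets have uniform
  size. The preimages of \<open>T\<close> have a limit because a fixed half-ball at
  \<open>x0\<close> is eventually mapped into \<open>T\<close>. This bounds the gradients of the
  pulled back functionals of the facets other than \<open>F\<close>, whereas for \<open>F\<close>
  only the direction of the gradient matters. Dimension at least 2 provides a line inside the
  hyperplane of \<open>F\<close>: along it a missing point is approached through \<Omega>, and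
  missing points are enclosed between points of \<Omega>. The universal covers of \<open>G\<close>
  and \<Omega> are compared through one coordinate on that of \<open>H\<close>, the developing map,
  of which the charts on both sides are locally affine functions.\<close>

text \<open>Evenly covered neighbourhoods are described by their sections. Neither surjectivity of \<open>q\<close>
  nor disjointness of the sheets is demanded; unique lifting only needs the total space to be
  Hausdorff.\<close>

definition covering :: "'a topology \<Rightarrow> 'b topology \<Rightarrow> ('a \<Rightarrow> 'b) \<Rightarrow> bool" where
  "covering X Y q \<longleftrightarrow> Hausdorff_space X \<and> continuous_map X Y q \<and>
     (\<forall>y\<in>topspace Y. \<exists>U. openin Y U \<and> y \<in> U \<and>
        (\<forall>x\<in>topspace X. q x \<in> U \<longrightarrow>
           (\<exists>\<sigma>. continuous_map (subtopology Y U) X \<sigma> \<and> \<sigma> (q x) = x \<and>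
                (\<forall>y\<in>U. q (\<sigma> y) = y) \<and> openin X (\<sigma> ` U))))"

lemma covering_imp_continuous_map: "covering X Y q \<Longrightarrow> continuous_map X Y q"
  by (simp add: covering_def)

lemma covering_evenly:
  assumes "covering X Y q" "y \<in> topspace Y"
  obtains U where "openin Y U" "y \<in> U"
    "\<And>x. x \<in> topspace X \<Longrightarrow> q x \<in> U \<Longrightarrow>
       \<exists>\<sigma>. continuous_map (subtopology Y U) X \<sigma> \<and> \<sigma> (q x) = x \<and>
                (\<forall>y\<in>U. q (\<sigma> y) = y) \<and> openin X (\<sigma> ` U)"
  using assms unfolding covering_def by meson

text \<open>The set of agreement is closed because \<open>X\<close> is Hausdorff. It is open because
  two lifts that both lie in the image of one section are recovered from their common projection by
  that section.\<close>

lemma covering_lift_unique: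
  assumes cov: "covering X Y q" and Z: "connected_space Z"
    and f: "continuous_map Z X f" and g: "continuous_map Z X g"
    and eq: "\<And>z. z \<in> topspace Z \<Longrightarrow> q (f z) = q (g z)"
    and z0: "z0 \<in> topspace Z" "f z0 = g z0" and z: "z \<in> topspace Z"
  shows "f z = g z"
proof -
  let ?E = "{z \<in> topspace Z. f z = g z}"
  have clo: "closedin Z ?E"
    using closedin_continuous_maps_eq[of X Z f g] cov f g by (simp add: covering_def)
  have "openin Z ?E"
  proof (subst openin_subopen, intro ballI)
    fix e assume e: "e \<in> ?E"
    then have fe: "f e \<in> topspace X" "q (f e) \<in> topspace Y"
      using f covering_imp_continuous_map[OF cov] by (auto simp: continuous_map_def Pi_iff)
    obtain U where U: "openin Y U" "q (f e) \<in> U" and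
      S: "\<And>x. x \<in> topspace X \<Longrightarrow> q x \<in> U \<Longrightarrow>
       \<exists>\<sigma>. continuous_map (subtopology Y U) X \<sigma> \<and> \<sigma> (q x) = x \<and>
                (\<forall>y\<in>U. q (\<sigma> y) = y) \<and> openin X (\<sigma> ` U)"
      using covering_evenly[OF cov fe(2)] by blast
    obtain \<sigma> where s: "\<sigma> (q (f e)) = f e" "\<And>y. y \<in> U \<Longrightarrow> q (\<sigma> y) = y" "openin X (\<sigma> ` U)"
      using S[OF fe(1) U(2)] by blast
    let ?W = "{z \<in> topspace Z. f z \<in> \<sigma> ` U} \<inter> {z \<in> topspace Z. g z \<in> \<sigma> ` U}"
    have "openin Z ?W"
      using f g s(3) by (blast intro: openin_Int openin_continuous_map_preimage)
    moreover have "e \<in> ?W"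
      using e s(1) U(2) by (smt (verit) Int_iff imageI mem_Collect_eq)
    moreover have "?W \<subseteq> ?E"
      using eq s(2) by auto (metis)
    ultimately show "\<exists>T. openin Z T \<and> e \<in> T \<and> T \<subseteq> ?E" by blast
  qed
  then have "?E = {} \<or> ?E = topspace Z"
    using clo Z unfolding connected_space_clopen_in by blast
  with z0 z show ?thesis by blast
qed

lemma connected_space_interval: "connected_space (top_of_set {a..b::real})"
  by (metis connected_Icc connectedin_absolute connectedin_def connectedin_iff_connected
      topspace_euclidean_subtopology)

text \<open>Bisection of the interval. The claim for \<open>[a, b]\<close> ranges over all starting
  points over \<open>f a\<close>, so that lifts on adjacent intervals can be glued; on short
  intervals a single section does the lifting.\<close>

lemma covering_path_lift:
  assumes cov: "covering X Y q" and f: "pathin Y f" and x: "x \<in> topspace X" "q x = f 0"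
  obtains F where "pathin X F" "F 0 = x" "\<And>t. t \<in> {0..1} \<Longrightarrow> q (F t) = f t"
proof -
  define P where "P a b \<longleftrightarrow> (0 \<le> a \<and> a \<le> b \<and> b \<le> 1 \<longrightarrow>
      (\<forall>x\<in>topspace X. q x = f a \<longrightarrow>
        (\<exists>F. continuous_map (top_of_set {a..b}) X F \<and> F a = x \<and> (\<forall>t\<in>{a..b}. q (F t) = f t))))"
    for a b
  have fc: "continuous_map (top_of_set {0..1}) Y f"
    using f by (simp add: pathin_def)
  have "P 0 1"
  proof (rule Bolzano)
    show "(0::real) \<le> 1" by simp
  next
    fix a b c assume ab: "P a b" and bc: "P b c" and le: "a \<le> b" "b \<le> c"
    show "P a c" unfolding P_def
    proof (intro impI ballI)
      fix x assume ac: "0 \<le> a \<and> a \<le> c \<and> c \<le> 1" and x: "x \<in> topspace X" "q x = f a"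
      obtain F where F: "continuous_map (top_of_set {a..b}) X F" "F a = x" "\<And>t. t \<in> {a..b} \<Longrightarrow> q (F t) = f t"
        using ab ac le x unfolding P_def by (meson order.trans)
      have "F b \<in> topspace X" "q (F b) = f b"
        using F le by (auto simp: continuous_map_def)
      then obtain G where G: "continuous_map (top_of_set {b..c}) X G" "G b = F b" "\<And>t. t \<in> {b..c} \<Longrightarrow> q (G t) = f t"
        using bc ac le unfolding P_def by (meson order.trans)
      have "continuous_map (top_of_set {a..c}) X (\<lambda>t. if t \<le> b then F t else G t)"
      proof (rule continuous_map_cases_le)
        show "continuous_map (subtopology (top_of_set {a..c}) {x \<in> topspace (top_of_set {a..c}). x \<le> b}) X F"
          by (auto simp: subtopology_subtopology intro: continuous_map_from_subtopology_mono[OF F(1)])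
        show "continuous_map (subtopology (top_of_set {a..c}) {x \<in> topspace (top_of_set {a..c}). b \<le> x}) X G"
          by (auto simp: subtopology_subtopology intro: continuous_map_from_subtopology_mono[OF G(1)])
      qed (use G in auto)
      then show "\<exists>F. continuous_map (top_of_set {a..c}) X F \<and> F a = x \<and> (\<forall>t\<in>{a..c}. q (F t) = f t)"
        using F G le by (intro exI[of _ "\<lambda>t. if t \<le> b then F t else G t"]) auto
    qed
  next
    fix t :: real assume t: "0 \<le> t" "t \<le> 1"
    then have "f t \<in> topspace Y"
      using fc by (auto simp: continuous_map_def)
    then obtain U where U: "openin Y U" "f t \<in> U" and
      S: "\<And>x. x \<in> topspace X \<Longrightarrow> q x \<in> U \<Longrightarrow>
       \<exists>\<sigma>. continuous_map (subtopology Y U) X \<sigma> \<and> \<sigma> (q x) = x \<and>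
                (\<forall>y\<in>U. q (\<sigma> y) = y) \<and> openin X (\<sigma> ` U)"
      using covering_evenly[OF cov] by blast
    have "openin (top_of_set {0..1}) {s \<in> {0..1}. f s \<in> U}"
      using openin_continuous_map_preimage[OF fc U(1)] by simp
    then obtain d where d: "d > 0" "\<And>s. s \<in> {0..1} \<Longrightarrow> dist s t < d \<Longrightarrow> f s \<in> U"
      using U(2) t unfolding openin_euclidean_subtopology_iff by auto
    have "P a b" if ab: "a \<le> t" "t \<le> b" "b - a < d" for a b
      unfolding P_def
    proof (intro impI ballI)
      fix x assume ac: "0 \<le> a \<and> a \<le> b \<and> b \<le> 1" and x: "x \<in> topspace X" "q x = f a"
      have fU: "f s \<in> U" if "s \<in> {a..b}" for s
        using that ab ac by (intro d(2)) (auto simp: dist_real_def)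
      then obtain \<sigma> where s: "continuous_map (subtopology Y U) X \<sigma>" "\<sigma> (q x) = x" "\<And>y. y \<in> U \<Longrightarrow> q (\<sigma> y) = y"
        using S[OF x(1)] x(2) ac by fastforce
      have "continuous_map (top_of_set {a..b}) (subtopology Y U) f"
        using ac fU by (auto simp: continuous_map_in_subtopology intro!: continuous_map_from_subtopology_mono[OF fc])
      then have "continuous_map (top_of_set {a..b}) X (\<sigma> \<circ> f)"
        using s(1) by (rule continuous_map_compose)
      then show "\<exists>F. continuous_map (top_of_set {a..b}) X F \<and> F a = x \<and> (\<forall>t\<in>{a..b}. q (F t) = f t)"
        using s x fU by (intro exI[of _ "\<sigma> \<circ> f"]) auto
    qed
    then show "\<exists>d>0. \<forall>a b. a \<le> t \<and> t \<le> b \<and> b - a < d \<longrightarrow> P a b"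
      using d(1) by blast
  qed
  with x that show ?thesis
    unfolding P_def pathin_def by (metis order.refl zero_le_one)
qed

text \<open>The paths \<open>t\<close> to \<open>f (z, t)\<close> are lifted separately for each
  \<open>z\<close>. Unique lifting then shows that these lifts are locally a section composed with
  \<open>f\<close>, which gives joint continuity.\<close>

lemma covering_homotopy_lift:
  assumes cov: "covering X Y q"
    and f: "continuous_map (prod_topology Z (top_of_set {0..1})) Y f"
    and g: "continuous_map Z X g" and gq: "\<And>z. z \<in> topspace Z \<Longrightarrow> q (g z) = f (z, 0::real)"
  obtains F where "continuous_map (prod_topology Z (top_of_set {0..1})) X F"
    "\<And>z. z \<in> topspace Z \<Longrightarrow> F (z, 0) = g z"
    "\<And>z t. z \<in> topspace Z \<Longrightarrow> t \<in> {0..1} \<Longrightarrow> q (F (z, t)) = f (z, t)"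
proof -
  let ?I = "top_of_set {0..1::real}"
  have "\<exists>F. pathin X F \<and> F 0 = g z \<and> (\<forall>t\<in>{0..1}. q (F t) = f (z, t))" if z: "z \<in> topspace Z" for z
  proof -
    have "continuous_map ?I (prod_topology Z ?I) (\<lambda>t. (z, t))"
      using z by (intro continuous_intros) auto
    then have "continuous_map ?I Y (f \<circ> (\<lambda>t. (z, t)))"
      using f by (rule continuous_map_compose)
    then have "pathin Y (\<lambda>t. f (z, t))"
      by (simp add: pathin_def o_def)
    moreover have "g z \<in> topspace X"
      using g z by (auto simp: continuous_map_def)
    ultimately show ?thesis
      using covering_path_lift[OF cov, of "\<lambda>t. f (z, t)" "g z"] gq[OF z] by metis
  qed
  then obtain F' where F': "\<And>z. z \<in> topspace Z \<Longrightarrow> pathin X (F' z)" "\<And>z. z \<in> topspace Z \<Longrightarrow> F' z 0 = g z"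
    "\<And>z t. z \<in> topspace Z \<Longrightarrow> t \<in> {0..1} \<Longrightarrow> q (F' z t) = f (z, t)"
    by metis
  define F where "F = (\<lambda>(z, t). F' z t)"
  have loc: "\<exists>N. openin Z N \<and> z0 \<in> N \<and> continuous_map (subtopology (prod_topology Z ?I) (N \<times> {0..1})) X F"
    if z0: "z0 \<in> topspace Z" for z0
  proof -
    \<comment> \<open>Continuity is propagated in time: from continuity in \<open>z\<close> at the
      single time \<open>a\<close> to joint continuity over \<open>[a, b]\<close>, where the
      neighbourhood of \<open>z0\<close> may shrink. This form is additive in the interval.\<close>
    define P where "P a b \<longleftrightarrow> (0 \<le> a \<and> a \<le> b \<and> b \<le> 1 \<longrightarrow>
        (\<exists>N. openin Z N \<and> z0 \<in> N \<and> continuous_map (subtopology Z N) X (\<lambda>z. F (z, a))) \<longrightarrow>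
        (\<exists>N. openin Z N \<and> z0 \<in> N \<and> continuous_map (subtopology (prod_topology Z ?I) (N \<times> {a..b})) X F))"
      for a b :: real
    have "P 0 1"
    proof (rule Bolzano)
      show "(0::real) \<le> 1" by simp
    next
      fix a b c assume ab: "P a b" and bc: "P b c" and le: "a \<le> b" "b \<le> c"
      show "P a c" unfolding P_def
      proof (intro impI)
        assume ac: "0 \<le> a \<and> a \<le> c \<and> c \<le> 1"
          and "\<exists>N. openin Z N \<and> z0 \<in> N \<and> continuous_map (subtopology Z N) X (\<lambda>z. F (z, a))"
        then obtain N1 where N1: "openin Z N1" "z0 \<in> N1"
          and c1: "continuous_map (subtopology (prod_topology Z ?I) (N1 \<times> {a..b})) X F"
          using ab le unfolding P_def by force
        have "continuous_map (subtopology Z N1) (subtopology (prod_topology Z ?I) (N1 \<times> {a..b})) (\<lambda>z. (z, b))"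
          unfolding continuous_map_in_subtopology continuous_map_pairwise o_def
          using le ac by (auto intro: continuous_map_from_subtopology)
        from continuous_map_compose[OF this c1]
        have "continuous_map (subtopology Z N1) X (\<lambda>z. F (z, b))"
          by (simp add: o_def)
        then obtain N2 where N2: "openin Z N2" "z0 \<in> N2"
          and c2: "continuous_map (subtopology (prod_topology Z ?I) (N2 \<times> {b..c})) X F"
          using bc le ac N1 unfolding P_def by force
        let ?Q = "subtopology (prod_topology Z ?I) ((N1 \<inter> N2) \<times> {a..c})"
        have "continuous_map ?Q X (\<lambda>x. if snd x \<le> b then F x else F x)"
        proof (rule continuous_map_cases_le)
          show "continuous_map ?Q euclideanreal snd"
            using continuous_map_into_fulltopology[OF continuous_map_snd[of Z ?I]]
            by (intro continuous_map_from_subtopology) (simp add: continuous_map_in_subtopology)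
          show "continuous_map (subtopology ?Q {x \<in> topspace ?Q. snd x \<le> b}) X F"
            unfolding subtopology_subtopology
            by (rule continuous_map_from_subtopology_mono[OF c1]) auto
          show "continuous_map (subtopology ?Q {x \<in> topspace ?Q. b \<le> snd x}) X F"
            unfolding subtopology_subtopology
            by (rule continuous_map_from_subtopology_mono[OF c2]) auto
        qed auto
        then show "\<exists>N. openin Z N \<and> z0 \<in> N \<and> continuous_map (subtopology (prod_topology Z ?I) (N \<times> {a..c})) X F"
          using N1 N2 by (intro exI[of _ "N1 \<inter> N2"]) auto
      qed
    next
      fix t :: real assume t: "0 \<le> t" "t \<le> 1"
      then have "f (z0, t) \<in> topspace Y"
        using f z0 by (auto simp: continuous_map_def)
      then obtain U where U: "openin Y U" "f (z0, t) \<in> U" and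
        S: "\<And>x. x \<in> topspace X \<Longrightarrow> q x \<in> U \<Longrightarrow>
         \<exists>\<sigma>. continuous_map (subtopology Y U) X \<sigma> \<and> \<sigma> (q x) = x \<and>
                  (\<forall>y\<in>U. q (\<sigma> y) = y) \<and> openin X (\<sigma> ` U)"
        using covering_evenly[OF cov] by blast
      have "openin (prod_topology Z ?I) {x \<in> topspace (prod_topology Z ?I). f x \<in> U}"
        using openin_continuous_map_preimage[OF f U(1)] .
      moreover have "(z0, t) \<in> {x \<in> topspace (prod_topology Z ?I). f x \<in> U}"
        using z0 t U(2) by auto
      ultimately obtain N0 J where NJ: "openin Z N0" "openin ?I J" "z0 \<in> N0" "t \<in> J"
        "N0 \<times> J \<subseteq> {x \<in> topspace (prod_topology Z ?I). f x \<in> U}"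
        unfolding openin_prod_topology_alt by (smt (verit, best))
      then obtain d where d: "d > 0" "\<And>s. s \<in> {0..1} \<Longrightarrow> dist s t < d \<Longrightarrow> s \<in> J"
        unfolding openin_euclidean_subtopology_iff by metis
      have "P a b" if ab: "a \<le> t" "t \<le> b" "b - a < d" for a b
        unfolding P_def
      proof (intro impI)
        assume ac: "0 \<le> a \<and> a \<le> b \<and> b \<le> 1"
          and "\<exists>N. openin Z N \<and> z0 \<in> N \<and> continuous_map (subtopology Z N) X (\<lambda>z. F (z, a))"
        then obtain N1 where N1: "openin Z N1" "z0 \<in> N1"
          and c1: "continuous_map (subtopology Z N1) X (\<lambda>z. F (z, a))" by blast
        have fU: "f (z, s) \<in> U" if "z \<in> N0" "s \<in> {a..b}" for z s
        proof -
          have "s \<in> J" using that ab ac by (intro d(2)) (auto simp: dist_real_def)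
          then show ?thesis using NJ(5) that by blast
        qed
        have N1sub: "N1 \<subseteq> topspace Z" "N0 \<subseteq> topspace Z"
          using N1(1) NJ(1) by (auto dest: openin_subset)
        have Fa: "F (z0, a) \<in> topspace X" "q (F (z0, a)) = f (z0, a)"
          using c1 N1 N1sub F'(3)[OF z0, of a] ac by (auto simp: continuous_map_def F_def)
        then obtain \<sigma> where s: "continuous_map (subtopology Y U) X \<sigma>" "\<sigma> (q (F (z0, a))) = F (z0, a)"
            "\<And>y. y \<in> U \<Longrightarrow> q (\<sigma> y) = y" "openin X (\<sigma> ` U)"
          using S[OF Fa(1)] fU[OF NJ(3), of a] ac by auto
        \<comment> \<open>Only those \<open>z\<close> are kept whose lift at time \<open>a\<close>
          lies on the sheet of \<open>F (z0, a)\<close>. They form an open set because the sheet is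
          open.\<close>
        define N where "N = N0 \<inter> {z \<in> topspace (subtopology Z N1). F (z, a) \<in> \<sigma> ` U}"
        have oN: "openin Z N"
          unfolding N_def using openin_continuous_map_preimage[OF c1 s(4)] N1(1) NJ(1)
          by (meson openin_Int openin_trans_full)
        have z0N: "z0 \<in> N"
        proof -
          have "F (z0, a) \<in> \<sigma> ` U"
            using s(2) Fa fU[OF NJ(3), of a] ac by (metis atLeastAtMost_iff image_eqI order_refl)
          then show ?thesis using z0 N1 NJ by (simp add: N_def)
        qed
        have feq: "F (z, s) = \<sigma> (f (z, s))" if z: "z \<in> N" and "s \<in> {a..b}" for z s
        proof -
          have zN0: "z \<in> N0" "z \<in> topspace Z" using z N1sub by (auto simp: N_def)
          have cf: "continuous_map (top_of_set {a..b}) (prod_topology Z ?I) (\<lambda>t. (z, t))"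
            using zN0 ac by (auto simp: continuous_map_pairwise o_def continuous_map_in_subtopology)
          have "continuous_map (top_of_set {a..b}) (subtopology Y U) (\<lambda>t. f (z, t))"
            using continuous_map_compose[OF cf f] zN0 fU by (auto simp: continuous_map_in_subtopology o_def)
          from continuous_map_compose[OF this s(1)]
          have c2: "continuous_map (top_of_set {a..b}) X (\<lambda>t. \<sigma> (f (z, t)))" by (simp add: o_def)
          have c1: "continuous_map (top_of_set {a..b}) X (\<lambda>t. F (z, t))"
            using continuous_map_from_subtopology_mono[OF F'(1)[OF zN0(2), unfolded pathin_def], of "{a..b}"] ac
            by (simp add: F_def)
          have Fza: "F (z, a) = \<sigma> (f (z, a))"
          proof -
            obtain y where "y \<in> U" "F (z, a) = \<sigma> y" using z unfolding N_def by auto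
            moreover have "q (F (z, a)) = f (z, a)"
              using F'(3)[OF zN0(2), of a] ac by (auto simp: F_def)
            ultimately show ?thesis using s(3) by metis
          qed
          show ?thesis
          proof (rule covering_lift_unique[OF cov _ c1 c2, of a])
            show "connected_space (top_of_set {a..b})" by (rule connected_space_interval)
            show "\<And>t. t \<in> topspace (top_of_set {a..b}) \<Longrightarrow> q (F (z, t)) = q (\<sigma> (f (z, t)))"
              using F'(3)[OF zN0(2)] s(3) fU[OF zN0(1)] ac by (auto simp: F_def)
          qed (use that ac Fza in auto)
        qed
        let ?Q = "subtopology (prod_topology Z ?I) (N \<times> {a..b})"
        have "continuous_map ?Q (subtopology Y U) f"
          using f fU by (auto simp: continuous_map_in_subtopology N_def intro: continuous_map_from_subtopology)
        then have "continuous_map ?Q X (\<sigma> \<circ> f)"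
          using s(1) by (rule continuous_map_compose)
        then have "continuous_map ?Q X F"
          by (rule continuous_map_eq) (use feq in auto)
        with oN z0N show "\<exists>N. openin Z N \<and> z0 \<in> N \<and> continuous_map (subtopology (prod_topology Z ?I) (N \<times> {a..b})) X F"
          by blast
      qed
      then show "\<exists>d>0. \<forall>a b. a \<le> t \<and> t \<le> b \<and> b - a < d \<longrightarrow> P a b"
        using d(1) by blast
    qed
    moreover have "\<exists>N. openin Z N \<and> z0 \<in> N \<and> continuous_map (subtopology Z N) X (\<lambda>z. F (z, 0))"
      using z0 g F'(2) by (intro exI[of _ "topspace Z"]) (auto simp: F_def intro: continuous_map_eq)
    ultimately show ?thesis unfolding P_def by simp
  qed
  have "continuous_map (prod_topology Z ?I) X F"
  proof -
    obtain N where N: "\<And>z. z \<in> topspace Z \<Longrightarrow> openin Z (N z) \<and> z \<in> N z \<and>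
        continuous_map (subtopology (prod_topology Z ?I) (N z \<times> {0..1})) X F"
      using loc by metis
    show ?thesis
    proof (rule pasting_lemma[where I = "topspace Z" and T = "\<lambda>z. N z \<times> {0..1}" and f = "\<lambda>_. F"])
      show "openin (prod_topology Z ?I) (N i \<times> {0..1})" if "i \<in> topspace Z" for i
        using N[OF that] by (auto simp: openin_prod_Times_iff)
    qed (use N in auto)
  qed
  moreover have "\<And>z. z \<in> topspace Z \<Longrightarrow> F (z, 0) = g z"
    using F'(2) by (simp add: F_def)
  moreover have "\<And>z t. z \<in> topspace Z \<Longrightarrow> t \<in> {0..1} \<Longrightarrow> q (F (z, t)) = f (z, t)"
    using F'(3) by (simp add: F_def)
  ultimately show ?thesis using that by blast
qed

text \<open>The straight contraction to \<open>c\<close> is lifted as a homotopy that starts at the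
  constant map \<open>x\<close>; its final stage is the lift. Starlike domains cover all later uses:
  segments, balls, and convex bodies from which boundary points have been removed.\<close>

lemma covering_starlike_lift:
  fixes S :: "'v::real_normed_vector set"
  assumes cov: "covering X Y q" and c: "c \<in> S" and star: "\<And>y. y \<in> S \<Longrightarrow> closed_segment c y \<subseteq> S"
    and f: "continuous_map (top_of_set S) Y f" and x: "x \<in> topspace X" "q x = f c"
  obtains F where "continuous_map (top_of_set S) X F" "F c = x" "\<And>y. y \<in> S \<Longrightarrow> q (F y) = f y"
proof -
  let ?I = "top_of_set {0..1::real}"
  let ?k = "\<lambda>(y, t). (1 - t) *\<^sub>R c + t *\<^sub>R y"
  have k: "continuous_map (prod_topology (top_of_set S) ?I) (top_of_set S) ?k"
  proof -
    have "continuous_on (S \<times> {0..1}) ?k"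
      unfolding case_prod_unfold by (intro continuous_intros)
    moreover have "?k ` (S \<times> {0..1}) \<subseteq> S"
      using star by (force simp: closed_segment_def)
    ultimately show ?thesis
      by (auto simp: continuous_map_in_subtopology simp flip: subtopology_Times)
  qed
  have "continuous_map (prod_topology (top_of_set S) ?I) Y (f \<circ> ?k)"
    using k f by (rule continuous_map_compose)
  then obtain F where F: "continuous_map (prod_topology (top_of_set S) ?I) X F"
     "\<And>z. z \<in> S \<Longrightarrow> F (z, 0) = x"
     "\<And>z t. z \<in> S \<Longrightarrow> t \<in> {0..1} \<Longrightarrow> q (F (z, t)) = f ((1 - t) *\<^sub>R c + t *\<^sub>R z)"
    using covering_homotopy_lift[OF cov, of "top_of_set S" "f \<circ> ?k" "\<lambda>_. x"] x by auto
  have c1: "continuous_map (top_of_set S) X (\<lambda>y. F (y, 1))"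
  proof -
    have "continuous_map (top_of_set S) (prod_topology (top_of_set S) ?I) (\<lambda>y. (y, 1))"
      by (intro continuous_intros) auto
    from continuous_map_compose[OF this F(1)] show ?thesis by (simp add: o_def)
  qed
  have c2: "continuous_map ?I X (\<lambda>t. F (c, t))"
  proof -
    have "continuous_map ?I (prod_topology (top_of_set S) ?I) (\<lambda>t. (c, t))"
      using c by (intro continuous_intros) auto
    from continuous_map_compose[OF this F(1)] show ?thesis by (simp add: o_def)
  qed
  \<comment> \<open>Over the constant path at \<open>c\<close> the lifted path is constant, by
    uniqueness.\<close>
  have "F (c, 1) = (\<lambda>t. x) 1"
  proof (rule covering_lift_unique[OF cov _ c2, of _ 0])
    show "connected_space ?I" by (rule connected_space_interval)
    show "q (F (c, t)) = q x" if "t \<in> topspace ?I" for t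
      using F(3)[OF c, of t] that x by (simp flip: scaleR_left.add)
  qed (use F(2) c x in auto)
  then show ?thesis
    using that[OF c1] F(3)[of _ 1] by auto
qed

section \<open>Universal covers\<close>

lemma mem_path_classD:
  assumes "q \<in> path_class X p"
  shows "pathin X p" "pathin X q" "q 0 = p 0" "q 1 = p 1"
  using assms homotopic_with_imp_continuous_maps[of _ _ X p q]
    homotopic_with_imp_property[of _ "top_of_set {0..1}" X p q]
  unfolding path_class_def pathin_def by auto

lemma mem_path_class_self: "pathin X p \<Longrightarrow> p \<in> path_class X p"
  by (simp add: path_class_def pathin_def)

lemma path_class_eqI:
  assumes "q \<in> path_class X p"
  shows "path_class X q = path_class X p"
proof -
  have e: "q 0 = p 0" "q 1 = p 1" using mem_path_classD[OF assms] by auto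
  have h: "homotopic_with (\<lambda>r. r 0 = p 0 \<and> r 1 = p 1) (top_of_set {0..1}) X p q"
    using assms by (simp add: path_class_def)
  show ?thesis
    unfolding path_class_def e
    using homotopic_with_trans[OF h] homotopic_with_trans[OF homotopic_with_symD[OF h]] by blast
qed

lemma path_class_eq_imp_mem: "pathin X q \<Longrightarrow> path_class X q = path_class X p \<Longrightarrow> q \<in> path_class X p"
  using mem_path_class_self by blast

lemma ucover_proj_path_class:
  assumes "pathin X p" shows "ucover_proj (path_class X p) = p 1"
  unfolding ucover_proj_def
  by (rule someI2[of "\<lambda>q. q \<in> path_class X p"]) (use assms mem_path_class_self mem_path_classD in fast)+

text \<open>Linear interpolation between the identity and \<theta> stays in the unit interval. Since
  \<open>p'\<close> is prescribed on \<open>{0..1}\<close> only, the choice of the identity for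
  \<theta> also replaces a path by another function that agrees with it there.\<close>

lemma path_class_reparam:
  assumes p: "pathin X p" and th: "continuous_on {0..1} \<theta>" "\<And>t. t \<in> {0..1} \<Longrightarrow> \<theta> t \<in> {0..1}"
    "\<theta> 0 = 0" "\<theta> 1 = 1" and p': "\<And>t. t \<in> {0..1} \<Longrightarrow> p' t = p (\<theta> t)"
  shows "path_class X p' = path_class X p"
proof (rule path_class_eqI)
  let ?I = "top_of_set {0..1::real}"
  let ?k = "\<lambda>(s, t). (1 - s) * t + s * \<theta> t"
  have "continuous_on ({0..1} \<times> {0..1}) ?k"
    unfolding case_prod_unfold
    by (intro continuous_intros continuous_on_compose2[OF th(1)]) auto
  moreover have "?k ` ({0..1} \<times> {0..1}) \<subseteq> {0..1}"
  proof clarify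
    fix s t :: real assume st: "s \<in> {0..1}" "t \<in> {0..1}"
    then have "(1 - s) *\<^sub>R t + s *\<^sub>R \<theta> t \<in> {0..1}"
      using th(2)[OF st(2)] by (intro convexD) auto
    then show "(1 - s) * t + s * \<theta> t \<in> {0..1}" by simp
  qed
  ultimately have "continuous_map (prod_topology ?I ?I) ?I ?k"
    by (auto simp: continuous_map_in_subtopology simp flip: subtopology_Times)
  then have c: "continuous_map (prod_topology ?I ?I) X (p \<circ> ?k)"
    using p unfolding pathin_def by (rule continuous_map_compose)
  show "p' \<in> path_class X p"
    unfolding path_class_def mem_Collect_eq
    by (subst homotopic_with)
       (use c th p' in \<open>auto intro!: exI[of _ "p \<circ> ?k"]\<close>)
qed

lemma pathin_path_concat:
  assumes p: "pathin X p" and q: "pathin X q" and e: "q 0 = p 1"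
  shows "pathin X (path_concat p q)"
  unfolding pathin_def path_concat_def
proof (rule continuous_map_cases_le)
  let ?I = "top_of_set {0..1::real}"
  have "continuous_map (subtopology ?I {x \<in> topspace ?I. x \<le> 1/2}) ?I (\<lambda>t. 2 * t)"
    by (auto simp: continuous_map_in_subtopology subtopology_subtopology intro!: continuous_intros)
  from continuous_map_compose[OF this p[unfolded pathin_def]]
  show "continuous_map (subtopology ?I {x \<in> topspace ?I. x \<le> 1/2}) X (\<lambda>t. p (2 * t))"
    by (simp add: o_def)
  have "continuous_map (subtopology ?I {x \<in> topspace ?I. 1/2 \<le> x}) ?I (\<lambda>t. 2 * t - 1)"
    by (auto simp: continuous_map_in_subtopology subtopology_subtopology intro!: continuous_intros)
  from continuous_map_compose[OF this q[unfolded pathin_def]]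
  show "continuous_map (subtopology ?I {x \<in> topspace ?I. 1/2 \<le> x}) X (\<lambda>t. q (2 * t - 1))"
    by (simp add: o_def)
  fix x :: real assume x: "x = 1/2"
  show "p (2 * x) = q (2 * x - 1)" using e by (simp add: x)
qed auto

lemma path_concat_ends [simp]: "path_concat p q 0 = p 0" "path_concat p q 1 = q 1"
  by (simp_all add: path_concat_def)

lemma path_class_concat_const:
  assumes "pathin X p" shows "path_class X (path_concat p (\<lambda>_. p 1)) = path_class X p"
proof (rule path_class_reparam[OF assms, of "\<lambda>t. min (2 * t) 1"])
  show "path_concat p (\<lambda>_. p 1) t = p (min (2 * t) 1)" for t
    by (auto simp: path_concat_def min_def)
qed (auto intro!: continuous_intros)

lemma path_class_concat_assoc:
  assumes "pathin X p" "pathin X q" "pathin X r" "q 0 = p 1" "r 0 = q 1"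
  shows "path_class X (path_concat p (path_concat q r)) = path_class X (path_concat (path_concat p q) r)"
\<comment> \<open>The required reparametrisation has slopes \<open>1/2\<close>, \<open>1\<close> and
  \<open>2\<close> in this order. It is therefore convex and equals the maximum of its three linear
  pieces.\<close>
proof (rule path_class_reparam[of _ _ "\<lambda>t. max (t/2) (max (t - 1/4) (2 * t - 1))"])
  show "pathin X (path_concat (path_concat p q) r)"
    using assms by (intro pathin_path_concat) auto
  fix t :: real assume t: "t \<in> {0..1}"
  consider "t \<le> 1/2" | "1/2 < t" "t \<le> 3/4" | "3/4 < t" by linarith
  then show "path_concat p (path_concat q r) t
    = path_concat (path_concat p q) r (max (t/2) (max (t - 1/4) (2 * t - 1)))"
  proof cases
    case 1
    then have "max (t/2) (max (t - 1/4) (2 * t - 1)) = t/2" using t by auto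
    then show ?thesis using 1 t by (simp add: path_concat_def)
  next
    case 2
    then have "max (t/2) (max (t - 1/4) (2 * t - 1)) = t - 1/4" using t by auto
    then show ?thesis using 2 t by (simp add: path_concat_def algebra_simps)
  next
    case 3
    then have "max (t/2) (max (t - 1/4) (2 * t - 1)) = 2 * t - 1" using t by auto
    then show ?thesis using 3 t by (simp add: path_concat_def algebra_simps)
  qed
  show "max (t/2) (max (t - 1/4) (2 * t - 1)) \<in> {0..1}"
    using t by (auto simp: le_max_iff_disj)
qed (auto intro!: continuous_intros)

lemma comp_path_concat: "f \<circ> path_concat p q = path_concat (f \<circ> p) (f \<circ> q)"
  by (auto simp: path_concat_def)

section \<open>Topology on path classes and the end point projection\<close>

definition ucover_nbhd :: "'a topology \<Rightarrow> (real \<Rightarrow> 'a) \<Rightarrow> 'a set \<Rightarrow> (real \<Rightarrow> 'a) set set" where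
  "ucover_nbhd X p U = {path_class X (path_concat p q) |q. pathin (subtopology X U) q \<and> q 0 = p 1}"

lemma ucover_topology_alt:
  "ucover_topology X x = topology_generated_by
     {ucover_nbhd X p U |p U. pathin X p \<and> p 0 = x \<and> openin X U \<and> p 1 \<in> U}"
  by (simp add: ucover_topology_def ucover_nbhd_def)

lemma openin_ucover_nbhd:
  assumes "pathin X p" "openin X U" "p 1 \<in> U"
  shows "openin (ucover_topology X (p 0)) (ucover_nbhd X p U)"
  unfolding ucover_topology_alt by (rule topology_generated_by_Basis) (use assms in blast)

lemma path_class_in_ucover_nbhd:
  assumes "pathin X p" "p 1 \<in> U"
  shows "path_class X p \<in> ucover_nbhd X p U"
  using path_class_concat_const[OF assms(1)] assms path_finish_in_topspace[OF assms(1)]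
  unfolding ucover_nbhd_def
  by (auto intro!: exI[of _ "\<lambda>_. p 1"])

lemma ucover_nbhdE:
  assumes "c \<in> ucover_nbhd X p U" "pathin X p"
  obtains q where "pathin X q" "\<And>t. t \<in> {0..1} \<Longrightarrow> q t \<in> U" "q 0 = p 1" "pathin X (path_concat p q)"
    "c = path_class X (path_concat p q)"
  using assms pathin_path_concat unfolding ucover_nbhd_def pathin_subtopology by blast

lemma ucover_nbhd_path:
  assumes "c \<in> ucover_nbhd X p U" "pathin X p"
  obtains p' where "pathin X p'" "p' 0 = p 0" "p' 1 \<in> U" "c = path_class X p'"
proof -
  obtain q where "\<And>t. t \<in> {0..1} \<Longrightarrow> q t \<in> U" "pathin X (path_concat p q)"
    "c = path_class X (path_concat p q)"
    using assms by (rule ucover_nbhdE) blast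
  then show ?thesis by (intro that[of "path_concat p q"]) auto
qed

lemma topspace_ucover_topology:
  "topspace (ucover_topology X x) = {path_class X p |p. pathin X p \<and> p 0 = x}" (is "?L = ?R")
proof
  show "?L \<subseteq> ?R"
  proof
    fix c assume "c \<in> ?L"
    then obtain p U where "pathin X p" "p 0 = x" "c \<in> ucover_nbhd X p U"
      unfolding ucover_topology_alt by auto
    then show "c \<in> ?R"
      by (elim ucover_nbhd_path) auto
  qed
  show "?R \<subseteq> ?L"
  proof clarify
    fix p assume p: "pathin X p" "x = p 0"
    have p1: "p 1 \<in> topspace X" using p(1) by (rule path_finish_in_topspace)
    have "path_class X p \<in> ucover_nbhd X p (topspace X)"
      using p(1) p1 by (rule path_class_in_ucover_nbhd)
    moreover have "openin (ucover_topology X (p 0)) (ucover_nbhd X p (topspace X))"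
      using openin_ucover_nbhd[OF p(1) openin_topspace p1] .
    ultimately show "path_class X p \<in> topspace (ucover_topology X (p 0))"
      using openin_subset by blast
  qed
qed

lemma continuous_map_ucover_proj: "continuous_map (ucover_topology X x) X ucover_proj"
  unfolding continuous_map_def
proof (intro conjI allI impI)
  show "ucover_proj \<in> topspace (ucover_topology X x) \<rightarrow> topspace X"
    unfolding topspace_ucover_topology
  proof clarify
    fix p assume "pathin X p"
    then show "ucover_proj (path_class X p) \<in> topspace X"
      by (simp add: ucover_proj_path_class path_finish_in_topspace)
  qed
  fix U assume U: "openin X U"
  let ?P = "{c \<in> topspace (ucover_topology X x). ucover_proj c \<in> U}"
  show "openin (ucover_topology X x) ?P"
  proof (subst openin_subopen, intro ballI)
    fix c assume "c \<in> ?P"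
    then obtain p where p: "pathin X p" "p 0 = x" "c = path_class X p" "p 1 \<in> U"
      unfolding topspace_ucover_topology using ucover_proj_path_class[of X] by auto
    have "ucover_nbhd X p U \<subseteq> ?P"
    proof
      fix d assume "d \<in> ucover_nbhd X p U"
      then obtain p' where "pathin X p'" "p' 0 = p 0" "p' 1 \<in> U" "d = path_class X p'"
        using p(1) by (rule ucover_nbhd_path)
      then show "d \<in> ?P"
        unfolding topspace_ucover_topology using p(2) by (auto simp: ucover_proj_path_class)
    qed
    then show "\<exists>T. openin (ucover_topology X x) T \<and> c \<in> T \<and> T \<subseteq> ?P"
      using openin_ucover_nbhd[OF p(1) U p(4)] path_class_in_ucover_nbhd[OF p(1,4)] p(2,3) by blast
  qed
qed

section \<open>Maps between universal covers induced by coverings\<close>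

definition ucover_map :: "'b topology \<Rightarrow> ('a \<Rightarrow> 'b) \<Rightarrow> (real \<Rightarrow> 'a) set \<Rightarrow> (real \<Rightarrow> 'b) set" where
  "ucover_map Y q c = path_class Y (q \<circ> (SOME p. p \<in> c))"

lemma path_class_compose:
  assumes q: "continuous_map X Y q" and r: "r \<in> path_class X p"
  shows "q \<circ> r \<in> path_class Y (q \<circ> p)"
proof -
  have "homotopic_with (\<lambda>r. r 0 = p 0 \<and> r 1 = p 1) (top_of_set {0..1}) X p r"
    using r by (simp add: path_class_def)
  from homotopic_with_compose_continuous_map_left[OF this q, of "\<lambda>r. r 0 = q (p 0) \<and> r 1 = q (p 1)"]
  show ?thesis by (auto simp: path_class_def)
qed

lemma ucover_map_path_class:
  assumes q: "continuous_map X Y q" and p: "pathin X p"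
  shows "ucover_map Y q (path_class X p) = path_class Y (q \<circ> p)"
proof -
  have "(SOME r. r \<in> path_class X p) \<in> path_class X p"
    using someI[of "\<lambda>r. r \<in> path_class X p" p] mem_path_class_self[OF p] by simp
  then show ?thesis
    unfolding ucover_map_def using q by (intro path_class_eqI path_class_compose)
qed

text \<open>The homotopy between the projected paths lifts. Unique lifting identifies the first and
  last stage of the lift with \<open>p\<close> and \<open>p'\<close> and shows that the end point
  does not move.\<close>

lemma covering_path_class_inj:
  assumes cov: "covering X Y q" and p: "pathin X p" and p': "pathin X p'" and e: "p' 0 = p 0"
    and h: "q \<circ> p' \<in> path_class Y (q \<circ> p)"
  shows "path_class X p' = path_class X p"
proof (rule path_class_eqI)
  let ?I = "top_of_set {0..1::real}"
  have "homotopic_with (\<lambda>r. r 0 = q (p 0) \<and> r 1 = q (p 1)) ?I Y (q \<circ> p) (q \<circ> p')"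
    using h by (simp add: path_class_def)
  then obtain k where k: "continuous_map (prod_topology ?I ?I) Y k"
    "\<And>t. k (0, t) = q (p t)" "\<And>t. k (1, t) = q (p' t)"
    "\<And>s. s \<in> {0..1} \<Longrightarrow> k (s, 0) = q (p 0)" "\<And>s. s \<in> {0..1} \<Longrightarrow> k (s, 1) = q (p 1)"
    unfolding homotopic_with_def by auto
  have p0: "p 0 \<in> topspace X" and p1: "p 1 \<in> topspace X"
    using p path_start_in_topspace path_finish_in_topspace by auto
  obtain F where F: "continuous_map (prod_topology ?I ?I) X F" "\<And>s. s \<in> {0..1} \<Longrightarrow> F (s, 0) = p 0"
    "\<And>s t. s \<in> {0..1} \<Longrightarrow> t \<in> {0..1} \<Longrightarrow> q (F (s, t)) = k (s, t)"
    using covering_homotopy_lift[OF cov k(1), of "\<lambda>_. p 0"] p0 k(4) by auto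
  have cF: "continuous_map ?I X (\<lambda>t. F (s, t))" if "s \<in> {0..1}" for s
  proof -
    have "continuous_map ?I (prod_topology ?I ?I) (\<lambda>t. (s, t))"
      using that by (intro continuous_intros) auto
    from continuous_map_compose[OF this F(1)] show ?thesis by (simp add: o_def)
  qed
  have F0: "F (0, t) = p t" if "t \<in> {0..1}" for t
    by (rule covering_lift_unique[OF cov connected_space_interval cF p[unfolded pathin_def], of _ 0])
       (use that F k in auto)
  have F1: "F (1, t) = p' t" if "t \<in> {0..1}" for t
    by (rule covering_lift_unique[OF cov connected_space_interval cF p'[unfolded pathin_def], of _ 0])
       (use that F k e in auto)
  have cG: "continuous_map ?I X (\<lambda>s. F (s, 1))"
  proof -
    have "continuous_map ?I (prod_topology ?I ?I) (\<lambda>s. (s, 1))"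
      by (intro continuous_intros) auto
    from continuous_map_compose[OF this F(1)] show ?thesis by (simp add: o_def)
  qed
  have G: "F (s, 1) = p 1" if "s \<in> {0..1}" for s
    by (rule covering_lift_unique[OF cov connected_space_interval cG, of "\<lambda>_. p 1" 0])
       (use that F k F0[of 1] p1 in auto)
  show "p' \<in> path_class X p"
    unfolding path_class_def mem_Collect_eq
    by (subst homotopic_with) (use F F0 F1 G in \<open>auto intro!: exI[of _ F]\<close>)
qed

lemma ucover_proj_ucover_map:
  assumes "continuous_map X Y q" "c \<in> topspace (ucover_topology X x)"
  shows "ucover_proj (ucover_map Y q c) = q (ucover_proj c)"
proof -
  obtain p where p: "pathin X p" "c = path_class X p"
    using assms(2) unfolding topspace_ucover_topology by blast
  then show ?thesis
    using ucover_map_path_class[OF assms(1) p(1)] pathin_compose[OF p(1) assms(1)]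
    by (simp add: ucover_proj_path_class)
qed

text \<open>This gives continuity of the induced map. For the inclusion from left to right the path
  \<open>s\<close> appended downstairs is lifted from \<open>p 1\<close>, and
  \<open>covering_path_class_inj\<close> identifies the resulting class.\<close>

lemma ucover_map_vimage_nbhd:
  assumes cov: "covering X Y q" and p: "pathin X p" "p 0 = x"
  shows "ucover_map Y q -` ucover_nbhd Y (q \<circ> p) U \<inter> topspace (ucover_topology X x)
           = ucover_nbhd X p {z \<in> topspace X. q z \<in> U}" (is "?L = ?R")
proof
  have q: "continuous_map X Y q" using cov by (rule covering_imp_continuous_map)
  show "?L \<subseteq> ?R"
  proof
    fix c assume c: "c \<in> ?L"
    then obtain p2 where p2: "pathin X p2" "p2 0 = x" "c = path_class X p2"
      unfolding topspace_ucover_topology by blast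
    have "path_class Y (q \<circ> p2) \<in> ucover_nbhd Y (q \<circ> p) U"
      using c p2 ucover_map_path_class[OF q p2(1)] by simp
    then obtain s where s: "pathin Y s" "\<And>t. t \<in> {0..1} \<Longrightarrow> s t \<in> U" "s 0 = (q \<circ> p) 1"
      "pathin Y (path_concat (q \<circ> p) s)"
      "path_class Y (q \<circ> p2) = path_class Y (path_concat (q \<circ> p) s)"
      using ucover_nbhdE[OF _ pathin_compose[OF p(1) q]] by blast
    obtain r where r: "pathin X r" "r 0 = p 1" "\<And>t. t \<in> {0..1} \<Longrightarrow> q (r t) = s t"
      using covering_path_lift[OF cov s(1), of "p 1"] s(3) path_finish_in_topspace[OF p(1)] by auto
    have pr: "pathin X (path_concat p r)"
      using p r by (intro pathin_path_concat) auto
    have "path_class Y (path_concat (q \<circ> p) s) = path_class Y (q \<circ> path_concat p r)"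
      by (rule path_class_reparam[OF pathin_compose[OF pr q], of "\<lambda>t. t"])
         (use r in \<open>auto simp: path_concat_def\<close>)
    then have "path_class X p2 = path_class X (path_concat p r)"
      using s(5) p p2 by (intro covering_path_class_inj[OF cov pr p2(1)])
        (auto intro!: path_class_eq_imp_mem pathin_compose[OF _ q])
    then show "c \<in> ?R"
      unfolding ucover_nbhd_def pathin_subtopology p2(3) using r s path_image_subset_topspace[OF r(1)]
      by (auto intro!: exI[of _ r] simp: Pi_iff)
  qed
  show "?R \<subseteq> ?L"
  proof
    fix c assume "c \<in> ?R"
    then obtain r where r: "pathin X r" "\<And>t. t \<in> {0..1} \<Longrightarrow> q (r t) \<in> U" "r 0 = p 1"
      "pathin X (path_concat p r)" "c = path_class X (path_concat p r)"
      using ucover_nbhdE[OF _ p(1), of c "{z \<in> topspace X. q z \<in> U}"] by (smt (verit) mem_Collect_eq)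
    have "c \<in> topspace (ucover_topology X x)"
      unfolding topspace_ucover_topology using r p by (auto intro!: exI[of _ "path_concat p r"])
    moreover have "ucover_map Y q c \<in> ucover_nbhd Y (q \<circ> p) U"
      using ucover_map_path_class[OF q r(4)] r pathin_compose[OF r(1) q]
      unfolding ucover_nbhd_def pathin_subtopology r(5) comp_path_concat
      by (auto intro!: exI[of _ "q \<circ> r"])
    ultimately show "c \<in> ?L" by simp
  qed
qed

text \<open>This gives continuity of the inverse of the induced map. A short path appended
  downstairs is lifted by a section through the end point upstairs and then appended to
  \<open>r\<close>.\<close>

lemma ucover_map_image_nbhd_open:
  assumes cov: "covering X Y q" and p: "pathin X p" "p 0 = x" and U: "openin X U"
  shows "openin (ucover_topology Y (q x)) (ucover_map Y q ` ucover_nbhd X p U)"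
proof (subst openin_subopen, intro ballI)
  have q: "continuous_map X Y q" using cov by (rule covering_imp_continuous_map)
  fix c assume "c \<in> ucover_map Y q ` ucover_nbhd X p U"
  then obtain r where r: "pathin X r" "\<And>t. t \<in> {0..1} \<Longrightarrow> r t \<in> U" "r 0 = p 1"
      "pathin X (path_concat p r)" "c = ucover_map Y q (path_class X (path_concat p r))"
    using ucover_nbhdE[OF _ p(1)] by blast
  then have c: "c = path_class Y (q \<circ> path_concat p r)"
    using ucover_map_path_class[OF q] by metis
  have r1: "r 1 \<in> topspace X" "q (r 1) \<in> topspace Y"
    using path_finish_in_topspace[OF r(1)] q by (auto simp: continuous_map_def)
  obtain W where W: "openin Y W" "q (r 1) \<in> W" and
    S: "\<And>x. x \<in> topspace X \<Longrightarrow> q x \<in> W \<Longrightarrow>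
       \<exists>\<sigma>. continuous_map (subtopology Y W) X \<sigma> \<and> \<sigma> (q x) = x \<and>
                (\<forall>y\<in>W. q (\<sigma> y) = y) \<and> openin X (\<sigma> ` W)"
    using covering_evenly[OF cov r1(2)] by blast
  obtain \<sigma> where s: "continuous_map (subtopology Y W) X \<sigma>" "\<sigma> (q (r 1)) = r 1" "\<And>y. y \<in> W \<Longrightarrow> q (\<sigma> y) = y"
    using S[OF r1(1) W(2)] by blast
  \<comment> \<open>The section through \<open>r 1\<close> sends \<open>W'\<close> into
    \<open>U\<close>, so paths inside \<open>W'\<close> lift to paths inside
    \<open>U\<close>.\<close>
  define W' where "W' = {y \<in> topspace (subtopology Y W). \<sigma> y \<in> U}"
  have W': "openin Y W'"
    unfolding W'_def using openin_continuous_map_preimage[OF s(1) U] W(1) by (rule openin_trans_full)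
  have r1W': "q (r 1) \<in> W'"
    using W r1 s r(2)[of 1] by (simp add: W'_def)
  let ?p = "q \<circ> path_concat p r"
  have pp: "pathin Y ?p" using r(4) q by (rule pathin_compose)
  have "openin (ucover_topology Y (q x)) (ucover_nbhd Y ?p W')"
    using openin_ucover_nbhd[OF pp W'] r1W' p by simp
  moreover have "c \<in> ucover_nbhd Y ?p W'"
    unfolding c using r1W' by (intro path_class_in_ucover_nbhd[OF pp]) simp
  moreover have "ucover_nbhd Y ?p W' \<subseteq> ucover_map Y q ` ucover_nbhd X p U"
  proof
    fix d assume "d \<in> ucover_nbhd Y ?p W'"
    then obtain v where v: "pathin Y v" "\<And>t. t \<in> {0..1} \<Longrightarrow> v t \<in> W'" "v 0 = ?p 1"
      "d = path_class Y (path_concat ?p v)"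
      using ucover_nbhdE[OF _ pp] by blast
    have "pathin (subtopology Y W) v"
      using v by (auto simp: pathin_subtopology W'_def)
    from pathin_compose[OF this s(1)]
    have sv: "pathin X (\<sigma> \<circ> v)" .
    have rv: "pathin X (path_concat r (\<sigma> \<circ> v))"
      using r(1) sv by (rule pathin_path_concat) (use v s in auto)
    have prv: "pathin X (path_concat (path_concat p r) (\<sigma> \<circ> v))"
      using r(4) sv by (rule pathin_path_concat) (use v s in auto)
    have "d = path_class Y (q \<circ> path_concat (path_concat p r) (\<sigma> \<circ> v))"
      unfolding v(4)
      by (rule path_class_reparam[OF pathin_compose[OF prv q], of "\<lambda>t. t"])
         (use v s in \<open>auto simp: path_concat_def W'_def\<close>)
    also have "\<dots> = ucover_map Y q (path_class X (path_concat (path_concat p r) (\<sigma> \<circ> v)))"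
      using ucover_map_path_class[OF q prv] by simp
    also have "path_class X (path_concat (path_concat p r) (\<sigma> \<circ> v)) = path_class X (path_concat p (path_concat r (\<sigma> \<circ> v)))"
      by (rule path_class_concat_assoc[symmetric]) (use p r sv v s in auto)
    finally have "d = ucover_map Y q (path_class X (path_concat p (path_concat r (\<sigma> \<circ> v))))" .
    moreover have "path_concat r (\<sigma> \<circ> v) t \<in> U" if "t \<in> {0..1}" for t
      using that r(2) v(2) by (auto simp: path_concat_def W'_def)
    then have "path_class X (path_concat p (path_concat r (\<sigma> \<circ> v))) \<in> ucover_nbhd X p U"
      unfolding ucover_nbhd_def pathin_subtopology using rv r(3)
      by (auto intro!: exI[of _ "path_concat r (\<sigma> \<circ> v)"])
    ultimately show "d \<in> ucover_map Y q ` ucover_nbhd X p U" by blast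
  qed
  ultimately show "\<exists>T. openin (ucover_topology Y (q x)) T \<and> c \<in> T \<and> T \<subseteq> ucover_map Y q ` ucover_nbhd X p U"
    by blast
qed

text \<open>Points of either universal cover are classes of paths from the base point, and along a
  covering both paths and homotopies lift; hence the bijection. The two preceding lemmas compare the
  basic open sets.\<close>

theorem homeomorphic_map_ucover_map:
  assumes cov: "covering X Y q" and x: "x \<in> topspace X"
  shows "homeomorphic_map (ucover_topology X x) (ucover_topology Y (q x)) (ucover_map Y q)"
proof -
  let ?X = "ucover_topology X x" and ?Y = "ucover_topology Y (q x)" and ?f = "ucover_map Y q"
  have q: "continuous_map X Y q" using cov by (rule covering_imp_continuous_map)
  have fim: "?f ` topspace ?X = topspace ?Y"
  proof
    show "?f ` topspace ?X \<subseteq> topspace ?Y"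
      unfolding topspace_ucover_topology
    proof clarify
      fix p assume p: "pathin X p" "x = p 0"
      have "pathin Y (q \<circ> p)" using p(1) q by (rule pathin_compose)
      moreover have "ucover_map Y q (path_class X p) = path_class Y (q \<circ> p)"
        using q p(1) by (rule ucover_map_path_class)
      ultimately show "\<exists>r. ucover_map Y q (path_class X p) = path_class Y r \<and> pathin Y r \<and> r 0 = q (p 0)"
        by (intro exI[of _ "q \<circ> p"]) simp
    qed
    show "topspace ?Y \<subseteq> ?f ` topspace ?X"
    proof
      fix c assume "c \<in> topspace ?Y"
      then obtain s where s: "pathin Y s" "s 0 = q x" "c = path_class Y s"
        unfolding topspace_ucover_topology by blast
      obtain p where p: "pathin X p" "p 0 = x" "\<And>t. t \<in> {0..1} \<Longrightarrow> q (p t) = s t"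
        using covering_path_lift[OF cov s(1) x] s(2) by metis
      have "path_class Y s = path_class Y (q \<circ> p)"
        by (rule path_class_reparam[OF pathin_compose[OF p(1) q], of "\<lambda>t. t"]) (use p in auto)
      then have "c = ?f (path_class X p)" using s ucover_map_path_class[OF q p(1)] by simp
      then show "c \<in> ?f ` topspace ?X" unfolding topspace_ucover_topology using p by blast
    qed
  qed
  have inj: "inj_on ?f (topspace ?X)"
  proof (rule inj_onI)
    fix c d assume cd: "c \<in> topspace ?X" "d \<in> topspace ?X" "?f c = ?f d"
    then obtain p p' where p: "pathin X p" "p 0 = x" "c = path_class X p"
      and p': "pathin X p'" "p' 0 = x" "d = path_class X p'"
      unfolding topspace_ucover_topology by blast
    have "path_class Y (q \<circ> p) = path_class Y (q \<circ> p')"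
      using cd p p' ucover_map_path_class[OF q] by simp
    then have "q \<circ> p \<in> path_class Y (q \<circ> p')"
      using path_class_eq_imp_mem pathin_compose[OF p(1) q] by blast
    then show "c = d" using covering_path_class_inj[OF cov p'(1) p(1)] p p' by simp
  qed
  have "continuous_map ?X ?Y ?f"
    unfolding ucover_topology_alt[of Y]
  proof (rule continuous_on_generated_topo)
    fix B assume "B \<in> {ucover_nbhd Y p U |p U. pathin Y p \<and> p 0 = q x \<and> openin Y U \<and> p 1 \<in> U}"
    then obtain s U where s: "B = ucover_nbhd Y s U" "pathin Y s" "s 0 = q x" "openin Y U" "s 1 \<in> U"
      by blast
    obtain p where p: "pathin X p" "p 0 = x" "\<And>t. t \<in> {0..1} \<Longrightarrow> q (p t) = s t"
      using covering_path_lift[OF cov s(2) x] s(3) by metis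
    \<comment> \<open>The base path \<open>s\<close> and the projection of its lift \<open>p\<close>
      agree on \<open>{0..1}\<close> but may differ as functions, so their concatenations are
      compared as path classes.\<close>
    have ps: "pathin Y (path_concat s r) \<Longrightarrow> path_class Y (path_concat s r) = path_class Y (path_concat (q \<circ> p) r)" for r
      by (rule sym, rule path_class_reparam[of _ _ "\<lambda>t. t"]) (use p in \<open>auto simp: path_concat_def\<close>)
    have "ucover_nbhd Y s U = ucover_nbhd Y (q \<circ> p) U"
      unfolding ucover_nbhd_def
      using ps pathin_path_concat[OF s(2)] p(3)[of 1] by (auto simp: pathin_subtopology)
    then have "?f -` B \<inter> topspace ?X = ucover_nbhd X p {z \<in> topspace X. q z \<in> U}"
      using s ucover_map_vimage_nbhd[OF cov p(1,2)] by simp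
    moreover have "openin ?X (ucover_nbhd X p {z \<in> topspace X. q z \<in> U})"
      using openin_ucover_nbhd[OF p(1) openin_continuous_map_preimage[OF q s(4)]] p s(5)
        path_finish_in_topspace[OF p(1)] p(3)[of 1] by simp
    ultimately show "openin ?X (?f -` B \<inter> topspace ?X)" by simp
  next
    show "?f ` topspace ?X \<subseteq> \<Union> {ucover_nbhd Y p U |p U. pathin Y p \<and> p 0 = q x \<and> openin Y U \<and> p 1 \<in> U}"
      using fim unfolding ucover_topology_alt[of Y] by simp
  qed
  moreover have "continuous_map ?Y ?X (inv_into (topspace ?X) ?f)"
  proof (subst (2) ucover_topology_alt, rule continuous_on_generated_topo)
    fix B assume "B \<in> {ucover_nbhd X p U |p U. pathin X p \<and> p 0 = x \<and> openin X U \<and> p 1 \<in> U}"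
    then obtain p U where p: "B = ucover_nbhd X p U" "pathin X p" "p 0 = x" "openin X U" "p 1 \<in> U"
      by blast
    have "B \<subseteq> topspace ?X" using p openin_ucover_nbhd openin_subset by metis
    then have "inv_into (topspace ?X) ?f -` B \<inter> topspace ?Y = ?f ` B"
    proof (intro equalityI subsetI)
      fix y assume y: "y \<in> inv_into (topspace ?X) ?f -` B \<inter> topspace ?Y"
      then have "y \<in> ?f ` topspace ?X" using fim by simp
      then have "?f (inv_into (topspace ?X) ?f y) = y" by (rule f_inv_into_f)
      moreover have "inv_into (topspace ?X) ?f y \<in> B" using y by simp
      ultimately show "y \<in> ?f ` B" by (rule image_eqI[OF sym])
    next
      fix y assume "y \<in> ?f ` B"
      then obtain c where c: "c \<in> B" "y = ?f c" by blast
      then have cX: "c \<in> topspace ?X" using \<open>B \<subseteq> topspace ?X\<close> by blast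
      then have "y \<in> topspace ?Y" using c(2) fim by blast
      then show "y \<in> inv_into (topspace ?X) ?f -` B \<inter> topspace ?Y"
        using c inv_into_f_f[OF inj cX] by simp
    qed
    then show "openin ?Y (inv_into (topspace ?X) ?f -` B \<inter> topspace ?Y)"
      using ucover_map_image_nbhd_open[OF cov p(2,3,4)] p(1) by simp
  next
    have "inv_into (topspace ?X) ?f ` topspace ?Y \<subseteq> topspace ?X"
      using fim inv_into_into by (metis image_subsetI)
    then show "inv_into (topspace ?X) ?f ` topspace ?Y
        \<subseteq> \<Union> {ucover_nbhd X p U |p U. pathin X p \<and> p 0 = x \<and> openin X U \<and> p 1 \<in> U}"
      by (simp add: ucover_topology_alt)
  qed
  ultimately have "homeomorphic_maps ?X ?Y ?f (inv_into (topspace ?X) ?f)"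
    unfolding homeomorphic_maps_def using fim inj by (auto simp: f_inv_into_f)
  then show ?thesis using homeomorphic_maps_map by blast
qed

section \<open>Affine maps and charts\<close>

lemma affine_map_altdef: "affine_map L \<longleftrightarrow> linear (\<lambda>x. L x - L 0)"
proof
  assume "affine_map L"
  then obtain A b where "linear A" "L = (\<lambda>x. A x + b)" unfolding affine_map_def by blast
  then show "linear (\<lambda>x. L x - L 0)" by (simp add: linear_0)
next
  assume "linear (\<lambda>x. L x - L 0)"
  then show "affine_map L" unfolding affine_map_def
    by (intro exI[of _ "\<lambda>x. L x - L 0"] exI[of _ "L 0"]) auto
qed

lemma affine_map_combination:
  assumes "affine_map L"
  shows "L ((1 - t) *\<^sub>R x + t *\<^sub>R y) = (1 - t) *\<^sub>R L x + t *\<^sub>R L y"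
proof -
  obtain A b where "linear A" "L = (\<lambda>x. A x + b)" using assms unfolding affine_map_def by blast
  then show ?thesis
    by (simp add: linear_add[of A] linear_diff[of A] linear_scale[of A] scaleR_add_right scaleR_diff_left)
qed

lemma affine_map_compose:
  assumes "affine_map L" "affine_map M" shows "affine_map (L \<circ> M)"
proof -
  obtain A b B c where "linear A" "L = (\<lambda>x. A x + b)" "linear B" "M = (\<lambda>x. B x + c)"
    using assms unfolding affine_map_def by metis
  then show ?thesis unfolding affine_map_def
    by (intro exI[of _ "A \<circ> B"] exI[of _ "A c + b"]) (auto simp: linear_compose linear_add)
qed

lemma affine_map_continuous_on: "affine_map L \<Longrightarrow> continuous_on S L"
proof -
  assume "affine_map L"
  then obtain A b where A: "linear A" "L = (\<lambda>x. A x + b)" unfolding affine_map_def by blast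
  have "continuous_on S A" using A(1) by (rule linear_continuous_on[OF linear_conv_bounded_linear[THEN iffD1]])
  then show "continuous_on S L" unfolding A(2) by (intro continuous_intros)
qed

lemma affine_automorphism_imp_affine_map: "affine_automorphism L \<Longrightarrow> affine_map L"
  by (simp add: affine_automorphism_def)

lemma affine_automorphism_id: "affine_automorphism id"
  unfolding affine_automorphism_def affine_map_def
  by (auto intro!: exI[of _ id] exI[of _ 0] simp: linear_id)

lemma affine_automorphism_compose:
  "affine_automorphism L \<Longrightarrow> affine_automorphism M \<Longrightarrow> affine_automorphism (L \<circ> M)"
  by (auto simp: affine_automorphism_def affine_map_compose bij_comp)

lemma affine_automorphism_inverse:
  assumes "affine_automorphism L" shows "affine_automorphism (inv_into UNIV L)"
proof -
  obtain A b where A: "linear A" "L = (\<lambda>x. A x + b)"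
    using assms unfolding affine_automorphism_def affine_map_def by blast
  have bij: "bij L" using assms by (simp add: affine_automorphism_def)
  have "inj A" using bij A(2) unfolding bij_def inj_def by auto
  then have lin: "linear (inv_into UNIV A)" and Asurj: "surj A"
    using inj_linear_imp_inv_linear[OF A(1)] linear_injective_imp_surjective[OF A(1)] by auto
  have "inv_into UNIV L = (\<lambda>y. inv_into UNIV A y + inv_into UNIV A (- b))"
  proof
    fix y
    have "L (inv_into UNIV A (y - b)) = y" using Asurj by (simp add: A(2) surj_f_inv_f)
    then have "inv_into UNIV L y = inv_into UNIV A (y - b)"
      using bij by (metis bij_inv_eq_iff)
    also have "\<dots> = inv_into UNIV A y + inv_into UNIV A (- b)"
      using linear_add[OF lin, of y "- b"] by simp
    finally show "inv_into UNIV L y = inv_into UNIV A y + inv_into UNIV A (- b)" .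
  qed
  with lin have "affine_map (inv_into UNIV L)" unfolding affine_map_def by metis
  then show ?thesis using bij by (simp add: affine_automorphism_def bij_imp_bij_inv)
qed

lemma affine_automorphism_inj: "affine_automorphism L \<Longrightarrow> L x = L y \<longleftrightarrow> x = y"
  by (auto simp: affine_automorphism_def bij_def inj_def)

lemma affine_automorphism_inv1 [simp]: "affine_automorphism L \<Longrightarrow> inv_into UNIV L (L x) = x"
  by (simp add: affine_automorphism_def bij_def)

lemma affine_automorphism_inv2 [simp]: "affine_automorphism L \<Longrightarrow> L (inv_into UNIV L x) = x"
  by (simp add: affine_automorphism_def bij_def surj_f_inv_f)

lemma affine_automorphism_continuous_on: "affine_automorphism L \<Longrightarrow> continuous_on S L"
  by (simp add: affine_map_continuous_on affine_automorphism_def)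

lemma affine_automorphism_open_image:
  assumes "affine_automorphism L" "open S" shows "open (L ` S)"
proof -
  have "L ` S = inv_into UNIV L -` S"
    using assms(1) by (force simp: image_iff)
  then show ?thesis
    using affine_automorphism_continuous_on[OF affine_automorphism_inverse[OF assms(1)], of UNIV] assms(2)
    by (simp add: continuous_on_open_vimage)
qed

lemma affine_automorphism_homeomorphic_map:
  assumes "affine_automorphism L"
  shows "homeomorphic_map (top_of_set S) (top_of_set (L ` S)) L"
proof -
  have "homeomorphic_maps (top_of_set S) (top_of_set (L ` S)) L (inv_into UNIV L)"
    unfolding homeomorphic_maps_def
    using assms affine_automorphism_continuous_on[OF assms]
      affine_automorphism_continuous_on[OF affine_automorphism_inverse[OF assms]]
    by (auto simp: continuous_map_in_subtopology)
  then show ?thesis using homeomorphic_maps_map by blast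
qed

text \<open>Any point is brought into a neighbourhood of \<open>x\<close> by scaling towards
  \<open>x\<close>. Together with \<open>stretch_eq\<close> this spreads identities of affine maps
  from an open set to the whole space; it also serves to move a little from \<open>x\<close> in a
  prescribed direction.\<close>

lemma stretch_into_open:
  fixes x y :: "'v::real_normed_vector"
  assumes "open S" "x \<in> S"
  obtains e where "e > 0" "(1 - e) *\<^sub>R x + e *\<^sub>R y \<in> S"
proof -
  have "continuous_on UNIV (\<lambda>e. (1 - e) *\<^sub>R x + e *\<^sub>R y)"
    by (intro continuous_intros)
  then have "open ((\<lambda>e. (1 - e) *\<^sub>R x + e *\<^sub>R y) -` S)"
    using assms(1) by (rule open_vimage[OF _ , rotated])
  moreover have "0 \<in> (\<lambda>e. (1 - e) *\<^sub>R x + e *\<^sub>R y) -` S" using assms by simp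
  ultimately obtain d where "d > 0" "\<And>e. dist e 0 < d \<Longrightarrow> (1 - e) *\<^sub>R x + e *\<^sub>R y \<in> S"
    unfolding open_dist by (metis (no_types, lifting) vimage_eq)
  then show ?thesis by (intro that[of "d/2"]) auto
qed

lemma stretch_eq:
  fixes x y :: "'v::real_vector"
  assumes "e \<noteq> 0"
  shows "y = (1 - 1 / e) *\<^sub>R x + (1 / e) *\<^sub>R ((1 - e) *\<^sub>R x + e *\<^sub>R y)"
proof -
  have "(1 / e) *\<^sub>R ((1 - e) *\<^sub>R x + e *\<^sub>R y) = (1 / e - 1) *\<^sub>R x + y"
    using assms by (simp add: scaleR_add_right scaleR_diff_left scaleR_diff_right diff_divide_distrib)
  then show ?thesis by (simp add: scaleR_diff_left)
qed

lemma affine_map_eq_on_open: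
  assumes "affine_map L" "affine_map M" "open S" "x \<in> S" "\<And>y. y \<in> S \<Longrightarrow> L y = M y"
  shows "L = M"
proof
  fix y
  obtain e where e: "e > 0" "(1 - e) *\<^sub>R x + e *\<^sub>R y \<in> S" using stretch_into_open assms(3,4) .
  then have y: "y = (1 - 1 / e) *\<^sub>R x + (1 / e) *\<^sub>R ((1 - e) *\<^sub>R x + e *\<^sub>R y)"
    by (intro stretch_eq) simp
  have "L ((1 - e) *\<^sub>R x + e *\<^sub>R y) = M ((1 - e) *\<^sub>R x + e *\<^sub>R y)" "L x = M x"
    using assms e by auto
  then have "L ((1 - 1 / e) *\<^sub>R x + (1 / e) *\<^sub>R ((1 - e) *\<^sub>R x + e *\<^sub>R y))
      = M ((1 - 1 / e) *\<^sub>R x + (1 / e) *\<^sub>R ((1 - e) *\<^sub>R x + e *\<^sub>R y))"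
    by (simp only: affine_map_combination[OF assms(1), of "1 / e"] affine_map_combination[OF assms(2), of "1 / e"])
  with y show "L y = M y" by (rule back_subst[of "\<lambda>z. L z = M z", rotated, OF sym])
qed

text \<open>A vector in the kernel of the linear part, scaled down, would join two points of
  \<open>S\<close> with the same image. Surjectivity follows since both spaces have the same
  dimension.\<close>

lemma affine_map_inj_on_open:
  fixes L :: "'v::euclidean_space \<Rightarrow> 'v"
  assumes L: "affine_map L" and S: "open S" "x \<in> S" and inj: "inj_on L S"
  shows "affine_automorphism L"
proof -
  obtain A b where A: "linear A" "L = (\<lambda>x. A x + b)" using L unfolding affine_map_def by blast
  have "inj A"
  proof (subst linear_injective_0[OF A(1)], intro allI impI)
    fix v assume v: "A v = 0"
    obtain e where e: "e > 0" "(1 - e) *\<^sub>R x + e *\<^sub>R (x + v) \<in> S" using stretch_into_open S .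
    then have "x + e *\<^sub>R v \<in> S" by (simp add: algebra_simps)
    moreover have "L (x + e *\<^sub>R v) = L x" using v A by (simp add: linear_add linear_scale)
    ultimately have "e *\<^sub>R v = 0" using inj S(2) by (metis add_cancel_left_right inj_onD)
    then show "v = 0" using e by simp
  qed
  then have "bij A" using linear_injective_imp_surjective[OF A(1)] by (simp add: bij_def)
  then have "bij ((\<lambda>x. x + b) \<circ> A)" by (rule bij_comp) (rule bij_plus_right)
  then have "bij L" by (simp add: A(2) o_def)
  then show ?thesis using L by (simp add: affine_automorphism_def)
qed

text \<open>An affine map is determined by its values at \<open>0\<close> and at the finitely many
  basis vectors, through a formula continuous in values and argument. Pointwise convergence
  therefore tolerates a convergent argument.\<close>

lemma affine_map_tendsto:
  fixes a :: "nat \<Rightarrow> 'v::euclidean_space \<Rightarrow> 'w::euclidean_space"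
  assumes a: "\<And>i. affine_map (a i)" and a': "affine_map a'"
    and lim: "\<And>v. (\<lambda>i. a i v) \<longlonglongrightarrow> a' v" and v: "v \<longlonglongrightarrow> v'"
  shows "(\<lambda>i. a i (v i)) \<longlonglongrightarrow> a' v'"
proof -
  have expand: "L w = L 0 + (\<Sum>b\<in>Basis. (w \<bullet> b) *\<^sub>R (L b - L 0))" if "affine_map L"
    for L :: "'v \<Rightarrow> 'w" and w
  proof -
    let ?A = "\<lambda>x. L x - L 0"
    have lin: "linear ?A" using that by (simp add: affine_map_altdef)
    have "?A w = ?A (\<Sum>b\<in>Basis. (w \<bullet> b) *\<^sub>R b)" by (simp add: euclidean_representation)
    also have "\<dots> = (\<Sum>b\<in>Basis. ?A ((w \<bullet> b) *\<^sub>R b))" by (rule linear_sum[OF lin])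
    also have "\<dots> = (\<Sum>b\<in>Basis. (w \<bullet> b) *\<^sub>R ?A b)"
      by (intro sum.cong refl) (rule linear_scale[OF lin])
    finally show ?thesis by (simp add: algebra_simps)
  qed
  have "(\<lambda>i. a i 0 + (\<Sum>b\<in>Basis. (v i \<bullet> b) *\<^sub>R (a i b - a i 0)))
      \<longlonglongrightarrow> a' 0 + (\<Sum>b\<in>Basis. (v' \<bullet> b) *\<^sub>R (a' b - a' 0))"
    by (intro tendsto_intros lim v)
  moreover have "a i (v i) = a i 0 + (\<Sum>b\<in>Basis. (v i \<bullet> b) *\<^sub>R (a i b - a i 0))" for i
    by (rule expand[OF a])
  moreover have "a' v' = a' 0 + (\<Sum>b\<in>Basis. (v' \<bullet> b) *\<^sub>R (a' b - a' 0))"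
    by (rule expand[OF a'])
  ultimately show ?thesis by presburger
qed

section \<open>Locally affine maps\<close>

lemma locally_restrictsE:
  assumes "locally_restricts {L. Q L} S f" "x \<in> S"
  obtains N L where "open N" "x \<in> N" "Q L" "\<And>y. y \<in> N \<Longrightarrow> y \<in> S \<Longrightarrow> f y = L y"
proof -
  obtain N where N: "open N" "x \<in> N" "\<exists>L\<in>{L. Q L}. \<forall>y\<in>N \<inter> S. f y = L y"
    using bspec[OF assms(1)[unfolded locally_restricts_def] assms(2)] by (elim exE conjE)
  from N(3) obtain L where L: "L \<in> {L. Q L}" "\<forall>y\<in>N \<inter> S. f y = L y" by (rule bexE)
  show ?thesis by (rule that[OF N(1,2)]) (use L in auto)
qed

lemma locally_restrictsI:
  assumes "\<And>x. x \<in> S \<Longrightarrow> \<exists>N L. open N \<and> x \<in> N \<and> Q L \<and> (\<forall>y\<in>N \<inter> S. f y = L y)"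
  shows "locally_restricts {L. Q L} S f"
  unfolding locally_restricts_def
proof
  fix x assume "x \<in> S"
  then obtain N L where "open N \<and> x \<in> N \<and> Q L \<and> (\<forall>y\<in>N \<inter> S. f y = L y)"
    using assms by presburger
  then show "\<exists>N. open N \<and> x \<in> N \<and> (\<exists>L\<in>{L. Q L}. \<forall>y\<in>N \<inter> S. f y = L y)"
    by (intro exI[of _ N] conjI bexI[of _ L]) auto
qed

text \<open>The points near which \<open>f\<close> agrees with one fixed \<open>L\<close> form an
  open set. Its complement is open too, because two affine maps that agree on a nonempty open set
  are equal.\<close>

lemma locally_affine_imp_affine:
  fixes f :: "'v::euclidean_space \<Rightarrow> 'w::euclidean_space"
  assumes S: "open S" "connected S" and f: "locally_restricts {L. affine_map L} S f"
  obtains L where "affine_map L" "\<And>x. x \<in> S \<Longrightarrow> f x = L x"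
proof (cases "S = {}")
  case True
  have "affine_map (\<lambda>_::'v. 0::'w)" unfolding affine_map_def
    by (intro exI[of _ "\<lambda>_. 0"] exI[of _ 0]) (auto simp: linear_zero)
  then show ?thesis using that True by blast
next
  case False
  then obtain x0 where x0: "x0 \<in> S" by blast
  have loc: "\<exists>N L. open N \<and> x \<in> N \<and> N \<subseteq> S \<and> affine_map L \<and> (\<forall>y\<in>N. f y = L y)" if x: "x \<in> S" for x
  proof -
    obtain N L where "open N" "x \<in> N" "affine_map L" "\<And>y. y \<in> N \<Longrightarrow> y \<in> S \<Longrightarrow> f y = L y"
      using f x by (rule locally_restrictsE) (rule that)
    then have "open (N \<inter> S)" "x \<in> N \<inter> S" "N \<inter> S \<subseteq> S" "affine_map L" "\<forall>y\<in>N \<inter> S. f y = L y"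
      using S(1) x by auto
    then show ?thesis by blast
  qed
  obtain N0 L where N0: "open N0" "x0 \<in> N0" "N0 \<subseteq> S" and L: "affine_map L" "\<And>y. y \<in> N0 \<Longrightarrow> f y = L y"
    using loc[OF x0] by blast
  let ?E = "\<Union>{N. open N \<and> N \<subseteq> S \<and> (\<forall>y\<in>N. f y = L y)}"
  have "open ?E" by auto
  moreover have "open (S - ?E)"
  proof (rule Topological_Spaces.openI)
    fix x assume x: "x \<in> S - ?E"
    then obtain N M where N: "open N" "x \<in> N" "N \<subseteq> S" and M: "affine_map M" "\<And>y. y \<in> N \<Longrightarrow> f y = M y"
      using loc[of x] by blast
    have "N \<inter> ?E = {}"
    proof (rule ccontr)
      assume "N \<inter> ?E \<noteq> {}"
      then obtain N' y where N': "open N'" "y \<in> N'" "y \<in> N" "\<And>z. z \<in> N' \<Longrightarrow> f z = L z" by auto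
      have "M = L"
      proof (rule affine_map_eq_on_open[OF M(1) L(1)])
        show "open (N \<inter> N')" "y \<in> N \<inter> N'" using N N' by auto
        show "M z = L z" if "z \<in> N \<inter> N'" for z
          using M(2)[of z] N'(4)[of z] that by simp
      qed
      then show False using x N M by blast
    qed
    then show "\<exists>T. open T \<and> x \<in> T \<and> T \<subseteq> S - ?E" using N by blast
  qed
  moreover have "x0 \<in> ?E" using N0 L by blast
  moreover have "?E \<subseteq> S" by blast
  ultimately have "?E = S"
    using connectedD[OF S(2), of ?E "S - ?E"] x0 by blast
  then have "\<And>x. x \<in> S \<Longrightarrow> f x = L x" by blast
  then show ?thesis using that L(1) by blast
qed

text \<open>Morphisms are tested with arbitrary affine maps, atlases with automorphisms; injective
  transition maps pass from the one to the other.\<close>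

lemma locally_restricts_automorphismI:
  fixes f :: "'v::euclidean_space \<Rightarrow> 'v"
  assumes S: "open S" "inj_on f S" and f: "locally_restricts {L. affine_map L} S f"
  shows "locally_restricts {L. affine_automorphism L} S f"
  unfolding locally_restricts_def
proof
  fix x assume x: "x \<in> S"
  obtain N L where N: "open N" "x \<in> N" "affine_map L" "\<And>y. y \<in> N \<Longrightarrow> y \<in> S \<Longrightarrow> f y = L y"
    using f x by (rule locally_restrictsE) (rule that)
  have "inj_on L (N \<inter> S)" using S(2) N(4) by (auto simp: inj_on_def)
  then have "affine_automorphism L"
    using affine_map_inj_on_open[of L "N \<inter> S" x] N S x by auto
  then show "\<exists>N. open N \<and> x \<in> N \<and> (\<exists>L\<in>{L. affine_automorphism L}. \<forall>y\<in>N \<inter> S. f y = L y)"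
    using N by (intro exI[of _ N] conjI bexI[of _ L]) auto
qed

section \<open>Restriction and inversion of charts\<close>

lemma chart_onD:
  assumes "chart_on X (U, \<phi>)"
  shows "openin X U" "open (\<phi> ` U)" "homeomorphic_map (subtopology X U) (top_of_set (\<phi> ` U)) \<phi>"
    "inj_on \<phi> U" "U \<subseteq> topspace X" "continuous_map (subtopology X U) euclidean \<phi>"
proof -
  show *: "openin X U" "open (\<phi> ` U)" "homeomorphic_map (subtopology X U) (top_of_set (\<phi> ` U)) \<phi>"
    using assms by (auto simp: chart_on_def)
  show U: "U \<subseteq> topspace X" using * openin_subset by blast
  show "inj_on \<phi> U" using homeomorphic_imp_injective_map[OF *(3)] U by (simp add: inf.absorb2)
  show "continuous_map (subtopology X U) euclidean \<phi>"
    using homeomorphic_imp_continuous_map[OF *(3)] continuous_map_in_subtopology by blast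
qed

lemma chart_on_open_image:
  assumes c: "chart_on X (U, \<phi>)" and W: "openin X W"
  shows "open (\<phi> ` (U \<inter> W))"
proof -
  have "openin (subtopology X U) (U \<inter> W)" using W by (simp add: openin_subtopology_Int2)
  then have "openin (top_of_set (\<phi> ` U)) (\<phi> ` (U \<inter> W))"
    using chart_onD(3)[OF c] homeomorphic_map_openness_eq homeomorphic_imp_open_map open_map_def by blast
  then show ?thesis using chart_onD(2)[OF c] openin_open_trans by blast
qed

lemma chart_on_preimage:
  assumes c: "chart_on X (U, \<phi>)" and W: "open W"
  shows "openin X {x \<in> U. \<phi> x \<in> W}"
proof -
  have "openin (subtopology X U) {x \<in> topspace (subtopology X U). \<phi> x \<in> W}"
    using chart_onD(6)[OF c] W by (intro openin_continuous_map_preimage[of _ euclidean]) auto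
  moreover have "{x \<in> topspace (subtopology X U). \<phi> x \<in> W} = {x \<in> U. \<phi> x \<in> W}"
    using chart_onD(5)[OF c] by auto
  ultimately show ?thesis using chart_onD(1)[OF c] openin_trans_full by metis
qed

lemma chart_on_subset:
  assumes c: "chart_on X (U, \<phi>)" and V: "openin X V" "V \<subseteq> U"
  shows "chart_on X (V, \<phi>)"
proof -
  have "open (\<phi> ` V)" using chart_on_open_image[OF c V(1)] V(2) by (simp add: inf.absorb2)
  moreover have "homeomorphic_map (subtopology (subtopology X U) V) (subtopology (top_of_set (\<phi> ` U)) (\<phi> ` V)) \<phi>"
  proof (rule homeomorphic_map_subtopologies[OF chart_onD(3)[OF c]])
    show "\<phi> ` (topspace (subtopology X U) \<inter> V) = topspace (top_of_set (\<phi> ` U)) \<inter> \<phi> ` V"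
      using V chart_onD(5)[OF c] by auto
  qed
  then have "homeomorphic_map (subtopology X V) (top_of_set (\<phi> ` V)) \<phi>"
    unfolding subtopology_subtopology Int_absorb1[OF V(2)] Int_absorb1[OF image_mono[OF V(2)]] .
  ultimately show ?thesis using V by (simp add: chart_on_def)
qed

lemma chart_on_inverse_continuous:
  assumes "chart_on X (U, \<phi>)"
  shows "continuous_map (top_of_set (\<phi> ` U)) (subtopology X U) (inv_into U \<phi>)"
proof -
  obtain g where g: "homeomorphic_maps (subtopology X U) (top_of_set (\<phi> ` U)) \<phi> g"
    using chart_onD(3)[OF assms] homeomorphic_map_maps by blast
  have "continuous_map (top_of_set (\<phi> ` U)) (subtopology X U) g"
    using g by (simp add: homeomorphic_maps_def)
  then show ?thesis
  proof (rule continuous_map_eq)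
    fix z assume "z \<in> topspace (top_of_set (\<phi> ` U))"
    then obtain u where u: "u \<in> U" "z = \<phi> u" by auto
    then show "g z = inv_into U \<phi> z"
      using g chart_onD(4,5)[OF assms] by (auto simp: homeomorphic_maps_def)
  qed
qed

section \<open>The holonomy cover\<close>

text \<open>\<open>h u\<close> is left multiplication by \<open>u\<close> read in the chart at the
  unit. The chart image is a ball so that \<open>N\<close>, and with it each affine translate of the
  ball, is connected.\<close>

locale etale_group = group G for G (structure) +
  fixes X :: "'a topology" and N :: "'a set" and \<phi> :: "'a \<Rightarrow> 'v::euclidean_space"
    and x0 :: 'v and r :: real and h :: "'a \<Rightarrow> 'v \<Rightarrow> 'v"
  assumes topspace_X: "topspace X = carrier G"
    and mult_cont: "continuous_map (prod_topology X X) X (\<lambda>(x, y). x \<otimes> y)"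
    and inv_cont: "continuous_map X X (\<lambda>x. inv x)"
    and Hausdorff_X: "Hausdorff_space X"
    and N_chart: "chart_on X (N, \<phi>)"
    and one_N: "\<one> \<in> N"
    and phi_one: "\<phi> \<one> = x0"
    and r_pos: "r > 0"
    and phi_N: "\<phi> ` N = ball x0 r"
    and h_aut: "u \<in> N \<Longrightarrow> affine_automorphism (h u)"
    and h_phi: "u \<in> N \<Longrightarrow> y \<in> N \<Longrightarrow> u \<otimes> y \<in> N \<Longrightarrow> \<phi> (u \<otimes> y) = h u (\<phi> y)"
begin

lemma N_open: "openin X N" and N_sub: "N \<subseteq> carrier G" and phi_inj: "inj_on \<phi> N"
  using chart_onD[OF N_chart] topspace_X by auto

lemma N_carrier [simp]: "u \<in> N \<Longrightarrow> u \<in> carrier G"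
  using N_sub by blast

lemma mult_left_cont: "g \<in> carrier G \<Longrightarrow> continuous_map X X (\<lambda>y. g \<otimes> y)"
  and mult_right_cont: "g \<in> carrier G \<Longrightarrow> continuous_map X X (\<lambda>y. y \<otimes> g)"
proof -
  assume g: "g \<in> carrier G"
  have "continuous_map X (prod_topology X X) (\<lambda>y. (g, y))" "continuous_map X (prod_topology X X) (\<lambda>y. (y, g))"
    using g topspace_X by (auto intro!: continuous_intros)
  from this[THEN continuous_map_compose, OF mult_cont]
  show "continuous_map X X (\<lambda>y. g \<otimes> y)" "continuous_map X X (\<lambda>y. y \<otimes> g)"
    by (simp_all add: o_def)
qed

lemma conj_cont: "g \<in> carrier G \<Longrightarrow> continuous_map X X (\<lambda>y. g \<otimes> y \<otimes> inv g)"
  using continuous_map_compose[OF mult_left_cont[of g] mult_right_cont[of "inv g"]] by (simp add: o_def)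

lemma open_preimage: "continuous_map X X f \<Longrightarrow> openin X U \<Longrightarrow> openin X {y \<in> carrier G. f y \<in> U}"
  using openin_continuous_map_preimage[of X X f U] topspace_X by simp

lemma h_one: "h \<one> = id"
proof (rule affine_map_eq_on_open)
  show "affine_map (h \<one>)" "affine_map (id :: 'v \<Rightarrow> 'v)"
    using h_aut[OF one_N] affine_automorphism_id affine_automorphism_imp_affine_map by auto
  show "open (ball x0 r)" "x0 \<in> ball x0 r" using r_pos by auto
  fix y assume "y \<in> ball x0 r"
  then obtain u where "u \<in> N" "y = \<phi> u" unfolding phi_N[symmetric] by blast
  then show "h \<one> y = id y" using h_phi[OF one_N, of u] by simp
qed

lemma h_x0: "u \<in> N \<Longrightarrow> h u x0 = \<phi> u"
  using h_phi[of u \<one>] one_N phi_one by simp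

text \<open>Both sides agree on the chart images of those \<open>x\<close> near the unit for which
  all products stay in \<open>N\<close>. This is an open set containing \<open>x0\<close>, and it
  determines an affine map.\<close>

lemma h_mult:
  assumes u: "u \<in> N" and y: "y \<in> N" and uy: "u \<otimes> y \<in> N"
  shows "h (u \<otimes> y) = h u \<circ> h y"
proof (rule affine_map_eq_on_open)
  let ?W = "{x \<in> carrier G. y \<otimes> x \<in> N} \<inter> {x \<in> carrier G. u \<otimes> y \<otimes> x \<in> N}"
  have W: "openin X ?W"
    using u y by (intro openin_Int open_preimage mult_left_cont N_open) auto
  show "affine_map (h (u \<otimes> y))" "affine_map (h u \<circ> h y)"
    using affine_automorphism_imp_affine_map[OF h_aut] u y uy affine_map_compose by auto
  show "open (\<phi> ` (N \<inter> ?W))" using chart_on_open_image[OF N_chart W] .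
  have "\<one> \<in> N \<inter> ?W" using one_N u y uy by auto
  then show "x0 \<in> \<phi> ` (N \<inter> ?W)" using phi_one by blast
  fix z assume "z \<in> \<phi> ` (N \<inter> ?W)"
  then obtain x where x: "x \<in> N" "y \<otimes> x \<in> N" "u \<otimes> y \<otimes> x \<in> N" "z = \<phi> x" by blast
  have "h (u \<otimes> y) z = \<phi> (u \<otimes> y \<otimes> x)" using h_phi[OF uy x(1)] x by simp
  also have "\<dots> = \<phi> (u \<otimes> (y \<otimes> x))" using u y x by (simp add: m_assoc)
  also have "\<dots> = h u (h y z)" using h_phi[OF u x(2)] h_phi[OF y x(1)] x u y by (simp add: m_assoc)
  finally show "h (u \<otimes> y) z = (h u \<circ> h y) z" by simp
qed

lemma h_inv:
  assumes "u \<in> N" "inv u \<in> N"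
  shows "h (inv u) = inv_into UNIV (h u)"
proof -
  have "h u \<circ> h (inv u) = id" using h_mult[of u "inv u"] assms one_N h_one by simp
  then show ?thesis using h_aut[OF assms(1)]
    by (metis affine_automorphism_inv1 comp_apply ext id_apply)
qed

text \<open>\<open>H\<close> is the holonomy cover of the identity component, realised as a subgroup of the product of
  \<open>G\<close> with the affine group: the leaf through the unit of the local graph of \<open>h\<close>.\<close>

definition emult :: "'a \<times> ('v \<Rightarrow> 'v) \<Rightarrow> 'a \<times> ('v \<Rightarrow> 'v) \<Rightarrow> 'a \<times> ('v \<Rightarrow> 'v)" where
  "emult e e' = (fst e \<otimes> fst e', snd e \<circ> snd e')"

definition einv :: "'a \<times> ('v \<Rightarrow> 'v) \<Rightarrow> 'a \<times> ('v \<Rightarrow> 'v)" where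
  "einv e = (inv (fst e), inv_into UNIV (snd e))"

definition eone :: "'a \<times> ('v \<Rightarrow> 'v)" where "eone = (\<one>, id)"

definition graph_h :: "'a \<Rightarrow> 'a \<times> ('v \<Rightarrow> 'v)" where "graph_h u = (u, h u)"

inductive_set H :: "('a \<times> ('v \<Rightarrow> 'v)) set" where
  eone_H: "eone \<in> H"
| mult_H: "e \<in> H \<Longrightarrow> u \<in> N \<Longrightarrow> emult e (graph_h u) \<in> H"
| div_H: "e \<in> H \<Longrightarrow> u \<in> N \<Longrightarrow> emult e (einv (graph_h u)) \<in> H"

definition valid :: "'a \<times> ('v \<Rightarrow> 'v) \<Rightarrow> bool" where
  "valid e \<longleftrightarrow> fst e \<in> carrier G \<and> affine_automorphism (snd e)"

lemma valid_eone: "valid eone" and valid_emult: "valid e \<Longrightarrow> valid e' \<Longrightarrow> valid (emult e e')"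
  and valid_einv: "valid e \<Longrightarrow> valid (einv e)" and valid_graph_h: "u \<in> N \<Longrightarrow> valid (graph_h u)"
  by (auto simp: valid_def eone_def emult_def einv_def graph_h_def affine_automorphism_id
      affine_automorphism_compose affine_automorphism_inverse h_aut)

lemma H_valid: "e \<in> H \<Longrightarrow> valid e"
  by (induction rule: H.induct) (auto simp: valid_eone valid_emult valid_einv valid_graph_h)

lemma H_carrier: "e \<in> H \<Longrightarrow> fst e \<in> carrier G" and H_aut: "e \<in> H \<Longrightarrow> affine_automorphism (snd e)"
  using H_valid by (auto simp: valid_def)

lemma emult_assoc:
  "valid a \<Longrightarrow> valid b \<Longrightarrow> valid c \<Longrightarrow> emult (emult a b) c = emult a (emult b c)"
  by (simp add: emult_def valid_def m_assoc o_assoc)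

lemma emult_eone: "valid e \<Longrightarrow> emult e eone = e" "valid e \<Longrightarrow> emult eone e = e"
  by (simp_all add: emult_def valid_def eone_def)

lemma emult_einv: "valid e \<Longrightarrow> emult e (einv e) = eone" "valid e \<Longrightarrow> emult (einv e) e = eone"
  by (auto simp: emult_def valid_def eone_def einv_def)

lemma emult_einv_cancel:
  assumes "valid a" "valid b"
  shows "emult (emult a b) (einv b) = a" "emult (emult a (einv b)) b = a"
    "emult (einv a) (emult a b) = b" "emult a (emult (einv a) b) = b"
  using assms by (simp_all add: emult_assoc valid_einv emult_einv emult_eone flip: emult_assoc[of a "einv a" b] emult_assoc[of "einv a" a b])

lemma einv_emult: assumes "valid a" "valid b" shows "einv (emult a b) = emult (einv b) (einv a)"
proof -
  let ?c = "emult (einv b) (einv a)"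
  have c: "valid ?c" using assms by (simp add: valid_emult valid_einv)
  have "emult (emult a b) ?c = emult (emult (emult a b) (einv b)) (einv a)"
    using assms by (simp add: emult_assoc valid_emult valid_einv)
  also have "\<dots> = eone" using assms by (simp add: emult_einv_cancel emult_einv)
  finally have *: "emult (emult a b) ?c = eone" .
  have "einv (emult a b) = emult (einv (emult a b)) (emult (emult a b) ?c)"
    unfolding * using assms by (simp add: emult_eone valid_emult valid_einv)
  also have "\<dots> = ?c" using assms c by (simp add: emult_einv_cancel valid_emult)
  finally show ?thesis .
qed

lemma H_emult: assumes "e \<in> H" "e' \<in> H" shows "emult e e' \<in> H"
  using assms(2)
proof induction
  case eone_H
  then show ?case using assms(1) by (simp add: emult_eone H_valid)
next
  case (mult_H e' u)
  then show ?case using H.mult_H[of "emult e e'" u] assms(1)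
    by (simp add: emult_assoc H_valid valid_graph_h)
next
  case (div_H e' u)
  then show ?case using H.div_H[of "emult e e'" u] assms(1)
    by (simp add: emult_assoc H_valid valid_graph_h valid_einv)
qed

lemma graph_h_H: "u \<in> N \<Longrightarrow> graph_h u \<in> H" and einv_graph_h_H: "u \<in> N \<Longrightarrow> einv (graph_h u) \<in> H"
  using H.mult_H[OF H.eone_H, of u] H.div_H[OF H.eone_H, of u]
  by (simp_all add: emult_eone valid_graph_h valid_einv)

lemma einv_eone: "einv eone = eone"
  using emult_einv(1)[OF valid_eone] emult_eone(2)[OF valid_einv[OF valid_eone]] by simp

lemma einv_einv: "valid e \<Longrightarrow> einv (einv e) = e"
  using emult_einv_cancel(3)[of "einv e" e] emult_einv[of e] emult_eone(1)[of "einv (einv e)"]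
  by (simp add: valid_einv)

lemma H_einv: assumes "e \<in> H" shows "einv e \<in> H"
  using assms
proof induction
  case eone_H
  then show ?case by (simp add: einv_eone H.eone_H)
next
  case (mult_H e u)
  then show ?case by (simp add: einv_emult H_valid valid_graph_h H_emult einv_graph_h_H)
next
  case (div_H e u)
  then show ?case by (simp add: einv_emult H_valid valid_graph_h valid_einv einv_einv H_emult graph_h_H)
qed

lemma emult_graph_h:
  assumes "valid e" "u \<in> N" "v \<in> N" "u \<otimes> v \<in> N"
  shows "emult (emult e (graph_h u)) (graph_h v) = emult e (graph_h (u \<otimes> v))"
  using assms h_mult[of u v] by (simp add: emult_def graph_h_def valid_def m_assoc o_assoc)

lemma emult_graph_h_one: "valid e \<Longrightarrow> emult e (graph_h \<one>) = e"
  using h_one by (simp add: emult_def graph_h_def valid_def)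

text \<open>The leaf topology: neighbourhoods of \<open>e\<close> are the left translates by
  \<open>e\<close> of small pieces of the graph of \<open>h\<close>. Elements of \<open>H\<close>
  that are close in both components but lie on another such piece do not count as near.\<close>

definition etop :: "('a \<times> ('v \<Rightarrow> 'v)) topology" where
  "etop = topology (\<lambda>W. W \<subseteq> H \<and>
     (\<forall>e\<in>W. \<exists>U. openin X U \<and> \<one> \<in> U \<and> (\<forall>u\<in>U \<inter> N. emult e (graph_h u) \<in> W)))"

lemma openin_etop:
  "openin etop W \<longleftrightarrow> W \<subseteq> H \<and>
     (\<forall>e\<in>W. \<exists>U. openin X U \<and> \<one> \<in> U \<and> (\<forall>u\<in>U \<inter> N. emult e (graph_h u) \<in> W))"
proof -
  let ?P = "\<lambda>W. W \<subseteq> H \<and>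
     (\<forall>e\<in>W. \<exists>U. openin X U \<and> \<one> \<in> U \<and> (\<forall>u\<in>U \<inter> N. emult e (graph_h u) \<in> W))"
  have "istopology ?P"
    unfolding istopology_def
  proof (intro conjI allI impI)
    fix S T assume S: "?P S" and T: "?P T"
    show "S \<inter> T \<subseteq> H" using S by blast
    show "\<forall>e\<in>S \<inter> T. \<exists>U. openin X U \<and> \<one> \<in> U \<and> (\<forall>u\<in>U \<inter> N. emult e (graph_h u) \<in> S \<inter> T)"
    proof
      fix e assume e: "e \<in> S \<inter> T"
      obtain U where U: "openin X U" "\<one> \<in> U" "\<forall>u\<in>U \<inter> N. emult e (graph_h u) \<in> S" using S e by blast
      obtain V where V: "openin X V" "\<one> \<in> V" "\<forall>u\<in>V \<inter> N. emult e (graph_h u) \<in> T" using T e by blast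
      show "\<exists>U. openin X U \<and> \<one> \<in> U \<and> (\<forall>u\<in>U \<inter> N. emult e (graph_h u) \<in> S \<inter> T)"
        using U V by (intro exI[of _ "U \<inter> V"]) auto
    qed
  next
    fix K assume K: "\<forall>S\<in>K. ?P S"
    then show "\<Union>K \<subseteq> H" by blast
    show "\<forall>e\<in>\<Union>K. \<exists>U. openin X U \<and> \<one> \<in> U \<and> (\<forall>u\<in>U \<inter> N. emult e (graph_h u) \<in> \<Union>K)"
    proof
      fix e assume "e \<in> \<Union>K"
      then obtain S where S: "S \<in> K" "e \<in> S" by blast
      then have "?P S" using K by blast
      then obtain U where "openin X U" "\<one> \<in> U" "\<forall>u\<in>U \<inter> N. emult e (graph_h u) \<in> S"
        using S(2) by meson
      then show "\<exists>U. openin X U \<and> \<one> \<in> U \<and> (\<forall>u\<in>U \<inter> N. emult e (graph_h u) \<in> \<Union>K)"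
        using S(1) by (intro exI[of _ U]) auto
    qed
  qed
  then show ?thesis unfolding etop_def by (simp add: topology_inverse')
qed

lemma topspace_etop: "topspace etop = H"
proof
  show "topspace etop \<subseteq> H" using openin_etop[of "topspace etop"] by simp
  have "openin X (carrier G)" using topspace_X openin_topspace by metis
  then have "openin etop H" unfolding openin_etop using H.mult_H by blast
  then show "H \<subseteq> topspace etop" by (rule openin_subset)
qed

lemma etop_continuous_mapI:
  assumes "\<And>e. e \<in> H \<Longrightarrow> f e \<in> topspace Y"
    and "\<And>e W. e \<in> H \<Longrightarrow> openin Y W \<Longrightarrow> f e \<in> W \<Longrightarrow>
      \<exists>U. openin X U \<and> \<one> \<in> U \<and> (\<forall>u\<in>U \<inter> N. f (emult e (graph_h u)) \<in> W)"
  shows "continuous_map etop Y f"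
  unfolding continuous_map_def topspace_etop
proof (intro conjI allI impI)
  fix W assume W: "openin Y W"
  show "openin etop {e \<in> H. f e \<in> W}"
    unfolding openin_etop
  proof (intro conjI ballI)
    fix e assume "e \<in> {e \<in> H. f e \<in> W}"
    then obtain U where "openin X U" "\<one> \<in> U" "\<forall>u\<in>U \<inter> N. f (emult e (graph_h u)) \<in> W"
      using assms(2)[OF _ W] by blast
    then show "\<exists>U. openin X U \<and> \<one> \<in> U \<and> (\<forall>u\<in>U \<inter> N. emult e (graph_h u) \<in> {e \<in> H. f e \<in> W})"
      using H.mult_H \<open>e \<in> {e \<in> H. f e \<in> W}\<close> by (intro exI[of _ U]) auto
  qed auto
qed (use assms(1) in auto)

text \<open>A further small factor \<open>graph_h v\<close> is absorbed into
  \<open>graph_h u\<close>, as the graph of \<open>h\<close> is multiplicative while the product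
  stays in \<open>N\<close>.\<close>

lemma openin_sheet:
  assumes e: "e \<in> H" and U: "openin X U" "U \<subseteq> N"
  shows "openin etop ((\<lambda>u. emult e (graph_h u)) ` U)"
  unfolding openin_etop
proof (intro conjI ballI)
  show "(\<lambda>u. emult e (graph_h u)) ` U \<subseteq> H" using e U H.mult_H by blast
  fix d assume "d \<in> (\<lambda>u. emult e (graph_h u)) ` U"
  then obtain u where u: "u \<in> U" "d = emult e (graph_h u)" by blast
  have uc: "u \<in> N" "u \<in> carrier G" using u U by auto
  let ?V = "{v \<in> carrier G. u \<otimes> v \<in> U}"
  have "openin X ?V" using uc U by (intro open_preimage mult_left_cont)
  moreover have "\<one> \<in> ?V" using uc u by simp
  moreover have "emult d (graph_h v) \<in> (\<lambda>u. emult e (graph_h u)) ` U" if "v \<in> ?V \<inter> N" for v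
    using that emult_graph_h[of e u v] e uc u U H_valid by auto
  ultimately show "\<exists>V. openin X V \<and> \<one> \<in> V \<and> (\<forall>v\<in>V \<inter> N. emult d (graph_h v) \<in> (\<lambda>u. emult e (graph_h u)) ` U)"
    by blast
qed

lemma continuous_map_sheet:
  assumes e: "e \<in> H"
  shows "continuous_map (subtopology X N) etop (\<lambda>u. emult e (graph_h u))"
  unfolding continuous_map_def
proof (intro conjI allI impI)
  show "(\<lambda>u. emult e (graph_h u)) \<in> topspace (subtopology X N) \<rightarrow> topspace etop"
    using e H.mult_H by (auto simp: topspace_etop)
  fix W assume W: "openin etop W"
  have "openin X {u \<in> N. emult e (graph_h u) \<in> W}"
  proof (subst openin_subopen, intro ballI)
    fix u assume u: "u \<in> {u \<in> N. emult e (graph_h u) \<in> W}"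
    then obtain U where U: "openin X U" "\<one> \<in> U" "\<forall>v\<in>U \<inter> N. emult (emult e (graph_h u)) (graph_h v) \<in> W"
      using W unfolding openin_etop by blast
    let ?T = "{y \<in> carrier G. inv u \<otimes> y \<in> U \<inter> N} \<inter> N"
    have "openin X ?T" using u U N_open by (intro openin_Int open_preimage mult_left_cont) auto
    moreover have "u \<in> ?T" using u U one_N by simp
    moreover have "?T \<subseteq> {u \<in> N. emult e (graph_h u) \<in> W}"
    proof
      fix y assume "y \<in> ?T"
      then have y: "y \<in> carrier G" "inv u \<otimes> y \<in> U" "inv u \<otimes> y \<in> N" "y \<in> N" by auto
      have "u \<otimes> (inv u \<otimes> y) = y" using u y by (simp flip: m_assoc)
      then show "y \<in> {u \<in> N. emult e (graph_h u) \<in> W}"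
        using bspec[OF U(3), of "inv u \<otimes> y"] y u emult_graph_h[of e u "inv u \<otimes> y"] H_valid[OF e] by simp
    qed
    ultimately show "\<exists>T. openin X T \<and> u \<in> T \<and> T \<subseteq> {u \<in> N. emult e (graph_h u) \<in> W}" by blast
  qed
  moreover have "{u \<in> topspace (subtopology X N). emult e (graph_h u) \<in> W} = N \<inter> {u \<in> N. emult e (graph_h u) \<in> W}"
    using N_sub topspace_X by auto
  ultimately show "openin (subtopology X N) {u \<in> topspace (subtopology X N). emult e (graph_h u) \<in> W}"
    by (simp add: openin_subtopology_Int2)
qed

lemma continuous_map_fst_etop: "continuous_map etop X fst"
proof (rule etop_continuous_mapI)
  show "e \<in> H \<Longrightarrow> fst e \<in> topspace X" for e using H_carrier topspace_X by simp
  fix e W assume e: "e \<in> H" and W: "openin X W" "fst e \<in> W"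
  show "\<exists>U. openin X U \<and> \<one> \<in> U \<and> (\<forall>u\<in>U \<inter> N. fst (emult e (graph_h u)) \<in> W)"
    using open_preimage[OF mult_left_cont[OF H_carrier[OF e]] W(1)] W(2) H_carrier[OF e]
    by (intro exI[of _ "{y \<in> carrier G. fst e \<otimes> y \<in> W}"]) (auto simp: emult_def graph_h_def)
qed

text \<open>Every point lies on the ray from \<open>x0\<close> through some \<open>\<phi> y\<close>, where \<open>h u (\<phi> y) = \<phi> (u \<otimes> y)\<close>.\<close>

lemma h_near_one:
  assumes W: "open W" "v \<in> W"
  obtains U where "openin X U" "\<one> \<in> U" "\<And>u. u \<in> U \<Longrightarrow> u \<in> N \<and> h u v \<in> W"
proof -
  obtain e where e: "e > 0" "(1 - e) *\<^sub>R x0 + e *\<^sub>R v \<in> ball x0 r"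
    using stretch_into_open[of "ball x0 r" x0] r_pos by auto
  then obtain y where y: "y \<in> N" "\<phi> y = (1 - e) *\<^sub>R x0 + e *\<^sub>R v"
    unfolding phi_N[symmetric] by (metis imageE)
  have v: "v = (1 - 1 / e) *\<^sub>R x0 + (1 / e) *\<^sub>R \<phi> y"
    unfolding y(2) using e by (intro stretch_eq) simp
  let ?V = "{u \<in> carrier G. u \<otimes> y \<in> N} \<inter> N"
  have V: "openin X ?V" using y by (intro openin_Int open_preimage mult_right_cont N_open) auto
  have c: "continuous_map (subtopology X N) euclidean \<phi>" using chart_onD(6)[OF N_chart] .
  have c1: "continuous_map (subtopology X ?V) euclidean \<phi>"
    by (rule continuous_map_from_subtopology_mono[OF c]) auto
  have "continuous_map (subtopology X ?V) (subtopology X N) (\<lambda>u. u \<otimes> y)"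
    using y by (auto simp: continuous_map_in_subtopology intro!: continuous_map_from_subtopology mult_right_cont)
  from continuous_map_compose[OF this c]
  have c2: "continuous_map (subtopology X ?V) euclidean (\<lambda>u. \<phi> (u \<otimes> y))" by (simp add: o_def)
  have "continuous_map (subtopology X ?V) euclidean (\<lambda>u. (1 - 1 / e) *\<^sub>R \<phi> u + (1 / e) *\<^sub>R \<phi> (u \<otimes> y))"
  proof (rule continuous_map_add)
    show "continuous_map (subtopology X ?V) euclidean (\<lambda>u. (1 - 1 / e) *\<^sub>R \<phi> u)"
      using continuous_map_compose[OF c1, of euclidean "\<lambda>z. (1 - 1 / e) *\<^sub>R z"]
      by (simp add: o_def continuous_intros)
    show "continuous_map (subtopology X ?V) euclidean (\<lambda>u. (1 / e) *\<^sub>R \<phi> (u \<otimes> y))"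
      using continuous_map_compose[OF c2, of euclidean "\<lambda>z. (1 / e) *\<^sub>R z"]
      by (simp add: o_def continuous_intros)
  qed
  then have "openin (subtopology X ?V) {u \<in> topspace (subtopology X ?V). (1 - 1 / e) *\<^sub>R \<phi> u + (1 / e) *\<^sub>R \<phi> (u \<otimes> y) \<in> W}"
    using W(1) openin_continuous_map_preimage open_openin by blast
  then have "openin X {u \<in> topspace (subtopology X ?V). (1 - 1 / e) *\<^sub>R \<phi> u + (1 / e) *\<^sub>R \<phi> (u \<otimes> y) \<in> W}"
    (is "openin X ?U") using V openin_trans_full by blast
  moreover have "\<one> \<in> ?U" using y one_N W(2) v phi_one topspace_X by simp
  moreover have "h u v \<in> W" if "u \<in> ?U" for u
  proof -
    have u: "u \<in> N" "u \<otimes> y \<in> N" using that by auto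
    have "h u ((1 - 1 / e) *\<^sub>R x0 + (1 / e) *\<^sub>R \<phi> y) = (1 - 1 / e) *\<^sub>R \<phi> u + (1 / e) *\<^sub>R \<phi> (u \<otimes> y)"
      using affine_map_combination[OF affine_automorphism_imp_affine_map[OF h_aut[OF u(1)]]]
        h_x0[OF u(1)] h_phi[OF u(1) y(1) u(2)] by simp
    then show ?thesis using that v by auto
  qed
  ultimately show ?thesis by (intro that[of ?U]) auto
qed

lemma continuous_map_eval: "continuous_map etop euclidean (\<lambda>e. snd e v)"
proof (rule etop_continuous_mapI)
  fix e and W :: "'v set" assume e: "e \<in> H" and W: "openin euclidean W" "snd e v \<in> W"
  have "open (snd e -` W)"
    using affine_automorphism_continuous_on[OF H_aut[OF e], of UNIV] W by (auto intro: open_vimage)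
  then obtain U where "openin X U" "\<one> \<in> U" "\<And>u. u \<in> U \<Longrightarrow> u \<in> N \<and> h u v \<in> snd e -` W"
    using h_near_one W(2) by (metis vimageI2)
  then show "\<exists>U. openin X U \<and> \<one> \<in> U \<and> (\<forall>u\<in>U \<inter> N. snd (emult e (graph_h u)) v \<in> W)"
    by (intro exI[of _ U]) (auto simp: emult_def graph_h_def)
qed simp

text \<open>For \<open>u\<close> near the unit the inverse of \<open>h u\<close> is
  \<open>h (inv u)\<close>, so that continuity of the group inverse reduces the claim to
  \<open>h_near_one\<close>.\<close>

lemma continuous_map_inverse_eval: "continuous_map etop euclidean (\<lambda>e. inv_into UNIV (snd e) v)"
proof (rule etop_continuous_mapI)
  fix e and W :: "'v set" assume e: "e \<in> H" and W: "openin euclidean W" "inv_into UNIV (snd e) v \<in> W"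
  then obtain U where U: "openin X U" "\<one> \<in> U"
      "\<And>u. u \<in> U \<Longrightarrow> u \<in> N \<and> h u (inv_into UNIV (snd e) v) \<in> W"
    using h_near_one open_openin by metis
  let ?V = "{u \<in> carrier G. inv u \<in> U}"
  have "openin X ?V" using U(1) inv_cont by (intro open_preimage)
  moreover have "\<one> \<in> ?V" using U by simp
  moreover have "inv_into UNIV (snd (emult e (graph_h u))) v \<in> W" if u: "u \<in> ?V \<inter> N" for u
  proof -
    have iu: "inv u \<in> N" using U u by blast
    have "inv_into UNIV (snd (emult e (graph_h u))) v = inv_into UNIV (h u) (inv_into UNIV (snd e) v)"
      using einv_emult[OF H_valid[OF e] valid_graph_h, of u] u
      by (simp add: einv_def emult_def graph_h_def)
    also have "\<dots> = h (inv u) (inv_into UNIV (snd e) v)" using h_inv iu u by simp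
    finally show ?thesis using U u by simp
  qed
  ultimately show "\<exists>U. openin X U \<and> \<one> \<in> U \<and> (\<forall>u\<in>U \<inter> N. inv_into UNIV (snd (emult e (graph_h u))) v \<in> W)"
    by blast
qed simp

lemma emult_graph_h_inj:
  assumes "valid e" "valid e'" "u \<in> N" "u' \<in> N" "fst e = fst e'"
    "emult e (graph_h u) = emult e' (graph_h u')"
  shows "e = e'"
proof -
  have "u = u'" using assms by (auto simp: emult_def graph_h_def valid_def)
  then show ?thesis
    using assms emult_einv_cancel(1)[OF assms(1) valid_graph_h] emult_einv_cancel(1)[OF assms(2) valid_graph_h]
    by metis
qed

text \<open>Elements with different first components are separated already in \<open>X\<close>. Over
  the same first component, a common point of the two sheets would give equal elements by
  cancellation.\<close>

lemma Hausdorff_etop: "Hausdorff_space etop"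
  unfolding Hausdorff_space_def topspace_etop
proof (intro allI impI)
  fix e e' assume e: "e \<in> H \<and> e' \<in> H \<and> e \<noteq> e'"
  show "\<exists>U V. openin etop U \<and> openin etop V \<and> e \<in> U \<and> e' \<in> V \<and> disjnt U V"
  proof (cases "fst e = fst e'")
    case False
    then obtain U V where UV: "openin X U" "openin X V" "fst e \<in> U" "fst e' \<in> V" "disjnt U V"
      using Hausdorff_X e H_carrier topspace_X unfolding Hausdorff_space_def by metis
    then show ?thesis
      using e openin_continuous_map_preimage[OF continuous_map_fst_etop UV(1)]
        openin_continuous_map_preimage[OF continuous_map_fst_etop UV(2)]
      by (intro exI[of _ "{e \<in> topspace etop. fst e \<in> U}"] exI[of _ "{e \<in> topspace etop. fst e \<in> V}"])
        (auto simp: topspace_etop disjnt_def)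
  next
    case True
    have "disjnt ((\<lambda>u. emult e (graph_h u)) ` N) ((\<lambda>u. emult e' (graph_h u)) ` N)"
      unfolding disjnt_iff
    proof (intro allI notI, elim conjE imageE)
      fix x u v assume x: "x = emult e (graph_h u)" "u \<in> N" "x = emult e' (graph_h v)" "v \<in> N"
      have "e = e'"
        by (rule emult_graph_h_inj[OF _ _ x(2,4) True]) (use e x H_valid in simp_all)
      then show False using e by blast
    qed
    moreover have "d \<in> (\<lambda>u. emult d (graph_h u)) ` N" if "d \<in> H" for d
      using emult_graph_h_one[OF H_valid[OF that]] one_N by (metis imageI)
    ultimately show ?thesis
      using openin_sheet[of e N] openin_sheet[of e' N] e N_open by (meson order_refl)
  qed
qed

text \<open>The translate of \<open>N\<close> by \<open>y\<close> is evenly covered: an element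
  \<open>e\<close> over it lies on the sheet through \<open>d\<close>, the element over the centre
  \<open>y\<close> that is obtained from \<open>e\<close> by dividing off the graph element of
  \<open>inv y \<otimes> fst e\<close>.\<close>

theorem covering_fst: "covering etop X fst"
  unfolding covering_def
proof (intro conjI ballI Hausdorff_etop continuous_map_fst_etop)
  fix y assume "y \<in> topspace X"
  then have y: "y \<in> carrier G" using topspace_X by simp
  let ?U = "{x \<in> carrier G. inv y \<otimes> x \<in> N}"
  have U: "openin X ?U" using y by (intro open_preimage mult_left_cont N_open) auto
  show "\<exists>U. openin X U \<and> y \<in> U \<and> (\<forall>e\<in>topspace etop. fst e \<in> U \<longrightarrow>
     (\<exists>\<sigma>. continuous_map (subtopology X U) etop \<sigma> \<and> \<sigma> (fst e) = e \<and> (\<forall>x\<in>U. fst (\<sigma> x) = x) \<and> openin etop (\<sigma> ` U)))"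
  proof (intro exI[of _ ?U] conjI ballI impI U)
    show "y \<in> ?U" using y one_N by simp
    fix e assume "e \<in> topspace etop" and eU: "fst e \<in> ?U"
    then have e: "e \<in> H" by (simp add: topspace_etop)
    let ?u = "inv y \<otimes> fst e"
    have u: "?u \<in> N" using eU by simp
    define d where "d = emult e (einv (graph_h ?u))"
    have d: "d \<in> H" using H.div_H[OF e u] by (simp add: d_def)
    have du: "emult d (graph_h ?u) = e"
      unfolding d_def using emult_einv_cancel(2)[OF H_valid[OF e] valid_graph_h[OF u]] .
    have fd: "fst d = y"
      using y H_carrier[OF e] u by (simp add: d_def emult_def einv_def graph_h_def inv_mult_group flip: m_assoc)
    let ?s = "\<lambda>x. emult d (graph_h (inv y \<otimes> x))"
    show "\<exists>\<sigma>. continuous_map (subtopology X ?U) etop \<sigma> \<and> \<sigma> (fst e) = e \<and> (\<forall>x\<in>?U. fst (\<sigma> x) = x) \<and> openin etop (\<sigma> ` ?U)"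
    proof (intro exI[of _ ?s] conjI ballI)
      have "continuous_map (subtopology X ?U) (subtopology X N) (\<lambda>x. inv y \<otimes> x)"
        using y by (auto simp: continuous_map_in_subtopology intro!: continuous_map_from_subtopology mult_left_cont)
      from continuous_map_compose[OF this continuous_map_sheet[OF d]]
      show "continuous_map (subtopology X ?U) etop ?s" by (simp add: o_def)
      show "?s (fst e) = e" by (rule du)
      show "fst (?s x) = x" if "x \<in> ?U" for x
        using that y fd by (simp add: emult_def graph_h_def flip: m_assoc)
      have "(\<lambda>x. inv y \<otimes> x) ` ?U = N"
      proof
        show "N \<subseteq> (\<lambda>x. inv y \<otimes> x) ` ?U"
        proof
          fix n assume n: "n \<in> N"
          then have "n = inv y \<otimes> (y \<otimes> n)" using y by (simp flip: m_assoc)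
          then show "n \<in> (\<lambda>x. inv y \<otimes> x) ` ?U" using n y by (intro image_eqI[of _ _ "y \<otimes> n"]) auto
        qed
      qed auto
      then have "?s ` ?U = (\<lambda>u. emult d (graph_h u)) ` N"
        using image_image[of "\<lambda>u. emult d (graph_h u)" "\<lambda>x. inv y \<otimes> x" ?U] by simp
      then show "openin etop (?s ` ?U)" using openin_sheet[OF d N_open] by simp
    qed
  qed
qed

section \<open>The orbit of \<open>x0\<close>, and the developing map as a covering of it\<close>

definition \<Omega> :: "'v set" where "\<Omega> = (\<lambda>e. snd e x0) ` H"

text \<open>The graph of \<open>h\<close> near the unit is invariant under conjugation by \<open>H\<close>, although \<open>H\<close> need not be
  normal in the product. This makes right translations of \<open>H\<close> homeomorphisms.\<close>

lemma conj_graph_h: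
  assumes "z \<in> H"
  obtains V where "openin X V" "\<one> \<in> V"
    "\<And>v. v \<in> V \<Longrightarrow> v \<in> N \<and> fst z \<otimes> v \<otimes> inv (fst z) \<in> N \<and>
        emult z (graph_h v) = emult (graph_h (fst z \<otimes> v \<otimes> inv (fst z))) z"
proof -
  let ?c = "\<lambda>z v. fst z \<otimes> v \<otimes> inv (fst z)"
  have "\<exists>V. openin X V \<and> \<one> \<in> V \<and>
     (\<forall>v\<in>V. v \<in> N \<and> ?c z v \<in> N \<and> emult z (graph_h v) = emult (graph_h (?c z v)) z)"
    using assms
  proof induction
    case eone_H
    then show ?case using N_open one_N
      by (intro exI[of _ N]) (auto simp: eone_def emult_def graph_h_def)
  next
    case (mult_H z u)
    then obtain V where V: "openin X V" "\<one> \<in> V"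
      "\<And>v. v \<in> V \<Longrightarrow> v \<in> N \<and> ?c z v \<in> N \<and> emult z (graph_h v) = emult (graph_h (?c z v)) z" by blast
    note zu = H_carrier[OF mult_H.hyps(1)] mult_H.hyps(2) H_valid[OF mult_H.hyps(1)]
    let ?V = "{v \<in> carrier G. u \<otimes> v \<otimes> inv u \<in> V} \<inter> ({v \<in> carrier G. u \<otimes> v \<in> N} \<inter> N)"
    have "openin X ?V" using zu V N_open
      by (intro openin_Int open_preimage conj_cont mult_left_cont) auto
    moreover have "\<one> \<in> ?V" using zu V one_N by simp
    moreover have "v \<in> N \<and> ?c (emult z (graph_h u)) v \<in> N \<and>
       emult (emult z (graph_h u)) (graph_h v) = emult (graph_h (?c (emult z (graph_h u)) v)) (emult z (graph_h u))"
      if "v \<in> ?V" for v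
    proof -
      let ?w = "u \<otimes> v \<otimes> inv u"
      have v: "v \<in> N" "u \<otimes> v \<in> N" "?w \<in> V" using that by auto
      note w = V(3)[OF v(3)]
      have wu: "?w \<otimes> u = u \<otimes> v" using zu v by (simp add: m_assoc)
      have cc: "?c (emult z (graph_h u)) v = ?c z ?w"
        using zu v by (simp add: emult_def graph_h_def inv_mult_group m_assoc)
      have "emult (emult z (graph_h u)) (graph_h v) = emult z (graph_h (u \<otimes> v))"
        using zu v by (simp add: emult_graph_h)
      also have "\<dots> = emult (emult z (graph_h ?w)) (graph_h u)"
        using zu v w wu by (subst emult_graph_h) auto
      also have "\<dots> = emult (emult (graph_h (?c z ?w)) z) (graph_h u)" using w by simp
      also have "\<dots> = emult (graph_h (?c z ?w)) (emult z (graph_h u))"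
        using zu w by (simp add: emult_assoc valid_graph_h)
      finally show ?thesis using v w cc by simp
    qed
    ultimately show ?case by (intro exI[of _ ?V]) blast
  next
    case (div_H z u)
    then obtain V where V: "openin X V" "\<one> \<in> V"
      "\<And>v. v \<in> V \<Longrightarrow> v \<in> N \<and> ?c z v \<in> N \<and> emult z (graph_h v) = emult (graph_h (?c z v)) z" by blast
    note zu = H_carrier[OF div_H.hyps(1)] div_H.hyps(2) H_valid[OF div_H.hyps(1)]
    let ?V = "{v \<in> carrier G. inv u \<otimes> v \<otimes> inv (inv u) \<in> {w \<in> carrier G. u \<otimes> w \<in> N} \<inter> (V \<inter> N)} \<inter> N"
    have "openin X ?V" using zu V N_open
      by (intro openin_Int open_preimage conj_cont mult_left_cont) auto
    moreover have "\<one> \<in> ?V" using zu V one_N by simp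
    moreover have "v \<in> N \<and> ?c (emult z (einv (graph_h u))) v \<in> N \<and>
       emult (emult z (einv (graph_h u))) (graph_h v)
         = emult (graph_h (?c (emult z (einv (graph_h u))) v)) (emult z (einv (graph_h u)))"
      if "v \<in> ?V" for v
    proof -
      let ?w = "inv u \<otimes> v \<otimes> inv (inv u)"
      have v: "v \<in> N" "?w \<in> V" "?w \<in> N" "u \<otimes> ?w \<in> N" using that by auto
      note w = V(3)[OF v(2)]
      have uw: "u \<otimes> ?w = v \<otimes> u" using zu v by (simp flip: m_assoc)
      have cc: "?c (emult z (einv (graph_h u))) v = ?c z ?w"
        using zu v by (simp add: emult_def graph_h_def einv_def inv_mult_group m_assoc)
      have gv: "emult (graph_h v) (graph_h u) = emult (graph_h u) (graph_h ?w)"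
      proof -
        have "emult (graph_h v) (graph_h u) = graph_h (v \<otimes> u)"
          using h_mult[of v u] zu v uw by (simp add: emult_def graph_h_def)
        also have "\<dots> = emult (graph_h u) (graph_h ?w)"
          unfolding uw[symmetric] using h_mult[of u ?w] zu v by (simp add: emult_def graph_h_def)
        finally show ?thesis .
      qed
      have "emult (einv (graph_h u)) (graph_h v)
          = emult (einv (graph_h u)) (emult (emult (graph_h v) (graph_h u)) (einv (graph_h u)))"
        using zu v by (simp add: emult_einv_cancel valid_graph_h)
      also have "\<dots> = emult (graph_h ?w) (einv (graph_h u))"
        unfolding gv using zu v
        by (simp add: emult_assoc[of "graph_h u"] emult_einv_cancel valid_graph_h valid_einv valid_emult)
      finally have g2: "emult (einv (graph_h u)) (graph_h v) = emult (graph_h ?w) (einv (graph_h u))" .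
      have "emult (emult z (einv (graph_h u))) (graph_h v) = emult (emult z (graph_h ?w)) (einv (graph_h u))"
        using zu v g2 by (simp add: emult_assoc valid_graph_h valid_einv)
      also have "\<dots> = emult (emult (graph_h (?c z ?w)) z) (einv (graph_h u))" using w by simp
      also have "\<dots> = emult (graph_h (?c z ?w)) (emult z (einv (graph_h u)))"
        using zu w by (simp add: emult_assoc valid_graph_h valid_einv)
      finally show ?thesis using v w cc by simp
    qed
    ultimately show ?case by (intro exI[of _ ?V]) blast
  qed
  then show ?thesis using that by blast
qed

text \<open>A factor \<open>graph_h v\<close> to the left of \<open>z\<close> moves to its right at
  the price of conjugating \<open>v\<close> by the inverse of \<open>z\<close>, and conjugation
  keeps \<open>v\<close> close to the unit.\<close>

lemma continuous_map_right_translation: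
  assumes z: "z \<in> H"
  shows "continuous_map etop etop (\<lambda>e. emult e z)"
proof (rule etop_continuous_mapI)
  show "e \<in> H \<Longrightarrow> emult e z \<in> topspace etop" for e using z H_emult topspace_etop by simp
  fix e W assume e: "e \<in> H" and W: "openin etop W" "emult e z \<in> W"
  then obtain U where U: "openin X U" "\<one> \<in> U" "\<forall>u\<in>U \<inter> N. emult (emult e z) (graph_h u) \<in> W"
    unfolding openin_etop by blast
  have iz: "einv z \<in> H" using z by (rule H_einv)
  obtain V where V: "openin X V" "\<one> \<in> V"
    "\<And>v. v \<in> V \<Longrightarrow> v \<in> N \<and> fst (einv z) \<otimes> v \<otimes> inv (fst (einv z)) \<in> N \<and>
        emult (einv z) (graph_h v) = emult (graph_h (fst (einv z) \<otimes> v \<otimes> inv (fst (einv z)))) (einv z)"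
    using iz by (rule conj_graph_h) (rule that)
  let ?c = "\<lambda>v. fst (einv z) \<otimes> v \<otimes> inv (fst (einv z))"
  let ?V = "{v \<in> carrier G. ?c v \<in> U} \<inter> V"
  have "openin X ?V" using H_carrier[OF iz] U V by (intro openin_Int open_preimage conj_cont) auto
  moreover have "\<one> \<in> ?V" using H_carrier[OF iz] U V by simp
  moreover have "emult (emult e (graph_h v)) z \<in> W" if v: "v \<in> ?V \<inter> N" for v
  proof -
    note vz = V(3)[of v]
    have val: "valid e" "valid z" "valid (graph_h v)" "valid (graph_h (?c v))"
      using e z v vz H_valid valid_graph_h by auto
    have "emult (graph_h v) z = emult z (emult (emult (einv z) (graph_h v)) z)"
      using val by (simp add: emult_assoc valid_einv valid_emult emult_einv_cancel)
    also have "emult (emult (einv z) (graph_h v)) z = graph_h (?c v)"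
      using vz v val by (simp add: emult_einv_cancel)
    finally have "emult (emult e (graph_h v)) z = emult (emult e z) (graph_h (?c v))"
      using val by (simp add: emult_assoc)
    then show ?thesis using U(3) v vz by simp
  qed
  ultimately show "\<exists>U. openin X U \<and> \<one> \<in> U \<and> (\<forall>u\<in>U \<inter> N. emult (emult e (graph_h u)) z \<in> W)" by blast
qed

lemma open_right_translation:
  assumes z: "z \<in> H" and W: "openin etop W"
  shows "openin etop ((\<lambda>e. emult e z) ` W)"
proof -
  have WH: "W \<subseteq> H" using W openin_etop by blast
  have "(\<lambda>e. emult e z) ` W = {e \<in> topspace etop. emult e (einv z) \<in> W}"
  proof
    show "(\<lambda>e. emult e z) ` W \<subseteq> {e \<in> topspace etop. emult e (einv z) \<in> W}"
    proof (rule image_subsetI)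
      fix e assume e: "e \<in> W"
      then have "e \<in> H" using WH by blast
      then show "emult e z \<in> {e \<in> topspace etop. emult e (einv z) \<in> W}"
        using e z H_emult by (simp add: topspace_etop emult_einv_cancel H_valid)
    qed
    show "{e \<in> topspace etop. emult e (einv z) \<in> W} \<subseteq> (\<lambda>e. emult e z) ` W"
    proof clarify
      fix a b assume "(a, b) \<in> topspace etop" "emult (a, b) (einv z) \<in> W"
      then show "(a, b) \<in> (\<lambda>e. emult e z) ` W"
        using z by (intro image_eqI[of _ _ "emult (a, b) (einv z)"])
          (auto simp: topspace_etop emult_einv_cancel H_valid)
    qed
  qed
  then show ?thesis
    using openin_continuous_map_preimage[OF continuous_map_right_translation[OF H_einv[OF z]] W] by simp
qed

lemma dev_sheet: "u \<in> N \<Longrightarrow> snd (emult e (graph_h u)) x0 = snd e (\<phi> u)"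
  by (simp add: emult_def graph_h_def h_x0)

lemma open_\<Omega>_nbhd:
  assumes "e \<in> H" shows "open (snd e ` ball x0 r)" "snd e ` ball x0 r \<subseteq> \<Omega>"
proof -
  show "open (snd e ` ball x0 r)" using affine_automorphism_open_image[OF H_aut[OF assms]] by simp
  show "snd e ` ball x0 r \<subseteq> \<Omega>"
    unfolding phi_N[symmetric] \<Omega>_def using dev_sheet[of _ e] H.mult_H[OF assms] by force
qed

lemma x0_\<Omega>: "x0 \<in> \<Omega>"
  unfolding \<Omega>_def using H.eone_H by (force simp: eone_def)

lemma open_\<Omega>: "open \<Omega>"
proof (rule Topological_Spaces.openI)
  fix x assume "x \<in> \<Omega>"
  then obtain e where e: "e \<in> H" "x = snd e x0" unfolding \<Omega>_def by blast
  then have "x \<in> snd e ` ball x0 r" using r_pos by simp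
  then show "\<exists>T. open T \<and> x \<in> T \<and> T \<subseteq> \<Omega>" using open_\<Omega>_nbhd[OF e(1)] by blast
qed

lemma \<Omega>_invariant: assumes "e \<in> H" "x \<in> \<Omega>" shows "snd e x \<in> \<Omega>"
proof -
  obtain d where d: "d \<in> H" "x = snd d x0" using assms(2) unfolding \<Omega>_def by blast
  have "snd e x = snd (emult e d) x0" by (simp add: emult_def d)
  then show ?thesis unfolding \<Omega>_def using H_emult[OF assms(1) d(1)] by blast
qed

lemma \<Omega>_invariant_iff: assumes e: "e \<in> H" shows "snd e x \<in> \<Omega> \<longleftrightarrow> x \<in> \<Omega>"
proof
  assume "snd e x \<in> \<Omega>"
  then have "snd (einv e) (snd e x) \<in> \<Omega>" using \<Omega>_invariant[OF H_einv[OF e]] by blast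
  then show "x \<in> \<Omega>" using H_aut[OF e] by (simp add: einv_def)
qed (rule \<Omega>_invariant[OF e])

text \<open>Multiplying an element by one generator, or dividing it, moves its point of the orbit
  within a single affine image of the ball around \<open>x0\<close>.\<close>

lemma connected_\<Omega>: "connected \<Omega>"
proof -
  have "connected_component \<Omega> x0 (snd e x0)" if "e \<in> H" for e
    using that
  proof induction
    case eone_H
    then show ?case using x0_\<Omega> by (simp add: eone_def)
  next
    case (mult_H e u)
    have "connected (snd e ` ball x0 r)"
      using affine_automorphism_continuous_on[OF H_aut[OF mult_H.hyps(1)]] by (intro connected_continuous_image) auto
    moreover have "snd e x0 \<in> snd e ` ball x0 r" "snd (emult e (graph_h u)) x0 \<in> snd e ` ball x0 r"
      using r_pos dev_sheet[of u e] mult_H.hyps(2) phi_N by auto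
    ultimately have "connected_component \<Omega> (snd e x0) (snd (emult e (graph_h u)) x0)"
      using open_\<Omega>_nbhd(2)[OF mult_H.hyps(1)] unfolding connected_component_def by blast
    then show ?case using mult_H.IH connected_component_trans by blast
  next
    case (div_H e u)
    let ?d = "emult e (einv (graph_h u))"
    have d: "?d \<in> H" using H.div_H div_H.hyps by blast
    have e: "e = emult ?d (graph_h u)"
      using emult_einv_cancel(2)[OF H_valid[OF div_H.hyps(1)] valid_graph_h[OF div_H.hyps(2)]] by simp
    have "connected (snd ?d ` ball x0 r)"
      using affine_automorphism_continuous_on[OF H_aut[OF d]] by (intro connected_continuous_image) auto
    moreover have "snd e x0 \<in> snd ?d ` ball x0 r" "snd ?d x0 \<in> snd ?d ` ball x0 r"
      using r_pos dev_sheet[OF div_H.hyps(2), of ?d] e div_H.hyps(2) phi_N by auto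
    ultimately have "connected_component \<Omega> (snd e x0) (snd ?d x0)"
      using open_\<Omega>_nbhd(2)[OF d] unfolding connected_component_def by blast
    then show ?case using div_H.IH connected_component_trans by blast
  qed
  then have *: "connected_component \<Omega> x0 x" if "x \<in> \<Omega>" for x
    using that unfolding \<Omega>_def by blast
  show ?thesis
    unfolding connected_iff_connected_component
    using * connected_component_sym connected_component_trans by meson
qed

text \<open>Elements with the same image differ by a right factor \<open>z\<close> that fixes
  \<open>x0\<close>. The sheets over the image of the ball under \<open>snd d\<close> are thus right
  translates, by such \<open>z\<close>, of the sheet through \<open>d\<close>; they are open because
  right translations are homeomorphisms.\<close>

theorem covering_dev: "covering etop (top_of_set \<Omega>) (\<lambda>e. snd e x0)"
  unfolding covering_def
proof (intro conjI ballI Hausdorff_etop)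
  show "continuous_map etop (top_of_set \<Omega>) (\<lambda>e. snd e x0)"
    using continuous_map_eval by (auto simp: continuous_map_in_subtopology \<Omega>_def topspace_etop)
  fix y assume "y \<in> topspace (top_of_set \<Omega>)"
  then obtain d where d: "d \<in> H" "y = snd d x0" by (auto simp: \<Omega>_def)
  let ?U = "snd d ` ball x0 r"
  have dv: "valid d" "affine_automorphism (snd d)" using d H_valid H_aut by auto
  show "\<exists>U. openin (top_of_set \<Omega>) U \<and> y \<in> U \<and> (\<forall>e\<in>topspace etop. snd e x0 \<in> U \<longrightarrow>
     (\<exists>\<sigma>. continuous_map (subtopology (top_of_set \<Omega>) U) etop \<sigma> \<and> \<sigma> (snd e x0) = e \<and>
       (\<forall>x\<in>U. snd (\<sigma> x) x0 = x) \<and> openin etop (\<sigma> ` U)))"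
  proof (intro exI[of _ ?U] conjI ballI impI)
    show "openin (top_of_set \<Omega>) ?U" using open_\<Omega>_nbhd[OF d(1)] by (meson open_openin_trans openin_open_eq open_\<Omega>)
    show "y \<in> ?U" using d r_pos by simp
    fix e assume "e \<in> topspace etop" and eU: "snd e x0 \<in> ?U"
    then have e: "e \<in> H" by (simp add: topspace_etop)
    obtain u where u: "u \<in> N" "snd e x0 = snd d (\<phi> u)" using eU unfolding phi_N[symmetric] by blast
    let ?du = "emult d (graph_h u)"
    have du: "?du \<in> H" using d u H.mult_H by blast
    define z where "z = emult (einv ?du) e"
    have z: "z \<in> H" unfolding z_def using H_emult H_einv du e by blast
    have duz: "emult ?du z = e" unfolding z_def using du e by (simp add: emult_einv_cancel H_valid)
    have "snd ?du (snd z x0) = snd ?du x0"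
      using arg_cong[OF duz, of "\<lambda>e. snd e x0"] u dev_sheet[OF u(1), of d] by (simp add: emult_def)
    then have zx: "snd z x0 = x0" using affine_automorphism_inj[OF H_aut[OF du]] by simp
    \<comment> \<open>\<open>?k x\<close> is the element of \<open>N\<close> whose chart point is
      moved to \<open>x\<close> by \<open>snd d\<close>.\<close>
    let ?k = "\<lambda>x. inv_into N \<phi> (inv_into UNIV (snd d) x)"
    let ?s = "\<lambda>x. emult (emult d (graph_h (?k x))) z"
    have k: "?k x \<in> N" "\<phi> (?k x) = inv_into UNIV (snd d) x" if x: "x \<in> ?U" for x
    proof -
      have "inv_into UNIV (snd d) x \<in> \<phi> ` N" using x dv phi_N by auto
      then show "?k x \<in> N" "\<phi> (?k x) = inv_into UNIV (snd d) x"
        by (auto intro: inv_into_into f_inv_into_f)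
    qed
    have kim: "?k ` ?U = N"
    proof
      show "N \<subseteq> ?k ` ?U"
      proof
        fix n assume n: "n \<in> N"
        have "n = ?k (snd d (\<phi> n))" using n dv phi_inj by simp
        then show "n \<in> ?k ` ?U" using n phi_N by blast
      qed
    qed (use k in blast)
    show "\<exists>\<sigma>. continuous_map (subtopology (top_of_set \<Omega>) ?U) etop \<sigma> \<and> \<sigma> (snd e x0) = e \<and>
       (\<forall>x\<in>?U. snd (\<sigma> x) x0 = x) \<and> openin etop (\<sigma> ` ?U)"
    proof (intro exI[of _ ?s] conjI ballI)
      have UO: "\<Omega> \<inter> ?U = ?U" using open_\<Omega>_nbhd[OF d(1)] by blast
      have "continuous_map (top_of_set ?U) (top_of_set (\<phi> ` N)) (inv_into UNIV (snd d))"
        using affine_automorphism_continuous_on[OF affine_automorphism_inverse[OF dv(2)]] dv phi_N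
        by (auto simp: continuous_map_in_subtopology)
      from continuous_map_compose[OF continuous_map_compose[OF this chart_on_inverse_continuous[OF N_chart]]
          continuous_map_compose[OF continuous_map_sheet[OF d(1)] continuous_map_right_translation[OF z]]]
      show "continuous_map (subtopology (top_of_set \<Omega>) ?U) etop ?s"
        by (simp add: o_def subtopology_subtopology UO)
      show "?s (snd e x0) = e" using u dv phi_inj duz by simp
      show "snd (?s x) x0 = x" if "x \<in> ?U" for x
      proof -
        have "snd (?s x) x0 = snd (emult d (graph_h (?k x))) x0" using zx by (simp add: emult_def)
        also have "\<dots> = snd d (\<phi> (?k x))" using k[OF that] dev_sheet by blast
        finally show ?thesis using k[OF that] dv by simp
      qed
      have "?s ` ?U = (\<lambda>u. emult (emult d (graph_h u)) z) ` (?k ` ?U)"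
        by (simp add: image_image)
      then have "?s ` ?U = (\<lambda>e. emult e z) ` ((\<lambda>u. emult d (graph_h u)) ` N)"
        unfolding kim by (simp add: image_image)
      then show "openin etop (?s ` ?U)"
        using open_right_translation[OF z openin_sheet[OF d(1) N_open]] by simp
    qed
  qed
qed

end

section \<open>Invariant walls\<close>

definition affine_grad :: "('v::euclidean_space \<Rightarrow> real) \<Rightarrow> 'v" where
  "affine_grad m = (\<Sum>b\<in>Basis. (m b - m 0) *\<^sub>R b)"

lemma affine_functional:
  assumes "affine_map m"
  shows "m x = m y + affine_grad m \<bullet> (x - y)"
proof -
  let ?A = "\<lambda>x. m x - m 0"
  have lin: "linear ?A" using assms by (simp add: affine_map_altdef)
  have A: "?A v = affine_grad m \<bullet> v" for v
  proof -
    have "?A v = ?A (\<Sum>b\<in>Basis. (v \<bullet> b) *\<^sub>R b)" by (simp add: euclidean_representation)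
    also have "\<dots> = (\<Sum>b\<in>Basis. ?A ((v \<bullet> b) *\<^sub>R b))" by (rule linear_sum[OF lin])
    also have "\<dots> = (\<Sum>b\<in>Basis. (v \<bullet> b) *\<^sub>R ?A b)"
      by (intro sum.cong refl) (rule linear_scale[OF lin])
    also have "\<dots> = affine_grad m \<bullet> v"
      unfolding affine_grad_def inner_sum_left by (intro sum.cong refl) (simp add: inner_commute)
    finally show ?thesis .
  qed
  show ?thesis using A[of x] A[of y] by (simp add: inner_diff_right)
qed

lemma affine_functional_segment:
  fixes m :: "'v::euclidean_space \<Rightarrow> real"
  assumes "affine_map m"
  shows "m ((1 - t) *\<^sub>R x + t *\<^sub>R y) = (1 - t) * m x + t * m y"
  using affine_map_combination[OF assms] by simp

lemma affine_functional_ray: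
  fixes m :: "'v::euclidean_space \<Rightarrow> real"
  assumes "affine_map m"
  shows "m (x + t *\<^sub>R (y - x)) = (1 - t) * m x + t * m y"
  using affine_functional_segment[OF assms, of t x y] by (simp add: algebra_simps)

lemma affine_functional_open_pos:
  fixes m :: "'v::euclidean_space \<Rightarrow> real"
  assumes "affine_map m" shows "open {x. m x > 0}"
  using open_Collect_less[OF continuous_on_const affine_map_continuous_on[OF assms]] .

text \<open>Of the subfamilies that cut out the same part of \<open>U\<close>, one of least size has
  no redundant member. Dropping \<open>j\<close> from it admits a point \<open>y\<close> violating
  only \<open>j\<close>. On the segment from \<open>z\<close> to \<open>y\<close> the functional
  \<open>m j\<close> vanishes at a point where all other members are positive; near this point
  \<open>m j\<close> alone decides.\<close>

lemma facet_point:
  fixes m :: "'j \<Rightarrow> 'v::euclidean_space \<Rightarrow> real"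
  assumes J: "finite J" and aff: "\<And>j. j \<in> J \<Longrightarrow> affine_map (m j)"
    and U: "open U" "convex U" and z: "z \<in> U" "\<And>j. j \<in> J \<Longrightarrow> m j z > 0"
    and x: "x \<in> U" "j0 \<in> J" "m j0 x \<le> 0"
  obtains j w e where "j \<in> J" "m j w = 0" "e > 0" "ball w e \<subseteq> U"
    "\<And>y k. y \<in> ball w e \<Longrightarrow> m j y > 0 \<Longrightarrow> k \<in> J \<Longrightarrow> m k y > 0"
proof -
  define P where "P I = {y \<in> U. \<forall>k\<in>I. m k y > 0}" for I
  obtain I where I: "I \<subseteq> J" "P I = P J" and Imin: "\<And>I'. I' \<subseteq> J \<Longrightarrow> P I' = P J \<Longrightarrow> card I \<le> card I'"
    using ex_has_least_nat[of "\<lambda>I. I \<subseteq> J \<and> P I = P J" J card] by (metis order_refl)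
  have "x \<notin> P J" "x \<in> P {}" using x by (force simp: P_def)+
  then have "I \<noteq> {}" using I(2) by metis
  then obtain j where j: "j \<in> I" by blast
  have finI: "finite I" using I(1) J finite_subset by blast
  have "P (I - {j}) \<noteq> P J"
    using Imin[of "I - {j}"] I(1) j card_Diff1_less[OF finI j] by auto
  then obtain y where y: "y \<in> P (I - {j})" "y \<notin> P I"
    using I unfolding P_def by blast
  have mjy: "m j y \<le> 0"
  proof (rule ccontr)
    assume "\<not> m j y \<le> 0"
    then have "m k y > 0" if "k \<in> I" for k
      using y(1) that unfolding P_def by (cases "k = j") auto
    then have "y \<in> P I" using y(1) unfolding P_def by blast
    then show False using y(2) by simp
  qed
  have mjz: "m j z > 0" using z j I by blast
  define t where "t = m j z / (m j z - m j y)"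
  have t: "0 < t" "t \<le> 1" using mjy mjz by (auto simp: t_def field_simps)
  define w where "w = (1 - t) *\<^sub>R z + t *\<^sub>R y"
  have aff': "affine_map (m k)" if "k \<in> I" for k using that I aff by blast
  have "m j w = (1 - t) * m j z + t * m j y"
    unfolding w_def using affine_functional_segment[OF aff'[OF j]] .
  also have "\<dots> = m j z - t * (m j z - m j y)" by (simp add: algebra_simps)
  also have "\<dots> = 0" using mjy mjz by (simp add: t_def)
  finally have mjw: "m j w = 0" .
  have mkw: "m k w > 0" if k: "k \<in> I - {j}" for k
  proof -
    have "m k w = (1 - t) * m k z + t * m k y"
      unfolding w_def using affine_functional_segment aff' k by blast
    moreover have "m k z > 0" "m k y > 0" using k I z y by (auto simp: P_def)
    ultimately show ?thesis using t by (simp add: add_nonneg_pos)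
  qed
  have wU: "w \<in> U" unfolding w_def using t z y U(2) by (intro convexD) (auto simp: P_def)
  have "open (U \<inter> (\<Inter>k\<in>I - {j}. {x. m k x > 0}))"
    using U finI aff' by (intro open_Int open_INT ballI affine_functional_open_pos) auto
  then obtain e where e: "e > 0" "ball w e \<subseteq> U \<inter> (\<Inter>k\<in>I - {j}. {x. m k x > 0})"
    using wU mkw open_contains_ball by (metis (mono_tags, lifting) INT_I IntI mem_Collect_eq)
  show ?thesis
  proof (rule that[of j w e])
    show "j \<in> J" "m j w = 0" "e > 0" "ball w e \<subseteq> U" using j I mjw e by auto
    fix v k assume v: "v \<in> ball w e" "m j v > 0" and k: "k \<in> J"
    have "v \<in> P I" unfolding P_def
    proof (intro CollectI conjI ballI)
      show "v \<in> U" using e v by blast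
      fix i assume "i \<in> I"
      then show "m i v > 0" using e v by (cases "i = j") auto
    qed
    then show "m k v > 0" using I(2) k by (auto simp: P_def)
  qed
qed

lemma finite_family_convergent_subsequence:
  fixes f :: "'j \<Rightarrow> nat \<Rightarrow> 'v::heine_borel"
  assumes "finite J" "\<And>j. j \<in> J \<Longrightarrow> bounded (range (f j))"
  obtains s l where "strict_mono (s :: nat \<Rightarrow> nat)" "\<And>j. j \<in> J \<Longrightarrow> (f j \<circ> s) \<longlonglongrightarrow> l j"
proof -
  have "\<exists>s. strict_mono (s :: nat \<Rightarrow> nat) \<and> (\<forall>j\<in>J. \<exists>l. (f j \<circ> s) \<longlonglongrightarrow> l)"
    using assms
  proof (induction J)
    case empty
    then show ?case using strict_mono_id by blast
  next
    case (insert j J)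
    have "\<exists>s. strict_mono (s :: nat \<Rightarrow> nat) \<and> (\<forall>j\<in>J. \<exists>l. (f j \<circ> s) \<longlonglongrightarrow> l)"
      by (rule insert.IH) (use insert.prems in blast)
    then obtain s where s: "strict_mono (s :: nat \<Rightarrow> nat)" "\<forall>j\<in>J. \<exists>l. (f j \<circ> s) \<longlonglongrightarrow> l"
      by (elim exE conjE)
    have "bounded (range (f j \<circ> s))"
      by (rule bounded_subset[of "range (f j)"]) (use insert.prems in auto)
    then obtain l t where t: "strict_mono t" "((f j \<circ> s) \<circ> t) \<longlonglongrightarrow> l"
      using bounded_imp_convergent_subsequence by blast
    have "\<exists>l. (f i \<circ> (s \<circ> t)) \<longlonglongrightarrow> l" if i: "i \<in> insert j J" for i
    proof (cases "i = j")
      case True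
      then show ?thesis using t by (auto simp: o_assoc)
    next
      case False
      then obtain l where "(f i \<circ> s) \<longlonglongrightarrow> l" using i s(2) by blast
      then show ?thesis using LIMSEQ_subseq_LIMSEQ[OF _ t(1)] by (auto simp: o_assoc)
    qed
    then show ?case using strict_mono_o[OF s(1) t(1)] by blast
  qed
  then obtain s where s: "strict_mono (s :: nat \<Rightarrow> nat)" "\<forall>j\<in>J. \<exists>l. (f j \<circ> s) \<longlonglongrightarrow> l" by blast
  then obtain l where "\<forall>j\<in>J. (f j \<circ> s) \<longlonglongrightarrow> l j" by metis
  with s(1) that show ?thesis by blast
qed

text \<open>The hyperplane where \<open>m\<close> vanishes is preserved. The factor may be negative,
  which exchanges the two sides.\<close>

definition preserves_wall :: "('v \<Rightarrow> real) \<Rightarrow> ('v \<Rightarrow> 'v) \<Rightarrow> bool" where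
  "preserves_wall m a \<longleftrightarrow> (\<exists>\<kappa>. \<kappa> \<noteq> 0 \<and> (\<forall>x. m (a x) = \<kappa> * m x))"

lemma preserves_wall_compose:
  assumes "preserves_wall m a" "preserves_wall m b" shows "preserves_wall m (a \<circ> b)"
proof -
  obtain c d where "c \<noteq> 0" "\<And>x. m (a x) = c * m x" "d \<noteq> 0" "\<And>x. m (b x) = d * m x"
    using assms unfolding preserves_wall_def by metis
  then show ?thesis unfolding preserves_wall_def by (intro exI[of _ "c * d"]) auto
qed

lemma preserves_wall_inverse:
  assumes "preserves_wall m a" "affine_automorphism a" shows "preserves_wall m (inv_into UNIV a)"
proof -
  obtain c where c: "c \<noteq> 0" "\<And>x. m (a x) = c * m x"
    using assms(1) unfolding preserves_wall_def by metis
  have "m (inv_into UNIV a x) = inverse c * m x" for x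
    using c(2)[of "inv_into UNIV a x"] c(1) assms(2) by simp
  then show ?thesis unfolding preserves_wall_def using c(1) by (intro exI[of _ "inverse c"]) auto
qed

context etale_group
begin

text \<open>If \<open>h u\<close> moved the wall point \<open>w\<close> to the side of \<open>\<Omega>\<close>, then \<open>w\<close> would be in \<open>\<Omega>\<close>; if it moved it to
  the other side, then a point of \<open>\<Omega>\<close> just above \<open>w\<close> would be moved into the wall.\<close>

lemma wall_point_germ:
  fixes m :: "'v \<Rightarrow> real"
  assumes m: "affine_map m" "affine_grad m \<noteq> 0"
    and above: "\<And>y. y \<in> ball w0 e \<Longrightarrow> m y > 0 \<Longrightarrow> y \<in> \<Omega>"
    and wall: "\<And>y. y \<in> ball w0 e \<Longrightarrow> m y = 0 \<Longrightarrow> y \<notin> \<Omega>"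
    and w: "w \<in> ball w0 e" "m w = 0"
  obtains U where "openin X U" "\<one> \<in> U" "\<And>u. u \<in> U \<Longrightarrow> u \<in> N \<and> m (h u w) = 0"
proof -
  let ?B = "ball w0 e" and ?g = "affine_grad m"
  obtain s where s: "s > 0" "(1 - s) *\<^sub>R w + s *\<^sub>R (w + ?g) \<in> ?B"
    using stretch_into_open[of ?B w] w by auto
  define v where "v = w + s *\<^sub>R ?g"
  have v: "v \<in> ?B" using s by (simp add: v_def algebra_simps)
  have mv: "m v > 0"
    using affine_functional[OF m(1), of v w] w s m(2) by (simp add: v_def)
  obtain U1 where U1: "openin X U1" "\<one> \<in> U1" "\<And>u. u \<in> U1 \<Longrightarrow> u \<in> N \<and> h u w \<in> ?B"
    using h_near_one[of ?B w] w by auto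
  have "open (?B \<inter> {y. m y > 0})" using affine_functional_open_pos[OF m(1)] by blast
  then obtain U2 where U2: "openin X U2" "\<one> \<in> U2" "\<And>u. u \<in> U2 \<Longrightarrow> u \<in> N \<and> h u v \<in> ?B \<inter> {y. m y > 0}"
    using h_near_one[of "?B \<inter> {y. m y > 0}" v] v mv by (metis IntI mem_Collect_eq)
  show ?thesis
  proof (rule that[of "U1 \<inter> U2"])
    show "openin X (U1 \<inter> U2)" "\<one> \<in> U1 \<inter> U2" using U1 U2 by auto
    fix u assume u: "u \<in> U1 \<inter> U2"
    have uN: "u \<in> N" "h u w \<in> ?B" "h u v \<in> ?B" "m (h u v) > 0" using U1(3)[of u] U2(3)[of u] u by auto
    have inv: "h u y \<in> \<Omega> \<longleftrightarrow> y \<in> \<Omega>" for y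
      using \<Omega>_invariant_iff[OF graph_h_H[OF uN(1)], of y] by (simp add: graph_h_def)
    have aff: "affine_map (h u)" using h_aut uN affine_automorphism_imp_affine_map by blast
    have "m (h u w) = 0"
    proof (rule ccontr)
      assume ne: "m (h u w) \<noteq> 0"
      have "\<not> m (h u w) > 0" using above[OF uN(2)] inv[of w] wall[OF w] by blast
      with ne have neg: "m (h u w) < 0" by simp
      define t where "t = m (h u w) / (m (h u w) - m (h u v))"
      have t: "0 < t" "t < 1" using neg uN(4) by (auto simp: t_def field_simps)
      define y where "y = (1 - t) *\<^sub>R w + t *\<^sub>R v"
      have hy: "h u y = (1 - t) *\<^sub>R h u w + t *\<^sub>R h u v"
        unfolding y_def by (rule affine_map_combination[OF aff])
      have "m (h u y) = (1 - t) * m (h u w) + t * m (h u v)"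
        unfolding hy by (rule affine_functional_segment[OF m(1)])
      also have "\<dots> = m (h u w) - t * (m (h u w) - m (h u v))" by (simp add: algebra_simps)
      also have "\<dots> = 0" using neg uN(4) by (simp add: t_def)
      finally have "m (h u y) = 0" .
      moreover have "h u y \<in> ?B" unfolding hy using uN t by (intro convexD) auto
      ultimately have "y \<notin> \<Omega>" using wall inv by blast
      moreover have "y \<in> ?B" unfolding y_def using w v t by (intro convexD) auto
      moreover have "m y > 0"
        unfolding y_def affine_functional_segment[OF m(1)] using w mv t by simp
      ultimately show False using above by blast
    qed
    with uN show "u \<in> N \<and> m (h u w) = 0" by simp
  qed
qed

text \<open>An affine functional is a multiple of \<open>m\<close> once it vanishes at finitely many
  points that span the wall. For \<open>m \<circ> h u\<close> this leaves finitely many wall points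
  to test, and the corresponding neighbourhoods of the unit can be intersected.\<close>

lemma wall_germ:
  fixes m :: "'v \<Rightarrow> real"
  assumes m: "affine_map m" "affine_grad m \<noteq> 0"
    and above: "\<And>y. y \<in> ball w0 e \<Longrightarrow> m y > 0 \<Longrightarrow> y \<in> \<Omega>"
    and wall: "\<And>y. y \<in> ball w0 e \<Longrightarrow> m y = 0 \<Longrightarrow> y \<notin> \<Omega>"
    and w0: "e > 0" "m w0 = 0"
  obtains U where "openin X U" "\<one> \<in> U" "\<And>u. u \<in> U \<Longrightarrow> u \<in> N \<and> preserves_wall m (h u)"
proof -
  let ?g = "affine_grad m"
  define n where "n = ?g /\<^sub>R norm ?g"
  have n: "norm n = 1" "?g = norm ?g *\<^sub>R n" using m(2) by (auto simp: n_def)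
  \<comment> \<open>The basis vectors projected orthogonally to the gradient span the directions of
    the wall. Their norms are at most 2, so the step \<open>e / 3\<close> stays inside the
    ball.\<close>
  define b' where "b' b = b - (b \<bullet> n) *\<^sub>R n" for b
  have b'n: "n \<bullet> b' b = 0" for b
    using n(1) by (simp add: b'_def inner_diff_right inner_commute norm_eq_1)
  have nb': "norm (b' b) \<le> 2" if "b \<in> Basis" for b
  proof -
    have "norm (b' b) \<le> norm b + norm ((b \<bullet> n) *\<^sub>R n)" unfolding b'_def by (rule norm_triangle_ineq4)
    also have "\<dots> \<le> 1 + 1"
      using that Cauchy_Schwarz_ineq2[of b n] n(1) by simp
    finally show ?thesis by simp
  qed
  define d where "d = e / 3"
  have d: "d > 0" using w0 by (simp add: d_def)
  define Wp where "Wp = insert w0 ((\<lambda>b. w0 + d *\<^sub>R b' b) ` Basis)"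
  have Wp: "w \<in> ball w0 e" "m w = 0" if "w \<in> Wp" for w
  proof -
    consider "w = w0" | b where "b \<in> Basis" "w = w0 + d *\<^sub>R b' b" using \<open>w \<in> Wp\<close> by (auto simp: Wp_def)
    then have "w \<in> ball w0 e \<and> m w = 0"
    proof cases
      case 2
      have "norm (d *\<^sub>R b' b) \<le> d * 2" using nb'[OF 2(1)] d by simp
      then have "w \<in> ball w0 e" using 2 w0 by (simp add: dist_norm d_def)
      moreover have "?g \<bullet> b' b = 0" using n(2) b'n by (metis inner_scaleR_left mult_zero_right)
      then have "m w = 0" using affine_functional[OF m(1), of w w0] w0 2 by simp
      ultimately show ?thesis by simp
    qed (use w0 in simp)
    then show "w \<in> ball w0 e" "m w = 0" by auto
  qed
  have "\<exists>U. openin X U \<and> \<one> \<in> U \<and> (\<forall>u\<in>U. u \<in> N \<and> m (h u w) = 0)" if w: "w \<in> Wp" for w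
  proof -
    obtain U where "openin X U" "\<one> \<in> U" "\<And>u. u \<in> U \<Longrightarrow> u \<in> N \<and> m (h u w) = 0"
      using wall_point_germ[OF m above wall Wp[OF w]] by blast
    then show ?thesis by blast
  qed
  then obtain U where U: "\<And>w. w \<in> Wp \<Longrightarrow> openin X (U w)" "\<And>w. w \<in> Wp \<Longrightarrow> \<one> \<in> U w"
    "\<And>w u. w \<in> Wp \<Longrightarrow> u \<in> U w \<Longrightarrow> u \<in> N \<and> m (h u w) = 0" by metis
  have finWp: "finite Wp" "Wp \<noteq> {}" by (auto simp: Wp_def)
  show ?thesis
  proof (rule that[of "\<Inter>w\<in>Wp. U w"])
    show "openin X (\<Inter>w\<in>Wp. U w)" using finWp U(1) by (intro openin_Inter) auto
    show "\<one> \<in> (\<Inter>w\<in>Wp. U w)" using U(2) by blast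
    fix u assume "u \<in> (\<Inter>w\<in>Wp. U w)"
    then have u: "u \<in> N" "\<And>w. w \<in> Wp \<Longrightarrow> m (h u w) = 0" using U(3) finWp by blast+
    have aut: "affine_automorphism (h u)" using h_aut u by blast
    let ?f = "m \<circ> h u"
    have f: "affine_map ?f" using affine_map_compose m aut affine_automorphism_imp_affine_map by blast
    let ?G = "affine_grad ?f"
    have fw0: "?f w0 = 0" using u(2) by (simp add: Wp_def)
    have Gb: "?G \<bullet> b = (?G \<bullet> n) * (n \<bullet> b)" if b: "b \<in> Basis" for b
    proof -
      have "w0 + d *\<^sub>R b' b \<in> Wp" using b unfolding Wp_def by blast
      from u(2)[OF this] have "?f (w0 + d *\<^sub>R b' b) = 0" by simp
      then have "?G \<bullet> b' b = 0"
        using affine_functional[OF f, of "w0 + d *\<^sub>R b' b" w0] fw0 d by simp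
      then have "?G \<bullet> b - (b \<bullet> n) * (?G \<bullet> n) = 0" unfolding b'_def inner_diff_right by simp
      then show ?thesis by (simp only: inner_commute[of b n] eq_iff_diff_eq_0[of "?G \<bullet> b"] mult.commute[of "?G \<bullet> n"])
    qed
    have G: "?G = (?G \<bullet> n) *\<^sub>R n"
    proof (rule euclidean_eqI)
      fix b :: 'v assume "b \<in> Basis"
      from Gb[OF this] show "?G \<bullet> b = (?G \<bullet> n) *\<^sub>R n \<bullet> b" by (simp only: inner_scaleR_left)
    qed
    define c where "c = (?G \<bullet> n) / norm ?g"
    have fx: "m (h u x) = c * m x" for x
    proof -
      have "?f x = ?G \<bullet> (x - w0)" using affine_functional[OF f, of x w0] fw0 by simp
      also have "\<dots> = (?G \<bullet> n) * (n \<bullet> (x - w0))"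
        using arg_cong[OF G, of "\<lambda>v. v \<bullet> (x - w0)"] by (simp only: inner_scaleR_left)
      also have "\<dots> = c * (norm ?g * (n \<bullet> (x - w0)))" using m(2) by (simp add: c_def)
      also have "\<dots> = c * (?g \<bullet> (x - w0))"
        using arg_cong[OF n(2), of "\<lambda>v. v \<bullet> (x - w0)"] by (simp only: inner_scaleR_left)
      also have "\<dots> = c * m x" using affine_functional[OF m(1), of x w0] w0 by simp
      finally show ?thesis by simp
    qed
    \<comment> \<open>With factor zero, \<open>m\<close> would vanish on the image of
      \<open>h u\<close>, which is the whole space.\<close>
    have "c \<noteq> 0"
    proof
      assume c0: "c = 0"
      have "m (w0 + ?g) \<noteq> 0" using affine_functional[OF m(1), of "w0 + ?g" w0] w0 m(2) by simp
      moreover have "m (h u (inv_into UNIV (h u) (w0 + ?g))) = m (w0 + ?g)" using aut by simp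
      ultimately show False using fx c0 by simp
    qed
    with fx u(1) show "u \<in> N \<and> preserves_wall m (h u)" unfolding preserves_wall_def by blast
  qed
qed

lemma connected_N: "connectedin X N"
proof -
  have "connectedin (top_of_set (\<phi> ` N)) (\<phi> ` N)"
    unfolding phi_N by (metis connected_ball connectedin_absolute connectedin_iff_connected)
  moreover have "connectedin (top_of_set (\<phi> ` N)) (\<phi> ` N) \<longleftrightarrow> connectedin (subtopology X N) N"
    using homeomorphic_map_connectedness[OF chart_onD(3)[OF N_chart], of N] chart_onD(5)[OF N_chart] by simp
  ultimately show ?thesis by (simp add: connectedin_subtopology)
qed

text \<open>A small right factor does not change whether \<open>h u\<close> preserves the wall, so
  the elements of \<open>N\<close> with this property form an open and closed part of the connected
  set \<open>N\<close>. Finally \<open>H\<close> is generated by the graph over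
  \<open>N\<close>.\<close>

lemma preserves_wall_H:
  assumes U: "openin X U" "\<one> \<in> U" "\<And>u. u \<in> U \<Longrightarrow> u \<in> N \<and> preserves_wall m (h u)"
    and e: "e \<in> H"
  shows "preserves_wall m (snd e)"
proof -
  let ?E = "{u \<in> N. preserves_wall m (h u)}"
  have key: "preserves_wall m (h (u \<otimes> v)) \<longleftrightarrow> preserves_wall m (h u)"
    if "u \<in> N" "v \<in> U" "u \<otimes> v \<in> N" for u v
  proof -
    have v: "v \<in> N" "preserves_wall m (h v)" using U that by auto
    have huv: "h (u \<otimes> v) = h u \<circ> h v" using h_mult that v by blast
    have "h u = h (u \<otimes> v) \<circ> inv_into UNIV (h v)" unfolding huv using h_aut[OF v(1)] by (simp add: o_def)
    then have "preserves_wall m (h (u \<otimes> v)) \<Longrightarrow> preserves_wall m (h u)"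
      using preserves_wall_compose[of m "h (u \<otimes> v)"] preserves_wall_inverse[OF v(2) h_aut[OF v(1)]] by simp
    moreover have "preserves_wall m (h u) \<Longrightarrow> preserves_wall m (h (u \<otimes> v))"
      unfolding huv using v(2) by (rule preserves_wall_compose[rotated])
    ultimately show ?thesis by blast
  qed
  have nb: "\<exists>T. openin X T \<and> u \<in> T \<and> (if preserves_wall m (h u) then T \<subseteq> ?E else T \<subseteq> N - ?E)"
    if u: "u \<in> N" for u
  proof -
    let ?T = "{y \<in> carrier G. inv u \<otimes> y \<in> U} \<inter> N"
    have "openin X ?T" using u U N_open by (intro openin_Int open_preimage mult_left_cont) auto
    moreover have "u \<in> ?T" using u U by simp
    moreover have "preserves_wall m (h y) = preserves_wall m (h u)" if y: "y \<in> ?T" for y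
    proof -
      have "u \<otimes> (inv u \<otimes> y) = y" using u y by (simp flip: m_assoc)
      then show ?thesis using key[OF u, of "inv u \<otimes> y"] y by simp
    qed
    then have "if preserves_wall m (h u) then ?T \<subseteq> ?E else ?T \<subseteq> N - ?E" by auto
    ultimately show ?thesis by blast
  qed
  have o1: "openin X ?E"
  proof (subst openin_subopen, intro ballI)
    fix u assume "u \<in> ?E"
    then show "\<exists>T. openin X T \<and> u \<in> T \<and> T \<subseteq> ?E" using nb[of u] by simp
  qed
  have o2: "openin X (N - ?E)"
  proof (subst openin_subopen, intro ballI)
    fix u assume "u \<in> N - ?E"
    then show "\<exists>T. openin X T \<and> u \<in> T \<and> T \<subseteq> N - ?E" using nb[of u] by simp
  qed
  have "\<one> \<in> ?E" using U(2,3) by blast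
  then have "N - ?E = {}"
    using connected_N o1 o2 one_N unfolding connectedin by blast
  then have N: "preserves_wall m (h u)" if "u \<in> N" for u using that by blast
  show ?thesis using e
  proof induction
    case eone_H
    have "preserves_wall m id" unfolding preserves_wall_def by (intro exI[of _ 1]) auto
    then show ?case unfolding eone_def snd_conv .
  next
    case (mult_H e u)
    then show ?case unfolding emult_def graph_h_def snd_conv by (intro preserves_wall_compose N)
  next
    case (div_H e u)
    then show ?case unfolding emult_def graph_h_def einv_def snd_conv
      by (intro preserves_wall_compose preserves_wall_inverse N h_aut)
  qed
qed

text \<open>Otherwise some \<open>m j = 0\<close> is locally a wall of \<open>\<Omega>\<close>. Then \<open>H\<close> preserves \<open>m j\<close> up to factors, and \<open>m j\<close> is
  bounded away from \<open>0\<close> on \<open>T\<close>. The factors of the \<open>E i\<close> are bounded because \<open>snd (E i) x0 \<in> T\<close>, so points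
  close to the wall cannot be moved into \<open>T\<close>.\<close>

lemma halfspace_in_\<Omega>:
  fixes m :: "'j \<Rightarrow> 'v \<Rightarrow> real" and E :: "nat \<Rightarrow> 'a \<times> ('v \<Rightarrow> 'v)"
  assumes T: "compact T"
    and nonvanish: "\<And>f :: 'v \<Rightarrow> real. affine_map f \<Longrightarrow> (\<And>x. x \<in> \<Omega> \<Longrightarrow> f x \<noteq> 0) \<Longrightarrow> (\<And>x. x \<in> T \<Longrightarrow> f x \<noteq> 0)"
    and E: "\<And>i. E i \<in> H" "\<And>i. snd (E i) x0 \<in> T"
    and J: "finite J" and aff: "\<And>j. j \<in> J \<Longrightarrow> affine_map (m j)" and mx0: "\<And>j. j \<in> J \<Longrightarrow> m j x0 > 0"
    and \<nu>: "\<nu> \<noteq> 0"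
    and inner: "\<And>x. \<nu> \<bullet> (x - x0) > 0 \<Longrightarrow> (\<And>j. j \<in> J \<Longrightarrow> m j x > 0) \<Longrightarrow>
        x \<in> \<Omega> \<and> eventually (\<lambda>i. snd (E i) x \<in> T) sequentially"
    and outer: "\<And>y j. closed_segment x0 y \<subseteq> \<Omega> \<Longrightarrow> \<nu> \<bullet> (y - x0) > 0 \<Longrightarrow> j \<in> J \<Longrightarrow> m j y \<ge> 0"
    and x: "\<nu> \<bullet> (x - x0) > 0"
  shows "x \<in> \<Omega>"
proof (rule ccontr)
  assume "x \<notin> \<Omega>"
  then obtain j0 where j0: "j0 \<in> J" "m j0 x \<le> 0" using inner[OF x] by (meson not_le)
  let ?U = "{x. \<nu> \<bullet> (x - x0) > 0}"
  have "?U = {x. \<nu> \<bullet> x > \<nu> \<bullet> x0}" by (simp add: inner_diff_right)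
  then have U: "open ?U" "convex ?U"
    using open_halfspace_gt[of "\<nu> \<bullet> x0" \<nu>] convex_halfspace_gt[of "\<nu> \<bullet> x0" \<nu>] by auto
  \<comment> \<open>A point slightly off \<open>x0\<close> in the direction of \<open>x\<close>: all
    \<open>m j\<close> are still positive, and it is already strictly inside the half-space.\<close>
  obtain z where z: "z \<in> ?U" "\<And>j. j \<in> J \<Longrightarrow> m j z > 0"
  proof -
    have "open (\<Inter>j\<in>J. {x. m j x > 0})" using J aff by (intro open_INT ballI affine_functional_open_pos) auto
    moreover have "x0 \<in> (\<Inter>j\<in>J. {x. m j x > 0})" using mx0 by auto
    ultimately obtain s where s: "s > 0" "(1 - s) *\<^sub>R x0 + s *\<^sub>R x \<in> (\<Inter>j\<in>J. {x. m j x > 0})"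
      by (rule stretch_into_open) (rule that)
    have "(1 - s) *\<^sub>R x0 + s *\<^sub>R x - x0 = s *\<^sub>R (x - x0)" by (simp add: algebra_simps)
    then have "(1 - s) *\<^sub>R x0 + s *\<^sub>R x \<in> ?U" using s x by simp
    then show ?thesis using that s by auto
  qed
  obtain j w0 e where j: "j \<in> J" "m j w0 = 0" and e: "e > 0" "ball w0 e \<subseteq> ?U"
    and pos: "\<And>y k. y \<in> ball w0 e \<Longrightarrow> m j y > 0 \<Longrightarrow> k \<in> J \<Longrightarrow> m k y > 0"
    using facet_point[where m = m, OF J aff U z _ j0] x by blast
  let ?m = "m j"
  have m: "affine_map ?m" using aff j by blast
  have g: "affine_grad ?m \<noteq> 0"
    using affine_functional[OF m, of x0 w0] mx0[OF j(1)] j(2) by auto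
  have above: "y \<in> \<Omega>" if "y \<in> ball w0 e" "?m y > 0" for y
    using inner[of y] pos[OF that] e(2) that(1) by blast
  \<comment> \<open>If \<open>y\<close> were in \<Omega>, the segment from \<open>x0\<close> to
    \<open>y\<close> would run in \<Omega> and, as \<Omega> is open, extend beyond \<open>y\<close>
    to a point \<open>y'\<close> where \<open>?m\<close> is negative. This is what
    \<open>outer\<close> forbids.\<close>
  have wall: "y \<notin> \<Omega>" if y: "y \<in> ball w0 e" "?m y = 0" for y
  proof
    assume yO: "y \<in> \<Omega>"
    have nonneg: "m k y \<ge> 0" if k: "k \<in> J" for k
    proof (rule ccontr)
      assume "\<not> m k y \<ge> 0"
      then have "open (ball w0 e \<inter> {x. m k x < 0})" "y \<in> ball w0 e \<inter> {x. m k x < 0}"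
        using y open_Collect_less[OF affine_map_continuous_on[OF aff[OF k]] continuous_on_const] by auto
      then obtain s where s: "s > 0" "(1 - s) *\<^sub>R y + s *\<^sub>R (y + affine_grad ?m) \<in> ball w0 e \<inter> {x. m k x < 0}"
        by (rule stretch_into_open) (rule that)
      let ?y = "(1 - s) *\<^sub>R y + s *\<^sub>R (y + affine_grad ?m)"
      have "?y - y = s *\<^sub>R affine_grad ?m" by (simp add: algebra_simps)
      then have "?m ?y > 0" using affine_functional[OF m, of ?y y] y s(1) g by simp
      then have "m k ?y > 0" using pos[of ?y k] s k by blast
      then show False using s by auto
    qed
    have yU: "\<nu> \<bullet> (y - x0) > 0" using y e(2) by blast
    have seg: "x0 + t *\<^sub>R (y - x0) \<in> \<Omega>" if t: "0 \<le> t" "t < 1" for t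
    proof (cases "t = 0")
      case True
      then show ?thesis using x0_\<Omega> by simp
    next
      case False
      have "m k (x0 + t *\<^sub>R (y - x0)) > 0" if k: "k \<in> J" for k
        unfolding affine_functional_ray[OF aff[OF k]]
        using mx0[OF k] nonneg[OF k] t by (intro add_pos_nonneg) auto
      then show ?thesis using inner[of "x0 + t *\<^sub>R (y - x0)"] False t yU by simp
    qed
    obtain d where d: "d > 0" "ball y d \<subseteq> \<Omega>" using yO open_\<Omega> open_contains_ball by blast
    have "open (ball y d)" "y \<in> ball y d" using d by auto
    then obtain s where s: "s > 0" "(1 - s) *\<^sub>R y + s *\<^sub>R (y + (y - x0)) \<in> ball y d"
      by (rule stretch_into_open) (rule that)
    define y' where "y' = x0 + (1 + s) *\<^sub>R (y - x0)"
    have y'_eq: "y' = (1 - s) *\<^sub>R y + s *\<^sub>R (y + (y - x0))" by (simp add: y'_def algebra_simps)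
    have "closed_segment x0 y' \<subseteq> closed_segment x0 y \<union> closed_segment y y'"
    proof -
      have "y \<in> closed_segment x0 y'"
        unfolding closed_segment_def
      proof (intro CollectI exI[of _ "1 / (1 + s)"] conjI)
        have "(1 / (1 + s)) *\<^sub>R y' = (1 / (1 + s)) *\<^sub>R x0 + (y - x0)"
          using s(1) by (simp add: y'_def scaleR_add_right)
        then show "y = (1 - 1 / (1 + s)) *\<^sub>R x0 + (1 / (1 + s)) *\<^sub>R y'"
          by (simp add: algebra_simps)
      qed (use s in auto)
      then show ?thesis using Un_closed_segment by blast
    qed
    also have "\<dots> \<subseteq> \<Omega>"
    proof -
      have "closed_segment x0 y \<subseteq> \<Omega>"
      proof
        fix v assume "v \<in> closed_segment x0 y"
        then obtain t where t: "0 \<le> t" "t \<le> 1" "v = (1 - t) *\<^sub>R x0 + t *\<^sub>R y"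
          unfolding closed_segment_def by blast
        then have "v = x0 + t *\<^sub>R (y - x0)" by (simp add: algebra_simps)
        then show "v \<in> \<Omega>" using seg[of t] t yO by (cases "t = 1") auto
      qed
      moreover have "closed_segment y y' \<subseteq> ball y d"
        using s d unfolding y'_eq by (intro closed_segment_subset) auto
      ultimately show ?thesis using d by blast
    qed
    finally have "closed_segment x0 y' \<subseteq> \<Omega>" .
    moreover have "\<nu> \<bullet> (y' - x0) > 0" using yU s(1) by (simp add: y'_def)
    ultimately have "?m y' \<ge> 0" using outer j(1) by blast
    moreover have "?m y' = - s * ?m x0"
      unfolding y'_def affine_functional_ray[OF m] using y by simp
    ultimately show False using mx0[OF j(1)] s(1) by (simp add: mult_le_0_iff)
  qed
  obtain U where U: "openin X U" "\<one> \<in> U" "\<And>u. u \<in> U \<Longrightarrow> u \<in> N \<and> preserves_wall ?m (h u)"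
    using wall_germ[OF m g above wall e(1) j(2)] by blast
  have pw: "preserves_wall ?m (snd d)" if "d \<in> H" for d
    using preserves_wall_H[OF U that] .
  \<comment> \<open>\<Omega> is the orbit of \<open>x0\<close>, where \<open>?m\<close> is positive,
    and \<open>H\<close> changes \<open>?m\<close> by nonzero factors only.\<close>
  have "?m y \<noteq> 0" if y: "y \<in> \<Omega>" for y
  proof -
    obtain d where d: "d \<in> H" "y = snd d x0" using y unfolding \<Omega>_def by blast
    obtain c where "c \<noteq> 0" "\<And>x. ?m (snd d x) = c * ?m x" using pw[OF d(1)] unfolding preserves_wall_def by blast
    then show ?thesis using d mx0[OF j(1)] by simp
  qed
  then have nz: "\<And>y. y \<in> T \<Longrightarrow> ?m y \<noteq> 0" using nonvanish[OF m] by blast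
  have cT: "continuous_on T (\<lambda>y. \<bar>?m y\<bar>)"
    using affine_map_continuous_on[OF m] by (intro continuous_intros)
  have Tne: "T \<noteq> {}" using E(2) by blast
  obtain y1 where y1: "y1 \<in> T" "\<And>y. y \<in> T \<Longrightarrow> \<bar>?m y1\<bar> \<le> \<bar>?m y\<bar>"
    using continuous_attains_inf[OF T Tne cT] by blast
  obtain y2 where y2: "y2 \<in> T" "\<And>y. y \<in> T \<Longrightarrow> \<bar>?m y\<bar> \<le> \<bar>?m y2\<bar>"
    using continuous_attains_sup[OF T Tne cT] by blast
  define c where "c = \<bar>?m y1\<bar>"
  define C where "C = \<bar>?m y2\<bar>"
  have c: "c > 0" and C: "C > 0" using nz y1(1) y2(1) by (auto simp: c_def C_def)
  \<comment> \<open>Factors have absolute value at most \<open>C / ?m x0\<close>. A point with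
    \<open>0 < ?m < k\<close> is therefore moved to a value of absolute value at most
    \<open>c / 2\<close>, below the minimum \<open>c\<close> on \<open>T\<close>.\<close>
  define k where "k = c * ?m x0 / (2 * C)"
  have k: "k > 0" using c C mx0[OF j(1)] by (simp add: k_def)
  have "open (ball w0 e \<inter> {x. ?m x < k})" "w0 \<in> ball w0 e \<inter> {x. ?m x < k}"
    using e j k open_Collect_less[OF affine_map_continuous_on[OF m] continuous_on_const] by auto
  then obtain s where s: "s > 0" "(1 - s) *\<^sub>R w0 + s *\<^sub>R (w0 + affine_grad ?m) \<in> ball w0 e \<inter> {x. ?m x < k}"
    by (rule stretch_into_open) (rule that)
  let ?y = "(1 - s) *\<^sub>R w0 + s *\<^sub>R (w0 + affine_grad ?m)"
  have "?y - w0 = s *\<^sub>R affine_grad ?m" by (simp add: algebra_simps)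
  then have my: "?m ?y > 0" "?m ?y < k" using affine_functional[OF m, of ?y w0] j s g by auto
  have "eventually (\<lambda>i. snd (E i) ?y \<in> T) sequentially"
    using inner[of ?y] pos[of ?y] my(1) s(2) e(2) by blast
  then obtain i where i: "snd (E i) ?y \<in> T" unfolding eventually_sequentially by blast
  obtain \<kappa> where \<kappa>: "\<And>x. ?m (snd (E i) x) = \<kappa> * ?m x" using pw[OF E(1)] unfolding preserves_wall_def by blast
  have "\<bar>\<kappa>\<bar> * ?m x0 \<le> C"
    using y2(2)[OF E(2), of i] \<kappa>[of x0] mx0[OF j(1)] by (simp add: C_def abs_mult)
  then have \<kappa>C: "\<bar>\<kappa>\<bar> \<le> C / ?m x0" using mx0[OF j(1)] by (simp add: field_simps)
  have "c \<le> \<bar>\<kappa>\<bar> * ?m ?y"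
    using y1(2)[OF i] \<kappa>[of ?y] my by (simp add: c_def abs_mult)
  also have "\<dots> \<le> C / ?m x0 * k" using \<kappa>C my C mx0[OF j(1)] by (intro mult_mono) auto
  also have "\<dots> = c / 2" using C mx0[OF j(1)] by (simp add: k_def)
  finally show False using c by simp
qed

text \<open>By homogeneity any point of \<Omega> can be moved to \<open>x0 + \<nu>\<close> by
  \<open>H\<close>. The complement is invariant and contained in the half-space
  \<open>\<nu> \<bullet> (x - x0) \<le> 0\<close>, which does not contain this point; so the point
  is no convex combination of points outside \<Omega>.\<close>

lemma convex_complement_\<Omega>:
  assumes \<nu>: "\<nu> \<noteq> 0" and half: "\<And>x. \<nu> \<bullet> (x - x0) > 0 \<Longrightarrow> x \<in> \<Omega>"
  shows "convex (- \<Omega>)"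
proof (rule convexI)
  fix u v and s t :: real
  assume u: "u \<in> - \<Omega>" and v: "v \<in> - \<Omega>" and st: "0 \<le> s" "0 \<le> t" "s + t = 1"
  show "s *\<^sub>R u + t *\<^sub>R v \<in> - \<Omega>"
  proof
    assume x: "s *\<^sub>R u + t *\<^sub>R v \<in> \<Omega>"
    have "x0 + \<nu> \<in> \<Omega>" using half \<nu> by simp
    then obtain b where b: "b \<in> H" "x0 + \<nu> = snd b x0" unfolding \<Omega>_def by blast
    obtain d where d: "d \<in> H" "s *\<^sub>R u + t *\<^sub>R v = snd d x0" using x unfolding \<Omega>_def by blast
    define g where "g = emult b (einv d)"
    have g: "g \<in> H" using H_emult H_einv b d by (simp add: g_def)
    have gx: "snd g (s *\<^sub>R u + t *\<^sub>R v) = x0 + \<nu>"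
      using b d H_aut[OF d(1)] by (simp add: g_def emult_def einv_def)
    have neg: "\<nu> \<bullet> (snd g y - x0) \<le> 0" if "y \<in> - \<Omega>" for y
      using half[of "snd g y"] \<Omega>_invariant_iff[OF g, of y] that by (meson ComplD not_le)
    have "snd g (s *\<^sub>R u + t *\<^sub>R v) = s *\<^sub>R snd g u + t *\<^sub>R snd g v"
      using affine_map_combination[OF affine_automorphism_imp_affine_map[OF H_aut[OF g]], of t u v] st
      by (metis add_diff_cancel_right')
    then have "\<nu> = s *\<^sub>R (snd g u - x0) + t *\<^sub>R (snd g v - x0)"
      using gx st(3) by (simp add: algebra_simps) (metis add_diff_cancel_left' scaleR_add_left scaleR_one add.commute)
    then have "\<nu> \<bullet> \<nu> = s * (\<nu> \<bullet> (snd g u - x0)) + t * (\<nu> \<bullet> (snd g v - x0))"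
      by (metis inner_add_right inner_scaleR_right)
    also have "\<dots> \<le> 0"
      using neg[OF u] neg[OF v] st by (intro add_nonpos_nonpos mult_nonneg_nonpos) auto
    finally show False using \<nu> by (metis inner_gt_zero_iff not_le)
  qed
qed

end

section \<open>Polytopes punctured in one facet\<close>

lemma compact_attains_inner_sup:
  fixes S :: "'v::euclidean_space set"
  assumes "compact S" "S \<noteq> {}"
  obtains e where "e \<in> S" "\<And>y. y \<in> S \<Longrightarrow> d \<bullet> y \<le> d \<bullet> e"
proof -
  have "continuous_on S (\<lambda>x. d \<bullet> x)" by (intro continuous_intros)
  from continuous_attains_sup[OF assms this] show ?thesis using that by blast
qed

context etale_group
begin

lemma continuous_map_left_translation:
  assumes g: "g \<in> H"
  shows "continuous_map etop etop (emult g)"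
proof (rule etop_continuous_mapI)
  show "e \<in> H \<Longrightarrow> emult g e \<in> topspace etop" for e using g H_emult topspace_etop by simp
  fix e W assume e: "e \<in> H" and W: "openin etop W" "emult g e \<in> W"
  then obtain U where U: "openin X U" "\<one> \<in> U" "\<forall>u\<in>U \<inter> N. emult (emult g e) (graph_h u) \<in> W"
    unfolding openin_etop by blast
  then show "\<exists>U. openin X U \<and> \<one> \<in> U \<and> (\<forall>u\<in>U \<inter> N. emult g (emult e (graph_h u)) \<in> W)"
    using g e by (intro exI[of _ U]) (auto simp: emult_assoc H_valid valid_graph_h)
qed

lemma eval_tendsto:
  assumes \<iota>: "continuous_map (top_of_set Y) etop \<iota>" and y: "\<And>n. y n \<in> Y" "y' \<in> Y" "y \<longlonglongrightarrow> y'"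
  shows "(\<lambda>n. snd (\<iota> (y n)) v) \<longlonglongrightarrow> snd (\<iota> y') v"
    "(\<lambda>n. inv_into UNIV (snd (\<iota> (y n))) v) \<longlonglongrightarrow> inv_into UNIV (snd (\<iota> y')) v"
proof -
  have "continuous_on Y (\<lambda>y. snd (\<iota> y) v)"
    using continuous_map_compose[OF \<iota> continuous_map_eval[of v]] by (simp add: o_def)
  then show "(\<lambda>n. snd (\<iota> (y n)) v) \<longlonglongrightarrow> snd (\<iota> y') v"
    by (rule continuous_on_tendsto_compose[OF _ y(3,2)]) (simp add: y(1))
  have "continuous_on Y (\<lambda>y. inv_into UNIV (snd (\<iota> y)) v)"
    using continuous_map_compose[OF \<iota> continuous_map_inverse_eval[of v]] by (simp add: o_def)
  then show "(\<lambda>n. inv_into UNIV (snd (\<iota> (y n))) v) \<longlonglongrightarrow> inv_into UNIV (snd (\<iota> y')) v"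
    by (rule continuous_on_tendsto_compose[OF _ y(3,2)]) (simp add: y(1))
qed

end

text \<open>\<open>l\<close> belongs to the punctured facet, the \<mu> to the other facets, and
  \<open>k0\<close> is a missing point. The facets are represented by affine functionals because
  these can be pulled back along the maps of \<open>H\<close> and passed to the limit.\<close>

locale punctured_polytope = etale_group G X N \<phi> x0 r h
  for G :: "('a, 'm) monoid_scheme" (structure) and X :: "'a topology" and N
    and \<phi> :: "'a \<Rightarrow> 'v::euclidean_space" and x0 r h +
  fixes J :: "'j set" and \<mu> :: "'j \<Rightarrow> 'v \<Rightarrow> real" and l :: "'v \<Rightarrow> real" and T :: "'v set" and z k0 :: 'v
  assumes dim: "DIM('v) \<ge> 2"
    and finite_J: "finite J"
    and \<mu>_affine: "j \<in> J \<Longrightarrow> affine_map (\<mu> j)"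
    and l_affine: "affine_map l"
    and T_eq: "T = {x. l x \<ge> 0 \<and> (\<forall>j\<in>J. \<mu> j x \<ge> 0)}"
    and compact_T: "compact T"
    and z_inner: "l z > 0" "j \<in> J \<Longrightarrow> \<mu> j z > 0"
    and puncture: "x \<in> T \<Longrightarrow> x \<notin> \<Omega> \<Longrightarrow> l x = 0 \<and> (\<forall>j\<in>J. \<mu> j x > 0)"
    and k0: "k0 \<in> T" "k0 \<notin> \<Omega>"
begin

lemma l_dir: "affine_grad l \<bullet> d = 0 \<Longrightarrow> l (k + t *\<^sub>R d) = l k"
  using affine_functional[OF l_affine, of "k + t *\<^sub>R d" k] by simp

lemma extend_in_facet:
  assumes k: "l k = 0" "\<And>j. j \<in> J \<Longrightarrow> \<mu> j k > 0" and d: "affine_grad l \<bullet> d = 0"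
  obtains s where "s > 0" "\<And>t. 0 \<le> t \<Longrightarrow> t \<le> s \<Longrightarrow> k + t *\<^sub>R d \<in> T"
proof -
  have "open (\<Inter>j\<in>J. {x. \<mu> j x > 0})"
    using finite_J \<mu>_affine by (intro open_INT ballI affine_functional_open_pos) auto
  moreover have "k \<in> (\<Inter>j\<in>J. {x. \<mu> j x > 0})" using k(2) by auto
  ultimately obtain s where s: "s > 0" "(1 - s) *\<^sub>R k + s *\<^sub>R (k + d) \<in> (\<Inter>j\<in>J. {x. \<mu> j x > 0})"
    by (rule stretch_into_open) (rule that)
  have ks: "(1 - s) *\<^sub>R k + s *\<^sub>R (k + d) = k + s *\<^sub>R d" by (simp add: algebra_simps)
  show ?thesis
  proof (rule that[OF s(1)])
    fix t assume t: "0 \<le> t" "t \<le> s"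
    have "\<mu> j (k + t *\<^sub>R d) \<ge> 0" if j: "j \<in> J" for j
    proof -
      have "k + t *\<^sub>R d = k + (t / s) *\<^sub>R ((k + s *\<^sub>R d) - k)" using s(1) by simp
      then have "\<mu> j (k + t *\<^sub>R d) = (1 - t / s) * \<mu> j k + (t / s) * \<mu> j (k + s *\<^sub>R d)"
        using affine_functional_ray[OF \<mu>_affine[OF j], of k "t / s" "k + s *\<^sub>R d"] by presburger
      moreover have "\<mu> j (k + s *\<^sub>R d) > 0" using s(2) ks j by auto
      ultimately show ?thesis using k(2)[OF j] t s(1) by simp
    qed
    then show "k + t *\<^sub>R d \<in> T" using l_dir[OF d] k(1) by (simp add: T_eq)
  qed
qed

text \<open>The last point of \<open>T\<close> on the ray from \<open>k\<close> along
  \<open>d\<close> lies in \<Omega>: at a missing point all \<open>\<mu> j\<close> are positive and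
  \<open>l\<close> is constant along \<open>d\<close>, so the ray could be continued in
  \<open>T\<close>.\<close>

lemma exit_point:
  assumes k: "k \<in> T" "k \<notin> \<Omega>" and d: "affine_grad l \<bullet> d = 0" "d \<noteq> 0"
  obtains t where "t \<ge> 0" "k + t *\<^sub>R d \<in> T" "k + t *\<^sub>R d \<in> \<Omega>"
proof -
  let ?R = "T \<inter> {x. d \<bullet> x \<ge> d \<bullet> k} \<inter> {x. \<exists>t. x = k + t *\<^sub>R d}"
  have line: "{x. \<exists>t. x = k + t *\<^sub>R d} = (\<lambda>v. k + v) ` span {d}"
    by (auto simp: span_singleton image_iff)
  have "closed {x. \<exists>t. x = k + t *\<^sub>R d}" unfolding line by (intro closed_translation closed_subspace subspace_span)
  then have "compact ?R" using compact_T by (intro compact_Int_closed closed_halfspace_ge)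
  moreover have "k + 0 *\<^sub>R d \<in> ?R" using k by (auto intro: exI[of _ 0])
  then have "?R \<noteq> {}" by blast
  ultimately obtain e where e: "e \<in> ?R" "\<And>y. y \<in> ?R \<Longrightarrow> d \<bullet> y \<le> d \<bullet> e"
    using compact_attains_inner_sup[of ?R d] by blast
  obtain t where t: "e = k + t *\<^sub>R d" using e(1) by blast
  have "d \<bullet> e = d \<bullet> k + t * (d \<bullet> d)" by (simp add: t inner_add_right)
  moreover have "d \<bullet> d > 0" using d(2) by simp
  moreover have "d \<bullet> k \<le> d \<bullet> e" using e(1) by blast
  ultimately have t0: "t \<ge> 0" using mult_neg_pos[of t "d \<bullet> d"] by linarith
  have "e \<in> \<Omega>"
  proof (rule ccontr)
    assume "e \<notin> \<Omega>"
    then have "l e = 0" "\<And>j. j \<in> J \<Longrightarrow> \<mu> j e > 0" using puncture[of e] e(1) by auto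
    then obtain s where s: "s > 0" "\<And>t. 0 \<le> t \<Longrightarrow> t \<le> s \<Longrightarrow> e + t *\<^sub>R d \<in> T"
      using extend_in_facet[of e d] d by metis
    have es: "e + s *\<^sub>R d = k + (t + s) *\<^sub>R d" by (simp add: t algebra_simps)
    have de: "d \<bullet> (e + s *\<^sub>R d) > d \<bullet> e" using s(1) d(2) by (simp add: inner_add_right)
    have "e + s *\<^sub>R d \<in> T" using s by simp
    moreover have "d \<bullet> k \<le> d \<bullet> (e + s *\<^sub>R d)" using de e(1) by auto
    ultimately have "e + s *\<^sub>R d \<in> ?R" using es by blast
    then show False using e(2) de by force
  qed
  moreover have "e \<in> T" using e(1) by blast
  ultimately show ?thesis unfolding t by (rule that[OF t0, rotated])
qed

text \<open>A missing point lies between two points of \<Omega> on a line inside the hyperplane of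
  the punctured facet. Since \<Omega> is connected, \<open>f\<close> has the same sign at both, and
  an affine function cannot vanish in between. This is what keeps an invariant wall away from
  \<open>T\<close>.\<close>

lemma nonvanish:
  fixes f :: "'v \<Rightarrow> real"
  assumes f: "affine_map f" and nz: "\<And>x. x \<in> \<Omega> \<Longrightarrow> f x \<noteq> 0" and x: "x \<in> T"
  shows "f x \<noteq> 0"
proof (cases "x \<in> \<Omega>")
  case False
  obtain d where d: "d \<noteq> 0" "affine_grad l \<bullet> d = 0"
    using orthogonal_to_vector_exists[OF dim, of "affine_grad l"] unfolding orthogonal_def by blast
  obtain s where s: "s \<ge> 0" "x + s *\<^sub>R d \<in> \<Omega>"
    using exit_point[OF x False d(2,1)] by blast
  have d': "affine_grad l \<bullet> (- d) = 0" "- d \<noteq> 0" using d by auto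
  obtain t where t: "t \<ge> 0" "x + t *\<^sub>R (- d) \<in> \<Omega>"
    using exit_point[OF x False d'] by blast
  let ?c = "affine_grad f \<bullet> d"
  have fs: "f (x + s *\<^sub>R d) = f x + s * ?c" "f (x + t *\<^sub>R (- d)) = f x - t * ?c"
    using affine_functional[OF f, of "x + s *\<^sub>R d" x] affine_functional[OF f, of "x + t *\<^sub>R (- d)" x] by auto
  have "is_interval (f ` \<Omega>)"
    using connected_continuous_image[OF affine_map_continuous_on[OF f] connected_\<Omega>] is_interval_connected_1 by blast
  have same: "0 < f (x + s *\<^sub>R d) \<longleftrightarrow> 0 < f (x + t *\<^sub>R (- d))"
  proof (rule ccontr)
    assume "\<not> ?thesis"
    then have "min (f (x + s *\<^sub>R d)) (f (x + t *\<^sub>R (- d))) \<le> 0" "0 \<le> max (f (x + s *\<^sub>R d)) (f (x + t *\<^sub>R (- d)))"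
      by auto
    moreover have "f (x + s *\<^sub>R d) \<in> f ` \<Omega>" "f (x + t *\<^sub>R (- d)) \<in> f ` \<Omega>" using s t by blast+
    ultimately have "0 \<in> f ` \<Omega>"
      using \<open>is_interval (f ` \<Omega>)\<close> unfolding is_interval_1
      by (smt (verit, ccfv_threshold))
    then show False using nz by force
  qed
  show ?thesis
  proof
    assume fx: "f x = 0"
    have "s * ?c \<noteq> 0" "t * ?c \<noteq> 0" using nz[OF s(2)] nz[OF t(2)] fs fx by auto
    moreover have "0 < s * ?c \<longleftrightarrow> 0 < - (t * ?c)" using same fs fx by simp
    ultimately show False using s(1) t(1) by (auto simp: zero_less_mult_iff mult_less_0_iff)
  qed
qed (rule nz)

text \<open>A missing point that is extremal in a direction \<open>d\<close> of the facet is left by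
  arbitrarily small steps along \<open>d\<close>, which remain in the facet.\<close>

lemma puncture_sequence:
  obtains p P where "p \<in> T" "p \<notin> \<Omega>" "\<And>i. P i \<in> T \<inter> \<Omega>" "\<And>i. l (P i) = 0" "P \<longlonglongrightarrow> p"
proof -
  obtain d where d: "d \<noteq> 0" "affine_grad l \<bullet> d = 0"
    using orthogonal_to_vector_exists[OF dim, of "affine_grad l"] unfolding orthogonal_def by blast
  have "compact (T - \<Omega>)" using compact_T open_\<Omega> by (rule compact_diff)
  moreover have "T - \<Omega> \<noteq> {}" using k0 by blast
  ultimately obtain p where p: "p \<in> T - \<Omega>" "\<And>y. y \<in> T - \<Omega> \<Longrightarrow> d \<bullet> y \<le> d \<bullet> p"
    using compact_attains_inner_sup[of "T - \<Omega>" d] by blast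
  have lp: "l p = 0" "\<And>j. j \<in> J \<Longrightarrow> \<mu> j p > 0" using puncture[of p] p(1) by auto
  obtain s where s: "s > 0" "\<And>t. 0 \<le> t \<Longrightarrow> t \<le> s \<Longrightarrow> p + t *\<^sub>R d \<in> T"
    using extend_in_facet[OF lp d(2)] by metis
  define P where "P i = p + (s / real (Suc i)) *\<^sub>R d" for i
  show ?thesis
  proof (rule that)
    show "p \<in> T" "p \<notin> \<Omega>" using p by auto
    show "P i \<in> T \<inter> \<Omega>" for i
    proof -
      have "s / real (Suc i) \<le> s / 1" using s(1) by (intro divide_left_mono) auto
      then have "P i \<in> T" unfolding P_def using s by (intro s(2)) auto
      moreover have "d \<bullet> P i > d \<bullet> p" using s(1) d(1) by (simp add: P_def inner_add_right)
      ultimately show ?thesis using p(2)[of "P i"] by force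
    qed
    show "l (P i) = 0" for i using l_dir[OF d(2)] lp by (simp add: P_def)
    have "(\<lambda>i. s / real (Suc i)) \<longlonglongrightarrow> 0"
      using tendsto_mult[OF tendsto_const[of s] LIMSEQ_inverse_real_of_nat] by (simp add: divide_inverse)
    then have "P \<longlonglongrightarrow> p + 0 *\<^sub>R d" unfolding P_def by (intro tendsto_intros)
    then show "P \<longlonglongrightarrow> p" by simp
  qed
qed

text \<open>Segments from the inner point \<open>z\<close> satisfy \<open>l > 0\<close> before their
  end and so avoid the missing points; hence \<open>T \<inter> \<Omega>\<close> is starlike. The
  lift chooses, continuously in \<open>y\<close>, an element of \<open>H\<close> that moves
  \<open>x0\<close> to \<open>y\<close>.\<close>

lemma lift_polytope:
  obtains \<iota> where "continuous_map (top_of_set (T \<inter> \<Omega>)) etop \<iota>" "\<And>y. y \<in> T \<inter> \<Omega> \<Longrightarrow> snd (\<iota> y) x0 = y"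
proof -
  have "z \<in> T" using z_inner by (auto simp: T_eq less_imp_le)
  then have zT: "z \<in> T \<inter> \<Omega>" using puncture[of z] z_inner(1) by auto
  have star: "closed_segment z y \<subseteq> T \<inter> \<Omega>" if y: "y \<in> T \<inter> \<Omega>" for y
  proof
    fix v assume "v \<in> closed_segment z y"
    then obtain t where t: "0 \<le> t" "t \<le> 1" "v = (1 - t) *\<^sub>R z + t *\<^sub>R y"
      unfolding closed_segment_def by blast
    show "v \<in> T \<inter> \<Omega>"
    proof (cases "t = 1")
      case True
      then show ?thesis using t y by simp
    next
      case False
      then have t1: "t < 1" using t by simp
      have lv: "l v > 0"
        unfolding t(3) affine_functional_segment[OF l_affine]
        using z_inner(1) t t1 y by (intro add_pos_nonneg) (auto simp: T_eq)
      have "\<mu> j v \<ge> 0" if "j \<in> J" for j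
        unfolding t(3) affine_functional_segment[OF \<mu>_affine[OF that]]
        using z_inner(2)[OF that] t y that by (intro add_nonneg_nonneg) (auto simp: T_eq)
      then have "v \<in> T" using lv by (simp add: T_eq)
      then show ?thesis using puncture[of v] lv by auto
    qed
  qed
  have f: "continuous_map (top_of_set (T \<inter> \<Omega>)) (top_of_set \<Omega>) (\<lambda>y. y)"
    by (auto simp: continuous_map_in_subtopology)
  obtain e where e: "e \<in> H" "z = snd e x0" using zT unfolding \<Omega>_def by blast
  show ?thesis
    using covering_starlike_lift[OF covering_dev zT star f, of e] e that by (auto simp: topspace_etop)
qed

text \<open>If \<open>snd (\<iota> (P i))\<close> moved points of \<open>Q\<close> to the faces \<open>\<mu> j = 0\<close> for infinitely many \<open>i\<close>, then \<open>\<iota> (P i)\<close>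
  would stay in a compact subset of \<open>H\<close>, since these faces are compact subsets of \<open>\<Omega>\<close>; but it moves
  \<open>x0\<close> to \<open>P i\<close>, which tends to \<open>p \<notin> \<Omega>\<close>.\<close>

lemma escape:
  assumes \<iota>: "continuous_map (top_of_set (T \<inter> \<Omega>)) etop \<iota>" "\<And>y. y \<in> T \<inter> \<Omega> \<Longrightarrow> snd (\<iota> y) x0 = y"
    and P: "\<And>i. P i \<in> T \<inter> \<Omega>" "\<And>i. l (P i) = 0" "P \<longlonglongrightarrow> p" and p: "p \<in> T" "p \<notin> \<Omega>"
    and Q: "compact Q" "Q \<subseteq> \<Omega>" "x0 \<in> Q" "\<And>x. x \<in> Q \<Longrightarrow> closed_segment x0 x \<subseteq> Q"
  shows "eventually (\<lambda>i. \<forall>x\<in>Q. l (snd (\<iota> (P i)) x) \<ge> 0 \<longrightarrow> (\<forall>j\<in>J. \<mu> j (snd (\<iota> (P i)) x) > 0)) sequentially"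
proof (rule ccontr)
  assume "\<not> ?thesis"
  then obtain s :: "nat \<Rightarrow> nat" where s: "strict_mono s" and
    bad: "\<And>n. \<exists>x\<in>Q. l (snd (\<iota> (P (s n))) x) \<ge> 0 \<and> (\<exists>j\<in>J. \<mu> j (snd (\<iota> (P (s n))) x) \<le> 0)"
    using not_eventually_sequentiallyD by (smt (verit, best))
  have f: "continuous_map (top_of_set Q) (top_of_set \<Omega>) (\<lambda>y. y)"
    using Q(2) by (auto simp: continuous_map_in_subtopology)
  \<comment> \<open>With the lift starting at the unit,
    \<open>emult (\<iota> (P i)) (\<sigma> x)\<close> is the lift of the moved set that starts at
    \<open>\<iota> (P i)\<close>, ready for comparison with \<iota>.\<close>
  obtain \<sigma> where \<sigma>: "continuous_map (top_of_set Q) etop \<sigma>" "\<sigma> x0 = eone" "\<And>x. x \<in> Q \<Longrightarrow> snd (\<sigma> x) x0 = x"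
    using covering_starlike_lift[OF covering_dev Q(3,4) f, of eone] H.eone_H
    by (auto simp: topspace_etop eone_def)
  have \<iota>H: "\<iota> y \<in> H" if "y \<in> T \<inter> \<Omega>" for y
    using \<iota>(1) that by (auto simp: continuous_map_def topspace_etop)
  have \<sigma>H: "\<sigma> y \<in> H" if "y \<in> Q" for y
    using \<sigma>(1) that by (auto simp: continuous_map_def topspace_etop)
  let ?L = "T \<inter> (\<Union>j\<in>J. {x. \<mu> j x \<le> 0})"
  have L\<Omega>: "?L \<subseteq> T \<inter> \<Omega>" using puncture by force
  \<comment> \<open>Along the image of the segment from \<open>x0\<close> to \<open>x\<close>, the
    first time at which some \<open>\<mu> j\<close> is no longer positive leads to a point of
    \<open>?L\<close>. Until then the image stays in \<open>T\<close>, and the two lifts agree by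
    uniqueness.\<close>
  have exits: "\<exists>x y. x \<in> Q \<and> y \<in> ?L \<and> \<iota> y = emult (\<iota> (P i)) (\<sigma> x)"
    if x: "x \<in> Q" "l (snd (\<iota> (P i)) x) \<ge> 0" "j0 \<in> J" "\<mu> j0 (snd (\<iota> (P i)) x) \<le> 0" for x i j0
  proof -
    let ?a = "snd (\<iota> (P i))" and ?c = "\<lambda>t. x0 + t *\<^sub>R (x - x0)"
    have EH: "\<iota> (P i) \<in> H" using \<iota>H P(1) by blast
    have aff: "affine_map ?a" using H_aut[OF EH] affine_automorphism_imp_affine_map by blast
    have a0: "?a x0 = P i" using \<iota>(2) P(1) by blast
    have cQ: "?c t \<in> Q" if "0 \<le> t" "t \<le> 1" for t
    proof -
      have "?c t = (1 - t) *\<^sub>R x0 + t *\<^sub>R x" by (simp add: algebra_simps)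
      then have "?c t \<in> closed_segment x0 x" using that unfolding closed_segment_def by blast
      then show ?thesis using Q(4) x(1) by blast
    qed
    have cont_ac: "continuous_on I (\<lambda>t. ?a (?c t))" for I
      by (intro continuous_on_compose2[OF affine_map_continuous_on[OF aff, of UNIV]] continuous_intros) auto
    let ?B = "{0..1} \<inter> (\<Union>j\<in>J. {t. \<mu> j (?a (?c t)) \<le> 0})"
    have "closed (\<Union>j\<in>J. {t. \<mu> j (?a (?c t)) \<le> 0})"
      using finite_J affine_map_continuous_on[OF \<mu>_affine, of _ UNIV]
      by (intro closed_UN ballI closed_Collect_le continuous_on_compose2[OF _ cont_ac] continuous_intros) auto
    then have "compact ?B" by (intro compact_Int_closed) auto
    moreover have "1 \<in> ?B" using x(3,4) by auto
    ultimately obtain t where t: "t \<in> ?B" "\<And>t'. t' \<in> ?B \<Longrightarrow> t \<le> t'"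
      using compact_attains_inf[of ?B] by blast
    have t01: "0 \<le> t" "t \<le> 1" using t(1) by auto
    have pos: "\<mu> j (?a (?c t')) > 0" if "0 \<le> t'" "t' < t" "j \<in> J" for t' j
    proof (rule ccontr)
      assume "\<not> ?thesis"
      then have "\<mu> j (?a (?c t')) \<le> 0" by simp
      then have "t' \<in> ?B" using that t01 by auto
      then show False using t(2) that by force
    qed
    \<comment> \<open>At the first such time no functional can be negative: being affine along the
      segment, it would have vanished strictly earlier.\<close>
    have nonneg: "\<mu> j (?a (?c t')) \<ge> 0" if t': "0 \<le> t'" "t' \<le> t" "j \<in> J" for t' j
    proof (cases "t' < t")
      case True
      then show ?thesis using pos[OF t'(1) True t'(3)] by simp
    next
      case False
      then have tt: "t' = t" using t' by simp
      let ?f = "\<lambda>t. \<mu> j (?a (?c t))"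
      have fm: "affine_map (\<mu> j \<circ> ?a)" using affine_map_compose \<mu>_affine[OF t'(3)] aff by blast
      have ft: "?f (u * t) = (1 - u) * ?f 0 + u * ?f t" for u
        using affine_functional_ray[OF fm, of x0 u "?c t"] by simp
      have f0: "?f 0 \<ge> 0" using P(1)[of i] a0 t'(3) by (simp add: T_eq)
      show ?thesis
      proof (rule ccontr)
        assume "\<not> ?f t' \<ge> 0"
        then have neg: "?f t < 0" using tt by simp
        then have "t \<noteq> 0" using f0 by auto
        then have t0: "t > 0" using t01 by simp
        define u where "u = ?f 0 / (?f 0 - ?f t)"
        have u: "0 \<le> u" "u < 1" using neg f0 by (auto simp: u_def divide_simps)
        have "?f (u * t) = ?f 0 - u * (?f 0 - ?f t)" unfolding ft by (simp add: algebra_simps)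
        also have "\<dots> = 0" using neg f0 by (simp add: u_def)
        finally have "?f (u * t) = 0" .
        moreover have "?f (u * t) > 0" using u t0 t'(3) by (intro pos) auto
        ultimately show False by simp
      qed
    qed
    have lpos: "l (?a (?c t')) \<ge> 0" if "0 \<le> t'" for t'
    proof -
      have lm: "affine_map (l \<circ> ?a)" using affine_map_compose l_affine aff by blast
      have "l (?a (?c t')) = t' * l (?a x)"
        using affine_functional_ray[OF lm, of x0 t' x] a0 P(2) by simp
      then show ?thesis using x(2) that by simp
    qed
    have acT: "?a (?c t') \<in> T \<inter> \<Omega>" if "0 \<le> t'" "t' \<le> t" for t'
    proof -
      have "?a (?c t') \<in> T" using nonneg lpos that by (simp add: T_eq)
      moreover have "?c t' \<in> \<Omega>" using cQ[of t'] that t01 Q(2) by auto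
      ultimately show ?thesis using \<Omega>_invariant[OF EH] by blast
    qed
    have "\<iota> (?a (?c t)) = emult (\<iota> (P i)) (\<sigma> (?c t))"
    proof (rule covering_lift_unique[OF covering_dev connected_space_interval[of 0 t]])
      have "continuous_map (top_of_set {0..t}) (top_of_set (T \<inter> \<Omega>)) (\<lambda>t. ?a (?c t))"
        using cont_ac acT by (auto simp: continuous_map_in_subtopology)
      from continuous_map_compose[OF this \<iota>(1)]
      show "continuous_map (top_of_set {0..t}) etop (\<lambda>t. \<iota> (?a (?c t)))" by (simp add: o_def)
      have "continuous_map (top_of_set {0..t}) (top_of_set Q) ?c"
        using cQ t01 by (auto simp: continuous_map_in_subtopology intro!: continuous_intros)
      from continuous_map_compose[OF this continuous_map_compose[OF \<sigma>(1) continuous_map_left_translation[OF EH]]]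
      show "continuous_map (top_of_set {0..t}) etop (\<lambda>t. emult (\<iota> (P i)) (\<sigma> (?c t)))" by (simp add: o_def)
      show "snd (\<iota> (?a (?c t'))) x0 = snd (emult (\<iota> (P i)) (\<sigma> (?c t'))) x0"
        if "t' \<in> topspace (top_of_set {0..t})" for t'
        using \<iota>(2)[OF acT] \<sigma>(3)[OF cQ] that t01 by (simp add: emult_def)
      show "0 \<in> topspace (top_of_set {0..t})" "t \<in> topspace (top_of_set {0..t})" using t01 by auto
      show "\<iota> (?a (?c 0)) = emult (\<iota> (P i)) (\<sigma> (?c 0))"
        using a0 \<sigma>(2) H_valid[OF EH] by (simp add: emult_eone)
    qed
    moreover have "?c t \<in> Q" using cQ t01 by blast
    moreover have "?a (?c t) \<in> ?L" using acT[of t] t01 t(1) by auto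
    ultimately show ?thesis by blast
  qed
  have "\<exists>x y. x \<in> Q \<and> y \<in> ?L \<and> \<iota> y = emult (\<iota> (P (s n))) (\<sigma> x)" for n
    using bad[of n] exits[of _ "s n"] by blast
  then obtain x y where xy: "\<And>n. x n \<in> Q" "\<And>n. y n \<in> ?L" "\<And>n. \<iota> (y n) = emult (\<iota> (P (s n))) (\<sigma> (x n))"
    by metis
  have "closed (\<Union>j\<in>J. {x. \<mu> j x \<le> 0})"
    using finite_J affine_map_continuous_on[OF \<mu>_affine, of _ UNIV]
    by (intro closed_UN ballI closed_Collect_le continuous_intros) auto
  then have "compact ?L" using compact_T by (intro compact_Int_closed)
  then have "compact (Q \<times> ?L)" using Q(1) by (intro compact_Times)
  then have "seq_compact (Q \<times> ?L)" by (simp add: compact_eq_seq_compact_metric)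
  moreover have "\<And>n. (x n, y n) \<in> Q \<times> ?L" using xy by simp
  ultimately obtain w t where w: "w \<in> Q \<times> ?L" and t: "strict_mono (t :: nat \<Rightarrow> nat)"
    "((\<lambda>n. (x n, y n)) \<circ> t) \<longlonglongrightarrow> w"
    using seq_compactE[of "Q \<times> ?L" "\<lambda>n. (x n, y n)"] by blast
  obtain x' y' where w': "w = (x', y')" "x' \<in> Q" "y' \<in> ?L" using w by blast
  have lx: "(\<lambda>n. x (t n)) \<longlonglongrightarrow> x'" and ly: "(\<lambda>n. y (t n)) \<longlonglongrightarrow> y'"
    using tendsto_fst[OF t(2)] tendsto_snd[OF t(2)] by (simp_all add: w' o_def)
  \<comment> \<open>Applied to \<open>v n\<close>, the product \<open>\<iota> (y (t n))\<close>
    cancels its factor \<open>\<sigma> (x (t n))\<close> and returns the point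
    \<open>P (s (t n))\<close>. Thus this point is expressed by data that converge on compact
    sets.\<close>
  define v where "v n = inv_into UNIV (snd (\<sigma> (x (t n)))) x0" for n
  have lv: "v \<longlonglongrightarrow> inv_into UNIV (snd (\<sigma> x')) x0"
    unfolding v_def using eval_tendsto(2)[OF \<sigma>(1) _ w'(2) lx] xy(1) by blast
  have yT: "y n \<in> T \<inter> \<Omega>" "y' \<in> T \<inter> \<Omega>" for n using xy(2) w'(3) L\<Omega> by blast+
  have le: "(\<lambda>n. snd (\<iota> (y (t n))) u) \<longlonglongrightarrow> snd (\<iota> y') u" for u
    using eval_tendsto(1)[OF \<iota>(1) _ yT(2) ly] yT(1) by blast
  have lim: "(\<lambda>n. snd (\<iota> (y (t n))) (v n)) \<longlonglongrightarrow> snd (\<iota> y') (inv_into UNIV (snd (\<sigma> x')) x0)"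
    by (rule affine_map_tendsto[OF _ _ le lv]) (use \<iota>H yT H_aut affine_automorphism_imp_affine_map in blast)+
  have "snd (\<iota> (y (t n))) (v n) = P (s (t n))" for n
  proof -
    have "snd (\<iota> (y (t n))) (v n) = snd (\<iota> (P (s (t n)))) (snd (\<sigma> (x (t n))) (v n))"
      using xy(3)[of "t n"] by (simp add: emult_def)
    also have "snd (\<sigma> (x (t n))) (v n) = x0" using H_aut[OF \<sigma>H[OF xy(1)]] by (simp add: v_def)
    finally show ?thesis using \<iota>(2) P(1) by simp
  qed
  then have "(\<lambda>n. P (s (t n))) \<longlonglongrightarrow> snd (\<iota> y') (inv_into UNIV (snd (\<sigma> x')) x0)" using lim by simp
  moreover have "(\<lambda>n. P (s (t n))) \<longlonglongrightarrow> p"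
    using LIMSEQ_subseq_LIMSEQ[OF P(3) strict_mono_o[OF s t(1)]] by (simp add: o_def)
  ultimately have "p = snd (\<iota> y') (inv_into UNIV (snd (\<sigma> x')) x0)" by (rule LIMSEQ_unique[rotated])
  moreover have "inv_into UNIV (snd (\<sigma> x')) x0 \<in> \<Omega>"
    using \<Omega>_invariant[OF H_einv[OF \<sigma>H[OF w'(2)]] x0_\<Omega>] by (simp add: einv_def)
  ultimately have "p \<in> \<Omega>" using \<Omega>_invariant[OF \<iota>H[OF yT(2)]] by simp
  with p show False by blast
qed

text \<open>The preimage of \<open>T\<close> under \<open>a i\<close> is cut out by
  \<open>l \<circ> a i\<close> and all \<open>\<mu> j \<circ> a i\<close>. The first vanishes at
  \<open>x0\<close> and only its sign matters, so its gradient is normalised. The others tend to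
  positive values at \<open>x0\<close> and keep their scale.\<close>

theorem convex_complement: "convex (- \<Omega>)"
proof -
  obtain p P where p: "p \<in> T" "p \<notin> \<Omega>" and P: "\<And>i. P i \<in> T \<inter> \<Omega>" "\<And>i. l (P i) = 0" "P \<longlonglongrightarrow> p"
    using puncture_sequence by blast
  obtain \<iota> where \<iota>: "continuous_map (top_of_set (T \<inter> \<Omega>)) etop \<iota>" "\<And>y. y \<in> T \<inter> \<Omega> \<Longrightarrow> snd (\<iota> y) x0 = y"
    using lift_polytope by blast
  note esc = escape[OF \<iota> P p]
  have EH: "\<iota> (P i) \<in> H" for i
    using \<iota>(1) P(1)[of i] by (auto simp: continuous_map_def topspace_etop)
  define a where "a i = snd (\<iota> (P i))" for i
  have aut: "affine_automorphism (a i)" and aff: "affine_map (a i)" for i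
    using H_aut[OF EH] affine_automorphism_imp_affine_map by (auto simp: a_def)
  have a0: "a i x0 = P i" for i using \<iota>(2) P(1) by (simp add: a_def)
  define L where "L i = affine_grad (l \<circ> a i)" for i
  have la: "l (a i x) = L i \<bullet> (x - x0)" for i x
    using affine_functional[OF affine_map_compose[OF l_affine aff], of i x x0] P(2) a0 by (simp add: L_def)
  have L0: "L i \<noteq> 0" for i
    using la[of i "inv_into UNIV (a i) z"] aut z_inner(1) by auto
  define n where "n i = L i /\<^sub>R norm (L i)" for i
  have n1: "norm (n i) = 1" and nsgn: "n i \<bullet> (x - x0) \<ge> 0 \<longleftrightarrow> l (a i x) \<ge> 0" "n i \<bullet> (x - x0) > 0 \<longleftrightarrow> l (a i x) > 0" for i x
    using L0[of i] by (auto simp: n_def la zero_le_mult_iff zero_less_mult_iff)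
  define w where "w j i = affine_grad (\<mu> j \<circ> a i)" for j i
  have \<mu>a: "\<mu> j (a i x) = \<mu> j (P i) + w j i \<bullet> (x - x0)" if "j \<in> J" for j i x
    using affine_functional[OF affine_map_compose[OF \<mu>_affine[OF that] aff], of i x x0] a0 by (simp add: w_def)
  \<comment> \<open>\<open>escape\<close> for this ball: eventually, the half of it where
    \<open>l \<circ> a i\<close> is nonnegative is mapped into \<open>T\<close>.\<close>
  obtain \<rho> where \<rho>: "\<rho> > 0" "cball x0 \<rho> \<subseteq> \<Omega>"
    using open_\<Omega> x0_\<Omega> open_contains_cball by blast
  have ball_ev: "eventually (\<lambda>i. \<forall>x\<in>cball x0 \<rho>. l (a i x) \<ge> 0 \<longrightarrow> (\<forall>j\<in>J. \<mu> j (a i x) > 0)) sequentially"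
    unfolding a_def
  proof (intro esc)
    show "closed_segment x0 x \<subseteq> cball x0 \<rho>" if "x \<in> cball x0 \<rho>" for x
      using that \<rho>(1) by (intro closed_segment_subset) auto
  qed (use \<rho> in auto)
  have "\<exists>M. \<forall>x\<in>T. \<bar>\<mu> j x\<bar> \<le> M" if "j \<in> J" for j
  proof -
    have "bounded (\<mu> j ` T)"
      using compact_T affine_map_continuous_on[OF \<mu>_affine[OF that]]
      by (intro compact_imp_bounded compact_continuous_image)
    then show ?thesis unfolding bounded_iff by auto
  qed
  then obtain M where M: "\<And>j x. j \<in> J \<Longrightarrow> x \<in> T \<Longrightarrow> \<bar>\<mu> j x\<bar> \<le> M j" by metis
  obtain i0 where i0: "\<And>i x j. i \<ge> i0 \<Longrightarrow> x \<in> cball x0 \<rho> \<Longrightarrow> l (a i x) \<ge> 0 \<Longrightarrow> j \<in> J \<Longrightarrow> \<mu> j (a i x) > 0"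
    using ball_ev unfolding eventually_sequentially by blast
  \<comment> \<open>The unit vector along \<open>w j i\<close> gets the sign that puts
    \<open>x0 + \<rho> *\<^sub>R v\<close> into the half-ball. There and at the centre
    \<open>\<mu> j\<close> is bounded by \<open>M j\<close>, so it varies by at most
    \<open>2 * M j\<close> over the distance \<rho>.\<close>
  have wbound: "norm (w j i) \<le> 2 * M j / \<rho>" if i: "i \<ge> i0" and j: "j \<in> J" for i j
  proof (cases "w j i = 0")
    case True
    then show ?thesis using M[OF j k0(1)] \<rho>(1) by simp
  next
    case False
    define v' where "v' = (1 / norm (w j i)) *\<^sub>R w j i"
    have v': "norm v' = 1" "w j i \<bullet> v' = norm (w j i)"
      using False by (simp_all add: v'_def power2_norm_eq_inner[symmetric] power2_eq_square)
    define v where "v = (if n i \<bullet> v' \<ge> 0 then v' else - v')"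
    have v: "norm v = 1" "n i \<bullet> v \<ge> 0" "\<bar>w j i \<bullet> v\<bar> = norm (w j i)"
      using v' by (simp_all add: v_def)
    let ?x = "x0 + \<rho> *\<^sub>R v"
    have xb: "?x \<in> cball x0 \<rho>" using v \<rho>(1) by (simp add: dist_norm)
    have lx: "l (a i ?x) \<ge> 0" using nsgn(1)[of i ?x] v(2) \<rho>(1) by simp
    have "a i ?x \<in> T" using i0[OF i xb lx] lx by (auto simp: T_eq less_imp_le)
    then have "\<bar>\<mu> j (a i ?x)\<bar> \<le> M j" "\<bar>\<mu> j (P i)\<bar> \<le> M j" using M[OF j] P(1) by auto
    moreover have "\<mu> j (a i ?x) - \<mu> j (P i) = \<rho> * (w j i \<bullet> v)" using \<mu>a[OF j, of i ?x] by simp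
    ultimately have "\<bar>\<rho> * (w j i \<bullet> v)\<bar> \<le> 2 * M j" by linarith
    then have "\<rho> * \<bar>w j i \<bullet> v\<bar> \<le> 2 * M j" using \<rho>(1) by (simp add: abs_mult)
    then show ?thesis using v(3) \<rho>(1) by (simp add: field_simps)
  qed
  have bn: "bounded (range (\<lambda>i. n (i + i0)))" using n1 unfolding bounded_iff by (intro exI[of _ 1]) auto
  obtain s1 \<nu> where s1: "strict_mono (s1 :: nat \<Rightarrow> nat)" "((\<lambda>i. n (i + i0)) \<circ> s1) \<longlonglongrightarrow> \<nu>"
    using bounded_imp_convergent_subsequence[OF bn] by blast
  have bw: "bounded (range (\<lambda>i. w j (s1 i + i0)))" if "j \<in> J" for j
    using wbound[OF _ that] unfolding bounded_iff by (intro exI[of _ "2 * M j / \<rho>"]) auto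
  obtain s2 w' where s2: "strict_mono (s2 :: nat \<Rightarrow> nat)"
    "\<And>j. j \<in> J \<Longrightarrow> ((\<lambda>i. w j (s1 i + i0)) \<circ> s2) \<longlonglongrightarrow> w' j"
    using finite_family_convergent_subsequence[of J "\<lambda>j i. w j (s1 i + i0)", OF finite_J bw] by blast
  \<comment> \<open>Three choices composed: the shift by \<open>i0\<close> beyond which the bounds
    hold, a subsequence for \<open>n\<close>, and a refinement for all \<open>w j\<close> at
    once.\<close>
  define s where "s i = s1 (s2 i) + i0" for i
  have s: "strict_mono s" using strict_mono_o[OF s1(1) s2(1)] by (auto simp: s_def strict_mono_def)
  have n_lim: "(\<lambda>i. n (s i)) \<longlonglongrightarrow> \<nu>"
    using LIMSEQ_subseq_LIMSEQ[OF s1(2) s2(1)] by (simp add: s_def o_def)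
  have w_lim: "(\<lambda>i. w j (s i)) \<longlonglongrightarrow> w' j" if "j \<in> J" for j
    using s2(2)[OF that] by (simp add: s_def o_def)
  have P_lim: "(\<lambda>i. P (s i)) \<longlonglongrightarrow> p" using LIMSEQ_subseq_LIMSEQ[OF P(3) s] by (simp add: o_def)
  have "norm \<nu> = 1" using tendsto_norm[OF n_lim] n1 by (simp add: LIMSEQ_const_iff)
  then have \<nu>: "\<nu> \<noteq> 0" by auto
  \<comment> \<open>The limit of \<open>\<mu> j \<circ> a (s i)\<close>. Its value
    \<open>\<mu> j p\<close> at \<open>x0\<close> is positive because \<open>p\<close> is a missing
    point.\<close>
  define m where "m j x = \<mu> j p + w' j \<bullet> (x - x0)" for j x
  have m_aff: "affine_map (m j)" for j
    unfolding affine_map_def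
    by (intro exI[of _ "\<lambda>x. w' j \<bullet> x"] exI[of _ "\<mu> j p - w' j \<bullet> x0"])
       (auto simp: m_def inner_diff_right bounded_linear.linear bounded_linear_inner_right)
  have m_x0: "m j x0 > 0" if "j \<in> J" for j using puncture[OF p] that by (simp add: m_def)
  have \<mu>_lim: "(\<lambda>i. \<mu> j (a (s i) x)) \<longlonglongrightarrow> m j x" if j: "j \<in> J" for j x
  proof -
    have "(\<lambda>i. \<mu> j (P (s i))) \<longlonglongrightarrow> \<mu> j p"
      by (rule continuous_on_tendsto_compose[OF affine_map_continuous_on[OF \<mu>_affine[OF j], of UNIV] P_lim]) auto
    then have "(\<lambda>i. \<mu> j (P (s i)) + w j (s i) \<bullet> (x - x0)) \<longlonglongrightarrow> m j x"
      unfolding m_def by (intro tendsto_intros w_lim j)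
    then show ?thesis using \<mu>a[OF j] by simp
  qed
  have l_ev: "eventually (\<lambda>i. l (a (s i) x) > 0) sequentially" if "\<nu> \<bullet> (x - x0) > 0" for x
  proof -
    have "(\<lambda>i. n (s i) \<bullet> (x - x0)) \<longlonglongrightarrow> \<nu> \<bullet> (x - x0)" by (intro tendsto_intros n_lim)
    then have "eventually (\<lambda>i. n (s i) \<bullet> (x - x0) > 0) sequentially" using that by (rule order_tendstoD)
    then show ?thesis using nsgn(2) by simp
  qed
  \<comment> \<open>Such an \<open>x\<close> is eventually moved to points of \<open>T\<close> with
    \<open>l > 0\<close>. These lie in \<Omega>, and invariance brings the conclusion back to
    \<open>x\<close>.\<close>
  have inner: "x \<in> \<Omega> \<and> eventually (\<lambda>i. snd (\<iota> (P (s i))) x \<in> T) sequentially"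
    if x: "\<nu> \<bullet> (x - x0) > 0" "\<And>j. j \<in> J \<Longrightarrow> m j x > 0" for x
  proof -
    have "eventually (\<lambda>i. \<forall>j\<in>J. \<mu> j (a (s i) x) > 0) sequentially"
      using finite_J order_tendstoD(1)[OF \<mu>_lim] x(2) by (intro eventually_ball_finite) auto
    then have "eventually (\<lambda>i. l (a (s i) x) > 0 \<and> (\<forall>j\<in>J. \<mu> j (a (s i) x) > 0)) sequentially"
      using l_ev[OF x(1)] by (rule eventually_conj[rotated])
    then have ev: "eventually (\<lambda>i. a (s i) x \<in> T \<and> l (a (s i) x) > 0) sequentially"
      by (rule eventually_mono) (auto simp: T_eq less_imp_le)
    then obtain i where i: "a (s i) x \<in> T" "l (a (s i) x) > 0" unfolding eventually_sequentially by blast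
    then have "a (s i) x \<in> \<Omega>" using puncture[OF i(1)] by force
    then have "x \<in> \<Omega>" using \<Omega>_invariant_iff[OF EH] by (simp add: a_def)
    moreover have "eventually (\<lambda>i. snd (\<iota> (P (s i))) x \<in> T) sequentially"
      using ev by (rule eventually_mono) (simp add: a_def)
    ultimately show ?thesis by blast
  qed
  \<comment> \<open>The segment is itself a compact starlike set, so \<open>escape\<close> applies
    to it. In the limit the strict inequality becomes a weak one.\<close>
  have outer: "m j y \<ge> 0" if y: "closed_segment x0 y \<subseteq> \<Omega>" "\<nu> \<bullet> (y - x0) > 0" and j: "j \<in> J" for y j
  proof -
    have "eventually (\<lambda>i. \<forall>x\<in>closed_segment x0 y. l (a i x) \<ge> 0 \<longrightarrow> (\<forall>j\<in>J. \<mu> j (a i x) > 0)) sequentially"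
      unfolding a_def using y(1) by (intro esc) (auto intro: subset_closed_segment[THEN iffD2] simp: subset_closed_segment)
    then have "eventually (\<lambda>i. \<forall>x\<in>closed_segment x0 y. l (a (s i) x) \<ge> 0 \<longrightarrow> (\<forall>j\<in>J. \<mu> j (a (s i) x) > 0)) sequentially"
      using eventually_subseq[OF s] by fast
    then have "eventually (\<lambda>i. \<mu> j (a (s i) y) \<ge> 0) sequentially"
      using l_ev[OF y(2)] by eventually_elim (use j in \<open>auto simp: less_imp_le\<close>)
    then show ?thesis by (rule tendsto_lowerbound[OF \<mu>_lim[OF j]]) simp
  qed
  have half: "x \<in> \<Omega>" if "\<nu> \<bullet> (x - x0) > 0" for x
  proof (rule halfspace_in_\<Omega>[where T = T and E = "\<lambda>i. \<iota> (P (s i))" and J = J and m = m and \<nu> = \<nu>])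
    show "snd (\<iota> (P (s i))) x0 \<in> T" for i using \<iota>(2) P(1) by (metis IntD1)
  qed (use compact_T nonvanish EH finite_J m_aff m_x0 \<nu> inner outer that in auto)
  show ?thesis using \<nu> half by (rule convex_complement_\<Omega>)
qed

end

section \<open>Charts adapted to the group\<close>

lemma affine_structureD:
  assumes "affine_structure X A"
  shows "Hausdorff_space X" "c \<in> A \<Longrightarrow> chart_on X c" "(\<Union>c\<in>A. fst c) = topspace X"
    "c \<in> A \<Longrightarrow> d \<in> A \<Longrightarrow> compatible (locally_restricts {L. affine_automorphism L}) c d"
    "chart_on X c \<Longrightarrow> (\<And>d. d \<in> A \<Longrightarrow> compatible (locally_restricts {L. affine_automorphism L}) c d) \<Longrightarrow> c \<in> A"
proof -
  note 1 = assms[unfolded affine_structure_def maximal_atlas_def]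
  note 2 = conjunct2[OF conjunct2[OF 1]]
  show "Hausdorff_space X" by (rule conjunct1[OF 1])
  show "c \<in> A \<Longrightarrow> chart_on X c" by (rule bspec[OF conjunct1[OF 2]])
  show "(\<Union>c\<in>A. fst c) = topspace X" by (rule conjunct1[OF conjunct2[OF 2]])
  show "c \<in> A \<Longrightarrow> d \<in> A \<Longrightarrow> compatible (locally_restricts {L. affine_automorphism L}) c d"
    by (rule bspec[OF bspec[OF conjunct1[OF conjunct2[OF conjunct2[OF 2]]]]])
  show "c \<in> A" if "chart_on X c" "\<And>d. d \<in> A \<Longrightarrow> compatible (locally_restricts {L. affine_automorphism L}) c d"
    by (rule mp[OF spec[OF conjunct2[OF conjunct2[OF conjunct2[OF 2]]]]]) (intro conjI ballI that)
qed

lemma left_invariantD: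
  assumes "left_invariant G X A" "g \<in> carrier G" "(U, \<phi>) \<in> A" "(V, \<psi>) \<in> A"
  shows "locally_restricts {L. affine_map L} (\<phi> ` (U \<inter> (\<lambda>y. g \<otimes>\<^bsub>G\<^esub> y) -` V)) (\<psi> \<circ> (\<lambda>y. g \<otimes>\<^bsub>G\<^esub> y) \<circ> inv_into U \<phi>)"
proof -
  have "chartwise_map (locally_restricts {L. affine_map L}) X A X A (\<lambda>y. g \<otimes>\<^bsub>G\<^esub> y)"
    using assms(1,2) by (auto simp: left_invariant_def affine_diffeomorphism_def affine_manifold_map_def)
  then show ?thesis using assms(3,4) unfolding chartwise_map_def by blast
qed

lemma left_invariant_continuous_map:
  assumes "left_invariant G X A" "g \<in> carrier G"
  shows "continuous_map X X (\<lambda>y. g \<otimes>\<^bsub>G\<^esub> y)"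
  using assms by (auto simp: left_invariant_def affine_diffeomorphism_def affine_manifold_map_def chartwise_map_def)

text \<open>Locally affine maps between charts that are injective on an open set are locally affine
  automorphisms, so affine local coordinates can be pulled back along left translations.\<close>

lemma translated_chart_in_atlas:
  fixes A :: "('a, 'v::euclidean_space) atlas"
  assumes G: "group G" and X: "topspace X = carrier G" and aff: "affine_structure X A"
    and li: "left_invariant G X A" and c: "(U, \<phi>) \<in> A" and g: "g \<in> carrier G" and a: "affine_automorphism a"
  shows "((\<lambda>y. g \<otimes>\<^bsub>G\<^esub> y) ` U, \<lambda>y. a (\<phi> (inv\<^bsub>G\<^esub> g \<otimes>\<^bsub>G\<^esub> y))) \<in> A"
proof -
  interpret group G by (rule G)
  let ?l = "\<lambda>y. g \<otimes>\<^bsub>G\<^esub> y" and ?m = "\<lambda>y. inv\<^bsub>G\<^esub> g \<otimes>\<^bsub>G\<^esub> y"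
  let ?U = "?l ` U" and ?\<phi> = "\<lambda>y. a (\<phi> (inv\<^bsub>G\<^esub> g \<otimes>\<^bsub>G\<^esub> y))"
  note ch = chart_onD[OF affine_structureD(2)[OF aff c]]
  have UG: "U \<subseteq> carrier G" using ch X by simp
  have ml: "?m (?l y) = y" "?l (?m y) = y" if "y \<in> carrier G" for y
    using g that by (simp_all flip: m_assoc)
  have Ueq: "?U = {y \<in> carrier G. ?m y \<in> U}"
  proof
    show "?U \<subseteq> {y \<in> carrier G. ?m y \<in> U}"
    proof (rule image_subsetI)
      fix u assume u: "u \<in> U"
      then have "u \<in> carrier G" using UG by blast
      then show "?l u \<in> {y \<in> carrier G. ?m y \<in> U}" using u g ml(1) by simp
    qed
    show "{y \<in> carrier G. ?m y \<in> U} \<subseteq> ?U"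
    proof
      fix y assume y: "y \<in> {y \<in> carrier G. ?m y \<in> U}"
      then have "y = ?l (?m y)" using ml(2) by simp
      then show "y \<in> ?U" using y by blast
    qed
  qed
  have cl: "continuous_map X X ?l" "continuous_map X X ?m"
    using left_invariant_continuous_map[OF li] g by auto
  have oU: "openin X ?U"
    unfolding Ueq using openin_continuous_map_preimage[OF cl(2) ch(1)] X by simp
  have chart: "chart_on X (?U, ?\<phi>)"
  proof -
    have "homeomorphic_maps X X ?m ?l"
      unfolding homeomorphic_maps_def X using cl ml by simp
    then have "homeomorphic_map X X ?m" using homeomorphic_maps_map by blast
    then have "homeomorphic_map (subtopology X ?U) (subtopology X U) ?m"
    proof (rule homeomorphic_map_subtopologies)
      have "?m ` ?U = U"
        unfolding image_image using UG ml(1) by (simp add: subset_iff cong: image_cong_simp)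
      moreover have "topspace X \<inter> ?U = ?U" "topspace X \<inter> U = U"
        using UG X unfolding Ueq by auto
      ultimately show "?m ` (topspace X \<inter> ?U) = topspace X \<inter> U" by simp
    qed
    then have "homeomorphic_map (subtopology X ?U) (top_of_set (\<phi> ` U)) (\<phi> \<circ> ?m)"
      using ch(3) by (rule homeomorphic_map_compose)
    then have "homeomorphic_map (subtopology X ?U) (top_of_set (a ` \<phi> ` U)) (a \<circ> (\<phi> \<circ> ?m))"
      using affine_automorphism_homeomorphic_map[OF a] by (rule homeomorphic_map_compose)
    moreover have im: "?\<phi> ` ?U = a ` \<phi> ` U"
    proof -
      have "?\<phi> ` ?U = (\<lambda>u. a (\<phi> u)) ` U"
        unfolding image_image by (rule image_cong) (use UG ml in auto)
      then show ?thesis by (simp add: image_image)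
    qed
    moreover have "open (a ` \<phi> ` U)" using affine_automorphism_open_image[OF a ch(2)] .
    ultimately show ?thesis using oU by (simp add: chart_on_def o_def)
  qed
  note ch' = chart_onD[OF chart]
  show ?thesis
  proof (rule affine_structureD(5)[OF aff chart])
    fix d assume d: "d \<in> A"
    obtain V \<psi> where d_eq: "d = (V, \<psi>)" by (cases d)
    note dA = d[unfolded d_eq]
    have chV: "chart_on X (V, \<psi>)" using affine_structureD(2)[OF aff dA] .
    note chv = chart_onD[OF chV]
    have UV: "openin X (?U \<inter> V)" using oU chv(1) by blast
    have o1: "open (?\<phi> ` (?U \<inter> V))" using chart_on_open_image[OF chart chv(1)] .
    have o2: "open (\<psi> ` (?U \<inter> V))" using chart_on_open_image[OF chV oU] by (simp add: Int_commute)
    have inv1: "inv_into ?U ?\<phi> (?\<phi> y) = y" if "y \<in> ?U" for y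
      using inv_into_f_f[OF ch'(4) that] .
    have inv2: "inv_into V \<psi> (\<psi> y) = y" if "y \<in> V" for y
      using inv_into_f_f[OF chv(4) that] .
    have i1: "inj_on (\<psi> \<circ> inv_into ?U ?\<phi>) (?\<phi> ` (?U \<inter> V))"
    proof (rule inj_onI)
      fix p q assume "p \<in> ?\<phi> ` (?U \<inter> V)" "q \<in> ?\<phi> ` (?U \<inter> V)" "(\<psi> \<circ> inv_into ?U ?\<phi>) p = (\<psi> \<circ> inv_into ?U ?\<phi>) q"
      then obtain y y' where y: "y \<in> ?U \<inter> V" "p = ?\<phi> y" "y' \<in> ?U \<inter> V" "q = ?\<phi> y'" and e: "\<psi> y = \<psi> y'"
        using inv1 by (smt (verit, best) Int_iff comp_apply imageE)
      then show "p = q" using chv(4) by (metis Int_iff inj_onD)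
    qed
    have i2: "inj_on (?\<phi> \<circ> inv_into V \<psi>) (\<psi> ` (?U \<inter> V))"
    proof (rule inj_onI)
      fix p q assume "p \<in> \<psi> ` (?U \<inter> V)" "q \<in> \<psi> ` (?U \<inter> V)" "(?\<phi> \<circ> inv_into V \<psi>) p = (?\<phi> \<circ> inv_into V \<psi>) q"
      then obtain y y' where y: "y \<in> ?U \<inter> V" "p = \<psi> y" "y' \<in> ?U \<inter> V" "q = \<psi> y'" and e: "?\<phi> y = ?\<phi> y'"
        using inv2 by (smt (verit, best) Int_iff comp_apply imageE)
      then show "p = q" using ch'(4) by (metis (no_types, lifting) Int_iff inj_onD)
    qed
    \<comment> \<open>The transition map is the inverse of \<open>a\<close> followed by left
      translation by \<open>g\<close> read in \<phi> and \<psi>, which is locally affine by left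
      invariance.\<close>
    have l1: "locally_restricts {L. affine_map L} (?\<phi> ` (?U \<inter> V)) (\<psi> \<circ> inv_into ?U ?\<phi>)"
    proof (rule locally_restrictsI)
      fix p assume "p \<in> ?\<phi> ` (?U \<inter> V)"
      then obtain u where u: "u \<in> U" "?l u \<in> V" "p = ?\<phi> (?l u)" by blast
      have pu: "p = a (\<phi> u)" using u UG ml by auto
      have "\<phi> u \<in> \<phi> ` (U \<inter> ?l -` V)" using u by blast
      with left_invariantD[OF li g c dA]
      obtain N' L where N': "open N'" "\<phi> u \<in> N'" "affine_map L"
        "\<And>y. y \<in> N' \<Longrightarrow> y \<in> \<phi> ` (U \<inter> ?l -` V) \<Longrightarrow> (\<psi> \<circ> ?l \<circ> inv_into U \<phi>) y = L y"
        by (rule locally_restrictsE) (rule that)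
      show "\<exists>N L. open N \<and> p \<in> N \<and> affine_map L \<and> (\<forall>y\<in>N \<inter> ?\<phi> ` (?U \<inter> V). (\<psi> \<circ> inv_into ?U ?\<phi>) y = L y)"
      proof (intro exI[of _ "a ` N'"] exI[of _ "L \<circ> inv_into UNIV a"] conjI ballI)
        show "open (a ` N')" using affine_automorphism_open_image[OF a N'(1)] .
        show "p \<in> a ` N'" using pu N' by blast
        show "affine_map (L \<circ> inv_into UNIV a)"
          using affine_map_compose N'(3) affine_automorphism_imp_affine_map[OF affine_automorphism_inverse[OF a]] by blast
        fix q assume "q \<in> a ` N' \<inter> ?\<phi> ` (?U \<inter> V)"
        then obtain v where v: "v \<in> U" "?l v \<in> V" "q = ?\<phi> (?l v)" "q \<in> a ` N'" by blast
        have qv: "q = a (\<phi> v)" using v UG ml by auto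
        then have "\<phi> v \<in> N'" using v(4) affine_automorphism_inj[OF a] by auto
        moreover have "\<phi> v \<in> \<phi> ` (U \<inter> ?l -` V)" using v by blast
        ultimately have "(\<psi> \<circ> ?l \<circ> inv_into U \<phi>) (\<phi> v) = L (\<phi> v)" by (rule N'(4))
        moreover have "inv_into U \<phi> (\<phi> v) = v" using inv_into_f_f[OF ch(4) v(1)] .
        moreover have "inv_into ?U ?\<phi> q = ?l v" unfolding v(3) by (rule inv1) (use v in blast)
        ultimately show "(\<psi> \<circ> inv_into ?U ?\<phi>) q = (L \<circ> inv_into UNIV a) q"
          using qv a by simp
      qed
    qed
    have ig: "inv\<^bsub>G\<^esub> g \<in> carrier G" using g by simp
    have l2: "locally_restricts {L. affine_map L} (\<psi> ` (?U \<inter> V)) (?\<phi> \<circ> inv_into V \<psi>)"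
    proof (rule locally_restrictsI)
      have mem: "y \<in> V \<inter> ?m -` U \<longleftrightarrow> y \<in> ?U \<inter> V" for y
        using chv(5) X unfolding Ueq by auto
      fix p assume "p \<in> \<psi> ` (?U \<inter> V)"
      then obtain y where y: "y \<in> ?U \<inter> V" "p = \<psi> y" by blast
      have "p \<in> \<psi> ` (V \<inter> ?m -` U)" using y mem by blast
      with left_invariantD[OF li ig dA c]
      obtain N' L where N': "open N'" "p \<in> N'" "affine_map L"
        "\<And>y. y \<in> N' \<Longrightarrow> y \<in> \<psi> ` (V \<inter> ?m -` U) \<Longrightarrow> (\<phi> \<circ> ?m \<circ> inv_into V \<psi>) y = L y"
        by (rule locally_restrictsE) (rule that)
      show "\<exists>N L. open N \<and> p \<in> N \<and> affine_map L \<and> (\<forall>y\<in>N \<inter> \<psi> ` (?U \<inter> V). (?\<phi> \<circ> inv_into V \<psi>) y = L y)"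
      proof (intro exI[of _ N'] exI[of _ "a \<circ> L"] conjI ballI N'(1,2))
        show "affine_map (a \<circ> L)"
          using affine_map_compose N'(3) affine_automorphism_imp_affine_map[OF a] by blast
        fix q assume q: "q \<in> N' \<inter> \<psi> ` (?U \<inter> V)"
        then have "q \<in> \<psi> ` (V \<inter> ?m -` U)" using mem by blast
        then show "(?\<phi> \<circ> inv_into V \<psi>) q = (a \<circ> L) q" using N'(4)[of q] q by simp
      qed
    qed
    show "compatible (locally_restricts {L. affine_automorphism L}) (?U, ?\<phi>) d"
      unfolding d_eq compatible_def
      using locally_restricts_automorphismI[OF o1 i1 l1] locally_restricts_automorphismI[OF o2 i2 l2] by simp
  qed
qed

text \<open>The ball is so small that products of two elements of \<open>N\<close> stay in the chart
  domain \<open>U\<close>. On this connected set the locally affine left multiplication by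
  \<open>u\<close> is one affine map, and cancellation in the group makes it injective.\<close>

lemma etale_group_exists:
  fixes A :: "('a, 'v::euclidean_space) atlas"
  assumes G: "group G" and X: "topspace X = carrier G"
    and mult: "continuous_map (prod_topology X X) X (\<lambda>(x, y). x \<otimes>\<^bsub>G\<^esub> y)"
    and inv: "continuous_map X X (\<lambda>x. inv\<^bsub>G\<^esub> x)"
    and aff: "affine_structure X A" and li: "left_invariant G X A"
  obtains U \<phi> N r h where "(U, \<phi>) \<in> A" "N \<subseteq> U" "etale_group G X N \<phi> (\<phi> \<one>\<^bsub>G\<^esub>) r h"
proof -
  interpret group G by (rule G)
  obtain U \<phi> where c: "(U, \<phi>) \<in> A" and oneU: "\<one>\<^bsub>G\<^esub> \<in> U"
    using affine_structureD(3)[OF aff] X by (metis (no_types, lifting) UN_E one_closed prod.collapse)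
  have chart: "chart_on X (U, \<phi>)" using affine_structureD(2)[OF aff c] .
  note ch = chart_onD[OF chart]
  have "openin (prod_topology X X) {x \<in> topspace (prod_topology X X). (\<lambda>(x, y). x \<otimes>\<^bsub>G\<^esub> y) x \<in> U}"
    using openin_continuous_map_preimage[OF mult ch(1)] .
  moreover have "(\<one>\<^bsub>G\<^esub>, \<one>\<^bsub>G\<^esub>) \<in> {x \<in> topspace (prod_topology X X). (\<lambda>(x, y). x \<otimes>\<^bsub>G\<^esub> y) x \<in> U}"
    using oneU X by simp
  ultimately obtain W1 W2 where W: "openin X W1" "openin X W2" "\<one>\<^bsub>G\<^esub> \<in> W1" "\<one>\<^bsub>G\<^esub> \<in> W2"
    "W1 \<times> W2 \<subseteq> {x \<in> topspace (prod_topology X X). (\<lambda>(x, y). x \<otimes>\<^bsub>G\<^esub> y) x \<in> U}"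
    unfolding openin_prod_topology_alt by (smt (verit, best))
  let ?x0 = "\<phi> \<one>\<^bsub>G\<^esub>"
  have "openin X (W1 \<inter> W2)" using W by blast
  then have "open (\<phi> ` (U \<inter> (W1 \<inter> W2)))" by (rule chart_on_open_image[OF chart])
  moreover have "?x0 \<in> \<phi> ` (U \<inter> (W1 \<inter> W2))" using oneU W by blast
  ultimately obtain r where r: "r > 0" "ball ?x0 r \<subseteq> \<phi> ` (U \<inter> (W1 \<inter> W2))"
    using open_contains_ball by blast
  define N where "N = {x \<in> U. \<phi> x \<in> ball ?x0 r}"
  have oN: "openin X N" unfolding N_def by (rule chart_on_preimage[OF chart open_ball])
  have NU: "N \<subseteq> U" by (auto simp: N_def)
  have NW: "N \<subseteq> W1 \<inter> W2"
  proof
    fix x assume x: "x \<in> N"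
    then have xU: "x \<in> U" and "\<phi> x \<in> \<phi> ` (U \<inter> (W1 \<inter> W2))"
      using subsetD[OF r(2), of "\<phi> x"] by (simp_all add: N_def)
    then obtain y where y: "\<phi> x = \<phi> y" "y \<in> U" "y \<in> W1 \<inter> W2" by blast
    have "x = y" by (rule inj_onD[OF ch(4) y(1) xU y(2)])
    then show "x \<in> W1 \<inter> W2" using y(3) by simp
  qed
  have NN: "u \<otimes>\<^bsub>G\<^esub> y \<in> U" if "u \<in> N" "y \<in> N" for u y 
  proof -
    have "(u, y) \<in> W1 \<times> W2" using NW that by blast
    then show ?thesis using W(5) by auto
  qed
  have im: "\<phi> ` N = ball ?x0 r"
  proof
    show "ball ?x0 r \<subseteq> \<phi> ` N" using r(2) unfolding N_def by blast
  qed (auto simp: N_def)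
  have NG: "N \<subseteq> carrier G" using NU ch(5) X by simp
  have "\<exists>L. affine_automorphism L \<and> (\<forall>y\<in>N. \<phi> (u \<otimes>\<^bsub>G\<^esub> y) = L (\<phi> y))" if u: "u \<in> N" for u
  proof -
    have uG: "u \<in> carrier G" using u NG by blast
    let ?f = "\<phi> \<circ> (\<lambda>y. u \<otimes>\<^bsub>G\<^esub> y) \<circ> inv_into U \<phi>"
    have sub: "ball ?x0 r \<subseteq> \<phi> ` (U \<inter> (\<lambda>y. u \<otimes>\<^bsub>G\<^esub> y) -` U)"
      unfolding im[symmetric] using NU NN[OF u] by blast
    have fy: "?f (\<phi> y) = \<phi> (u \<otimes>\<^bsub>G\<^esub> y)" if "y \<in> N" for y
      using inv_into_f_f[OF ch(4)] that NU by auto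
    have "locally_restricts {L. affine_map L} (ball ?x0 r) ?f"
    proof (rule locally_restrictsI)
      fix x assume x: "x \<in> ball ?x0 r"
      then have "x \<in> \<phi> ` (U \<inter> (\<lambda>y. u \<otimes>\<^bsub>G\<^esub> y) -` U)" using sub by blast
      with left_invariantD[OF li uG c c]
      obtain N' L where N': "open N'" "x \<in> N'" "affine_map L"
        "\<And>y. y \<in> N' \<Longrightarrow> y \<in> \<phi> ` (U \<inter> (\<lambda>y. u \<otimes>\<^bsub>G\<^esub> y) -` U) \<Longrightarrow> ?f y = L y"
        by (rule locally_restrictsE) (rule that)
      then have "\<forall>y\<in>N' \<inter> ball ?x0 r. ?f y = L y" using sub by blast
      with N'(1-3) show "\<exists>N L. open N \<and> x \<in> N \<and> affine_map L \<and> (\<forall>y\<in>N \<inter> ball ?x0 r. ?f y = L y)" by blast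
    qed
    then obtain L where L: "affine_map L" "\<And>x. x \<in> ball ?x0 r \<Longrightarrow> ?f x = L x"
      by (rule locally_affine_imp_affine[OF open_ball connected_ball]) (rule that)
    have Ly: "\<phi> (u \<otimes>\<^bsub>G\<^esub> y) = L (\<phi> y)" if "y \<in> N" for y
      using trans[OF sym[OF fy[OF that]] L(2)] im that by blast
    have "inj_on L (ball ?x0 r)"
      unfolding im[symmetric]
    proof (rule inj_onI, elim imageE)
      fix p q y y' assume y: "p = \<phi> y" "q = \<phi> y'" "y \<in> N" "y' \<in> N" and e: "L p = L q"
      then have "\<phi> (u \<otimes>\<^bsub>G\<^esub> y) = \<phi> (u \<otimes>\<^bsub>G\<^esub> y')" using Ly by simp
      then have "u \<otimes>\<^bsub>G\<^esub> y = u \<otimes>\<^bsub>G\<^esub> y'" using inj_onD[OF ch(4)] NN[OF u] y by blast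
      then have "inv\<^bsub>G\<^esub> u \<otimes>\<^bsub>G\<^esub> (u \<otimes>\<^bsub>G\<^esub> y) = inv\<^bsub>G\<^esub> u \<otimes>\<^bsub>G\<^esub> (u \<otimes>\<^bsub>G\<^esub> y')" by simp
      moreover have "y \<in> carrier G" "y' \<in> carrier G" using y NG by auto
      ultimately have "y = y'" using uG by (simp flip: m_assoc)
      then show "p = q" using y by simp
    qed
    then have "affine_automorphism L"
      using affine_map_inj_on_open[OF L(1) open_ball, of ?x0 ?x0 r] r(1) by simp
    with Ly show ?thesis by blast
  qed
  then obtain h where h: "\<And>u. u \<in> N \<Longrightarrow> affine_automorphism (h u)"
    "\<And>u y. u \<in> N \<Longrightarrow> y \<in> N \<Longrightarrow> \<phi> (u \<otimes>\<^bsub>G\<^esub> y) = h u (\<phi> y)" by metis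
  have "etale_group G X N \<phi> ?x0 r h"
  proof unfold_locales
    show "chart_on X (N, \<phi>)" using chart_on_subset[OF chart oN NU] .
    show "\<one>\<^bsub>G\<^esub> \<in> N" using oneU r(1) by (simp add: N_def)
  qed (use X mult inv affine_structureD(1)[OF aff] r(1) im h in auto)
  with c NU show ?thesis by (rule that)
qed

section \<open>Comparison of two affine structures through a common coordinate\<close>

lemma induced_affine_atlas_local:
  assumes c: "(V, \<psi>) \<in> induced_affine_atlas Y p B" and W: "(W, \<eta>) \<in> B" and y: "y \<in> V" "p y \<in> W"
  obtains L Q where "affine_automorphism L" "openin Y Q" "y \<in> Q" "Q \<subseteq> V"
    "\<And>y'. y' \<in> Q \<Longrightarrow> p y' \<in> W \<Longrightarrow> \<eta> (p y') = L (\<psi> y')"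
proof -
  have chart: "chart_on Y (V, \<psi>)" and
    lr: "locally_restricts {L. affine_automorphism L} (\<psi> ` (V \<inter> p -` W)) (\<eta> \<circ> p \<circ> inv_into V \<psi>)"
    using c W by (auto simp: induced_affine_atlas_def)
  have "\<psi> y \<in> \<psi> ` (V \<inter> p -` W)" using y by blast
  with lr obtain N L where N: "open N" "\<psi> y \<in> N" "affine_automorphism L"
    "\<And>z. z \<in> N \<Longrightarrow> z \<in> \<psi> ` (V \<inter> p -` W) \<Longrightarrow> (\<eta> \<circ> p \<circ> inv_into V \<psi>) z = L z"
    by (rule locally_restrictsE) (rule that)
  show ?thesis
  proof (rule that[OF N(3) chart_on_preimage[OF chart N(1)]])
    show "y \<in> {x \<in> V. \<psi> x \<in> N}" "{x \<in> V. \<psi> x \<in> N} \<subseteq> V" using y N by auto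
    fix y' assume y': "y' \<in> {x \<in> V. \<psi> x \<in> N}" "p y' \<in> W"
    then have "(\<eta> \<circ> p \<circ> inv_into V \<psi>) (\<psi> y') = L (\<psi> y')" by (intro N(4)) auto
    then show "\<eta> (p y') = L (\<psi> y')" using inv_into_f_f[OF chart_onD(4)[OF chart]] y' by simp
  qed
qed

text \<open>\<open>d\<close> plays the role of a developing map on \<open>U\<close>: charts in
  \<open>B\<close>, pulled back along \<open>f\<close>, differ from \<open>d\<close> locally by
  affine automorphisms. The formulation needs no atlas on \<open>U\<close>.\<close>

definition affine_coordinate ::
    "'c topology \<Rightarrow> ('c \<Rightarrow> 'v::euclidean_space) \<Rightarrow> ('c \<Rightarrow> 'b) \<Rightarrow> ('b, 'v) atlas \<Rightarrow> bool" where
  "affine_coordinate U d f B \<longleftrightarrow> (\<forall>(V, \<psi>)\<in>B. \<forall>c\<in>topspace U. f c \<in> V \<longrightarrow>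
     (\<exists>L Q. affine_automorphism L \<and> openin U Q \<and> c \<in> Q \<and> (\<forall>c'\<in>Q. f c' \<in> V \<and> \<psi> (f c') = L (d c'))))"

text \<open>Charts on both sides are affine functions of the same \<open>d\<close>, so between them
  the map reads \<open>L2 \<circ> inv_into UNIV L1\<close>.\<close>

lemma affine_manifold_map_via_coordinate:
  assumes f1: "homeomorphic_map U Y1 f1" and f2: "homeomorphic_map U Y2 f2"
    and B1: "\<And>c. c \<in> B1 \<Longrightarrow> chart_on Y1 c"
    and d1: "affine_coordinate U d f1 B1" and d2: "affine_coordinate U d f2 B2"
    and \<Psi>: "\<And>c. c \<in> topspace U \<Longrightarrow> \<Psi> (f1 c) = f2 c"
  shows "affine_manifold_map Y1 B1 Y2 B2 \<Psi>"
proof -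
  obtain g1 where g1: "homeomorphic_maps U Y1 f1 g1" using f1 homeomorphic_map_maps by blast
  have f1s: "f1 ` topspace U = topspace Y1" using homeomorphic_imp_surjective_map[OF f1] .
  have "continuous_map Y1 Y2 (f2 \<circ> g1)"
    using g1 homeomorphic_imp_continuous_map[OF f2] unfolding homeomorphic_maps_def
    by (blast intro: continuous_map_compose)
  then have cont: "continuous_map Y1 Y2 \<Psi>"
  proof (rule continuous_map_eq)
    fix y assume "y \<in> topspace Y1"
    then obtain c where "c \<in> topspace U" "y = f1 c" using f1s by blast
    then show "(f2 \<circ> g1) y = \<Psi> y" using \<Psi> g1 by (simp add: homeomorphic_maps_def)
  qed
  have "locally_restricts {L. affine_map L} (\<psi> ` (V \<inter> \<Psi> -` W)) (\<eta> \<circ> \<Psi> \<circ> inv_into V \<psi>)"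
    if c1: "(V, \<psi>) \<in> B1" and c2: "(W, \<eta>) \<in> B2" for V \<psi> W \<eta>
  proof (rule locally_restrictsI)
    have chart: "chart_on Y1 (V, \<psi>)" using B1 c1 by blast
    fix z assume "z \<in> \<psi> ` (V \<inter> \<Psi> -` W)"
    then obtain y where y: "y \<in> V" "\<Psi> y \<in> W" "z = \<psi> y" by blast
    have "y \<in> topspace Y1" using y(1) chart_onD(5)[OF chart] by blast
    then obtain c where c: "c \<in> topspace U" "y = f1 c" using f1s by blast
    obtain L1 Q1 where L1: "affine_automorphism L1" "openin U Q1" "c \<in> Q1"
      "\<And>c'. c' \<in> Q1 \<Longrightarrow> f1 c' \<in> V \<and> \<psi> (f1 c') = L1 (d c')"
      using d1 c1 c y(1) unfolding affine_coordinate_def by fastforce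
    obtain L2 Q2 where L2: "affine_automorphism L2" "openin U Q2" "c \<in> Q2"
      "\<And>c'. c' \<in> Q2 \<Longrightarrow> f2 c' \<in> W \<and> \<eta> (f2 c') = L2 (d c')"
      using d2 c2 c y(2) \<Psi>[OF c(1)] unfolding affine_coordinate_def by fastforce
    have "openin U (Q1 \<inter> Q2)" using L1(2) L2(2) by blast
    then have "openin Y1 (f1 ` (Q1 \<inter> Q2))"
      using homeomorphic_imp_open_map[OF f1] unfolding open_map_def by blast
    then have oN: "open (\<psi> ` (V \<inter> f1 ` (Q1 \<inter> Q2)))" by (rule chart_on_open_image[OF chart])
    show "\<exists>N L. open N \<and> z \<in> N \<and> affine_map L \<and> (\<forall>x\<in>N \<inter> \<psi> ` (V \<inter> \<Psi> -` W). (\<eta> \<circ> \<Psi> \<circ> inv_into V \<psi>) x = L x)"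
    proof (intro exI[of _ "\<psi> ` (V \<inter> f1 ` (Q1 \<inter> Q2))"] exI[of _ "L2 \<circ> inv_into UNIV L1"] conjI ballI oN)
      show "z \<in> \<psi> ` (V \<inter> f1 ` (Q1 \<inter> Q2))" using y c L1(3) L2(3) by blast
      show "affine_map (L2 \<circ> inv_into UNIV L1)"
        by (intro affine_map_compose affine_automorphism_imp_affine_map affine_automorphism_inverse L1 L2)
      fix x assume "x \<in> \<psi> ` (V \<inter> f1 ` (Q1 \<inter> Q2)) \<inter> \<psi> ` (V \<inter> \<Psi> -` W)"
      then obtain c' where c': "c' \<in> Q1" "c' \<in> Q2" "f1 c' \<in> V" "x = \<psi> (f1 c')" by blast
      have c'U: "c' \<in> topspace U" using c'(1) openin_subset[OF L1(2)] by blast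
      have "inv_into V \<psi> x = f1 c'" unfolding c'(4) using inv_into_f_f[OF chart_onD(4)[OF chart] c'(3)] .
      then have "(\<eta> \<circ> \<Psi> \<circ> inv_into V \<psi>) x = \<eta> (f2 c')" using \<Psi>[OF c'U] by simp
      also have "\<dots> = L2 (d c')" using L2(4)[OF c'(2)] by blast
      also have "d c' = inv_into UNIV L1 x" using L1(4)[OF c'(1)] c'(4) L1(1) by simp
      finally show "(\<eta> \<circ> \<Psi> \<circ> inv_into V \<psi>) x = (L2 \<circ> inv_into UNIV L1) x" by simp
    qed
  qed
  with cont show ?thesis
    unfolding affine_manifold_map_def chartwise_map_def by blast
qed

lemma affine_diffeomorphic_via_coordinate:
  assumes f1: "homeomorphic_map U Y1 f1" and f2: "homeomorphic_map U Y2 f2"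
    and B1: "\<And>c. c \<in> B1 \<Longrightarrow> chart_on Y1 c" and B2: "\<And>c. c \<in> B2 \<Longrightarrow> chart_on Y2 c"
    and d1: "affine_coordinate U d f1 B1" and d2: "affine_coordinate U d f2 B2"
  shows "affinely_diffeomorphic Y1 B1 Y2 B2"
proof -
  let ?\<Psi> = "f2 \<circ> inv_into (topspace U) f1"
  have inj: "inj_on f1 (topspace U)" "inj_on f2 (topspace U)"
    and im: "f1 ` topspace U = topspace Y1" "f2 ` topspace U = topspace Y2"
    using homeomorphic_imp_injective_map homeomorphic_imp_surjective_map f1 f2 by blast+
  have \<Psi>: "?\<Psi> (f1 c) = f2 c" if "c \<in> topspace U" for c
    using inv_into_f_f[OF inj(1) that] by simp
  have bij: "bij_betw ?\<Psi> (topspace Y1) (topspace Y2)"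
  proof (rule bij_betw_trans[OF bij_betw_inv_into])
    show "bij_betw f1 (topspace U) (topspace Y1)" "bij_betw f2 (topspace U) (topspace Y2)"
      using inj im by (simp_all add: bij_betw_def)
  qed
  have \<Psi>': "inv_into (topspace Y1) ?\<Psi> (f2 c) = f1 c" if "c \<in> topspace U" for c
  proof -
    have "f1 c \<in> topspace Y1" using im that by blast
    from inv_into_f_f[OF bij_betw_imp_inj_on[OF bij] this] show ?thesis unfolding \<Psi>[OF that] .
  qed
  have "affine_manifold_map Y1 B1 Y2 B2 ?\<Psi>"
    by (rule affine_manifold_map_via_coordinate[OF f1 f2 B1 d1 d2 \<Psi>])
  moreover have "affine_manifold_map Y2 B2 Y1 B1 (inv_into (topspace Y1) ?\<Psi>)"
    by (rule affine_manifold_map_via_coordinate[OF f2 f1 B2 d2 d1 \<Psi>'])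
  ultimately show ?thesis
    unfolding affinely_diffeomorphic_def affine_diffeomorphism_def using bij by blast
qed

section \<open>The developing map\<close>

locale developed_group = etale_group G X N \<phi> x0 r h
  for G :: "('a, 'm) monoid_scheme" (structure) and X :: "'a topology" and N
    and \<phi> :: "'a \<Rightarrow> 'v::euclidean_space" and x0 r h +
  fixes A :: "('a, 'v) atlas" and U0
  assumes affine_A: "affine_structure X A" and left_inv: "left_invariant G X A"
    and U0_chart: "(U0, \<phi>) \<in> A" and N_U0: "N \<subseteq> U0"
begin

text \<open>The chart at the unit, transported by left translation with \<open>g\<close> and then
  followed by \<open>a\<close>. With \<open>snd e\<close> for \<open>a\<close>, such charts
  represent the developing map near \<open>e\<close>.\<close>

definition chart_dom :: "'a \<Rightarrow> 'a set" where "chart_dom g = (\<lambda>y. g \<otimes> y) ` U0"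
definition chart_fun :: "'a \<Rightarrow> ('v \<Rightarrow> 'v) \<Rightarrow> 'a \<Rightarrow> 'v" where "chart_fun g a y = a (\<phi> (inv g \<otimes> y))"

lemma chart_in_A: "g \<in> carrier G \<Longrightarrow> affine_automorphism a \<Longrightarrow> (chart_dom g, chart_fun g a) \<in> A"
  using translated_chart_in_atlas[OF is_group topspace_X affine_A left_inv U0_chart]
  unfolding chart_dom_def chart_fun_def[abs_def] by blast

text \<open>On the sheet of elements \<open>emult e (graph_h u)\<close> the developing map is
  \<open>snd e (\<phi> u)\<close>, a chart of \<open>A\<close> applied to the first component. The
  additional \<open>g\<close> serves components of \<open>G\<close> other than that of the
  unit.\<close>

lemma dev_in_chart:
  assumes e: "e \<in> H" and g: "g \<in> carrier G"
  obtains W where "openin etop W" "e \<in> W"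
    "\<And>d. d \<in> W \<Longrightarrow> g \<otimes> fst d \<in> chart_dom (g \<otimes> fst e) \<and> snd d x0 = chart_fun (g \<otimes> fst e) (snd e) (g \<otimes> fst d)"
proof (rule that[OF openin_sheet[OF e N_open order_refl]])
  show "e \<in> (\<lambda>u. emult e (graph_h u)) ` N"
    using emult_graph_h_one[OF H_valid[OF e]] one_N by (metis imageI)
  fix d assume "d \<in> (\<lambda>u. emult e (graph_h u)) ` N"
  then obtain u where u: "u \<in> N" "d = emult e (graph_h u)" by blast
  have c: "fst e \<in> carrier G" "u \<in> carrier G" using H_carrier[OF e] u by auto
  have fd: "g \<otimes> fst d = g \<otimes> fst e \<otimes> u" using c g by (simp add: u(2) emult_def graph_h_def m_assoc)
  have "inv k \<otimes> (k \<otimes> u) = u" if "k \<in> carrier G" for k using that c by (simp flip: m_assoc)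
  from this[of "g \<otimes> fst e"] have "inv (g \<otimes> fst e) \<otimes> (g \<otimes> fst e \<otimes> u) = u" using c g by simp
  then have "chart_fun (g \<otimes> fst e) (snd e) (g \<otimes> fst d) = snd e (\<phi> u)" by (simp add: fd chart_fun_def)
  moreover have "snd d x0 = snd e (\<phi> u)" unfolding u(2) by (rule dev_sheet[OF u(1)])
  moreover have "g \<otimes> fst d \<in> chart_dom (g \<otimes> fst e)" unfolding fd chart_dom_def using u(1) N_U0 by blast
  ultimately show "g \<otimes> fst d \<in> chart_dom (g \<otimes> fst e) \<and> snd d x0 = chart_fun (g \<otimes> fst e) (snd e) (g \<otimes> fst d)"
    by simp
qed

text \<open>The coverings \<open>fst\<close> and \<open>?dev\<close> identify both universal covers
  with that of \<open>H\<close>. There the developing map composed with the end point projection is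
  an affine coordinate for either structure: through \<open>dev_in_chart\<close> for
  \<open>G\<close>, through the identity chart for \<Omega>.\<close>

theorem ucover_affinely_diffeomorphic:
  "affinely_diffeomorphic
     (ucover_topology X \<one>) (ucover_atlas X \<one> A)
     (ucover_topology (top_of_set \<Omega>) x0) (ucover_atlas (top_of_set \<Omega>) x0 (open_subset_atlas \<Omega>))"
proof -
  let ?U = "ucover_topology etop eone" and ?dev = "\<lambda>e. snd e x0"
  let ?f1 = "ucover_map X fst" and ?f2 = "ucover_map (top_of_set \<Omega>) ?dev"
  have e1: "eone \<in> topspace etop" by (simp add: topspace_etop H.eone_H)
  have f1: "homeomorphic_map ?U (ucover_topology X \<one>) ?f1"
    using homeomorphic_map_ucover_map[OF covering_fst e1] by (simp add: eone_def)
  have f2: "homeomorphic_map ?U (ucover_topology (top_of_set \<Omega>) x0) ?f2"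
    using homeomorphic_map_ucover_map[OF covering_dev e1] by (simp add: eone_def)
  define d where "d c = snd (ucover_proj c) x0" for c :: "(real \<Rightarrow> 'a \<times> ('v \<Rightarrow> 'v)) set"
  have projH: "ucover_proj c \<in> H" if "c \<in> topspace ?U" for c
    using continuous_map_ucover_proj[of etop eone] that by (auto simp: continuous_map_def topspace_etop)
  have p1: "ucover_proj (?f1 c) = fst (ucover_proj c)" and p2: "ucover_proj (?f2 c) = d c" if "c \<in> topspace ?U" for c
    using ucover_proj_ucover_map[OF covering_imp_continuous_map[OF covering_fst] that]
      ucover_proj_ucover_map[OF covering_imp_continuous_map[OF covering_dev] that] by (simp_all add: d_def)
  have "affine_coordinate ?U d ?f1 (ucover_atlas X \<one> A)"
    unfolding affine_coordinate_def
  proof clarify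
    fix V \<psi> c assume V: "(V, \<psi>) \<in> ucover_atlas X \<one> A" and c: "c \<in> topspace ?U" "?f1 c \<in> V"
    define e where "e = ucover_proj c"
    have e: "e \<in> H" using projH c(1) by (simp add: e_def)
    obtain W where W: "openin etop W" "e \<in> W"
      "\<And>d. d \<in> W \<Longrightarrow> \<one> \<otimes> fst d \<in> chart_dom (\<one> \<otimes> fst e) \<and> snd d x0 = chart_fun (\<one> \<otimes> fst e) (snd e) (\<one> \<otimes> fst d)"
      using e one_closed by (rule dev_in_chart) (rule that)
    have WH: "W \<subseteq> H" using W(1) openin_subset topspace_etop by metis
    have W': "fst d \<in> chart_dom (fst e)" "snd d x0 = chart_fun (fst e) (snd e) (fst d)" if "d \<in> W" for d
      using W(3)[OF that] H_carrier[OF e] H_carrier[of d] WH that by auto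
    have cA: "(chart_dom (fst e), chart_fun (fst e) (snd e)) \<in> A"
      using chart_in_A H_carrier[OF e] H_aut[OF e] by blast
    have "ucover_proj (?f1 c) \<in> chart_dom (fst e)" using p1[OF c(1)] W'(1)[OF W(2)] by (simp add: e_def)
    with V[unfolded ucover_atlas_def] cA c(2) obtain L Q where L: "affine_automorphism L"
      "openin (ucover_topology X \<one>) Q" "?f1 c \<in> Q" "Q \<subseteq> V"
      "\<And>y'. y' \<in> Q \<Longrightarrow> ucover_proj y' \<in> chart_dom (fst e) \<Longrightarrow> chart_fun (fst e) (snd e) (ucover_proj y') = L (\<psi> y')"
      by (rule induced_affine_atlas_local) (rule that)
    let ?Q = "{c' \<in> topspace ?U. ?f1 c' \<in> Q} \<inter> {c' \<in> topspace ?U. ucover_proj c' \<in> W}"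
    have "openin ?U ?Q"
      using openin_continuous_map_preimage[OF homeomorphic_imp_continuous_map[OF f1] L(2)]
        openin_continuous_map_preimage[OF continuous_map_ucover_proj W(1)] by blast
    moreover have "c \<in> ?Q" using c L(3) W(2) by (simp add: e_def)
    moreover have "?f1 c' \<in> V \<and> \<psi> (?f1 c') = inv_into UNIV L (d c')" if c': "c' \<in> ?Q" for c'
    proof -
      have "d c' = chart_fun (fst e) (snd e) (ucover_proj (?f1 c'))"
        using W'(2)[of "ucover_proj c'"] p1[of c'] c' by (simp add: d_def)
      also have "\<dots> = L (\<psi> (?f1 c'))"
        using W'(1)[of "ucover_proj c'"] p1[of c'] c' by (intro L(5)) auto
      finally show ?thesis using L(1,4) c' by auto
    qed
    ultimately show "\<exists>L Q. affine_automorphism L \<and> openin ?U Q \<and> c \<in> Q \<and> (\<forall>c'\<in>Q. ?f1 c' \<in> V \<and> \<psi> (?f1 c') = L (d c'))"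
      using affine_automorphism_inverse[OF L(1)] by blast
  qed
  moreover have "affine_coordinate ?U d ?f2 (ucover_atlas (top_of_set \<Omega>) x0 (open_subset_atlas \<Omega>))"
    unfolding affine_coordinate_def
  proof clarify
    fix V \<psi> c assume V: "(V, \<psi>) \<in> ucover_atlas (top_of_set \<Omega>) x0 (open_subset_atlas \<Omega>)"
      and c: "c \<in> topspace ?U" "?f2 c \<in> V"
    have idA: "(\<Omega>, id) \<in> open_subset_atlas \<Omega>"
    proof -
      have "chart_on (top_of_set \<Omega>) (\<Omega>, id)"
        using open_\<Omega> homeomorphic_map_id[of "top_of_set \<Omega>"] by (simp add: chart_on_def subtopology_subtopology id_def)
      moreover have "locally_restricts {L. affine_automorphism L} (id ` (\<Omega> \<inter> id -` UNIV)) (id \<circ> id \<circ> inv_into \<Omega> id)"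
      proof (rule locally_restrictsI)
        fix x :: 'v
        have "(id \<circ> id \<circ> inv_into \<Omega> id) y = id y" if "y \<in> \<Omega>" for y
          using that inv_into_f_f[of id \<Omega> y] by simp
        then show "\<exists>N L. open N \<and> x \<in> N \<and> affine_automorphism L \<and>
            (\<forall>y\<in>N \<inter> id ` (\<Omega> \<inter> id -` UNIV). (id \<circ> id \<circ> inv_into \<Omega> id) y = L y)"
          using affine_automorphism_id by (intro exI[of _ UNIV] exI[of _ id]) auto
      qed
      ultimately show ?thesis by (simp add: open_subset_atlas_def induced_affine_atlas_def)
    qed
    have dO: "d c' \<in> \<Omega>" if "c' \<in> topspace ?U" for c'
      using projH[OF that] unfolding \<Omega>_def d_def by blast
    have "ucover_proj (?f2 c) \<in> \<Omega>" using p2 dO c(1) by simp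
    with V[unfolded ucover_atlas_def] idA c(2) obtain L Q where L: "affine_automorphism L"
      "openin (ucover_topology (top_of_set \<Omega>) x0) Q" "?f2 c \<in> Q" "Q \<subseteq> V"
      "\<And>y'. y' \<in> Q \<Longrightarrow> ucover_proj y' \<in> \<Omega> \<Longrightarrow> id (ucover_proj y') = L (\<psi> y')"
      by (rule induced_affine_atlas_local) (rule that)
    let ?Q = "{c' \<in> topspace ?U. ?f2 c' \<in> Q}"
    have "openin ?U ?Q"
      using openin_continuous_map_preimage[OF homeomorphic_imp_continuous_map[OF f2] L(2)] .
    moreover have "c \<in> ?Q" using c L(3) by simp
    moreover have "?f2 c' \<in> V \<and> \<psi> (?f2 c') = inv_into UNIV L (d c')" if c': "c' \<in> ?Q" for c'
      using L(1,4) L(5)[of "?f2 c'"] p2[of c'] dO[of c'] c' by auto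
    ultimately show "\<exists>L Q. affine_automorphism L \<and> openin ?U Q \<and> c \<in> Q \<and> (\<forall>c'\<in>Q. ?f2 c' \<in> V \<and> \<psi> (?f2 c') = L (d c'))"
      using affine_automorphism_inverse[OF L(1)] by blast
  qed
  ultimately show ?thesis
    by (intro affine_diffeomorphic_via_coordinate[OF f1 f2])
       (auto simp: ucover_atlas_def induced_affine_atlas_def)
qed

text \<open>Translation by the inverse of \<open>f c\<close> moves the map to the unit, from where
  it lifts to \<open>H\<close> as \<open>S\<close> is starlike. The developed lift is locally
  affine, hence affine on the connected interior. A point of \<open>S\<close> on the boundary is a
  limit of interior points, so its local representative is the same \<open>L\<close>; nondegeneracy
  makes \<open>L\<close> invertible.\<close>

lemma develop_affine_map:
  assumes conv: "convex T" and c: "c \<in> interior T" and S: "interior T \<subseteq> S" "S \<subseteq> T"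
    and f: "nondegenerate_affine_map_on S X A f"
  obtains F L where "continuous_map (top_of_set S) etop F" "F c = eone"
    "\<And>y. y \<in> S \<Longrightarrow> f y = f c \<otimes> fst (F y)" "affine_automorphism L" "\<And>y. y \<in> S \<Longrightarrow> snd (F y) x0 = L y"
proof -
  have cS: "c \<in> S" using c S by blast
  have clT: "T \<subseteq> closure (interior T)"
    using convex_closure_interior[OF conv] c closure_subset by blast
  have star: "closed_segment c y \<subseteq> S" if y: "y \<in> S" for y
    using in_interior_closure_convex_segment[OF conv c, of y] y cS S closure_subset
    by (auto simp: closed_segment_eq_open)
  have f_cont: "continuous_map (top_of_set S) X f"
    and f_loc: "\<And>U \<psi>. (U, \<psi>) \<in> A \<Longrightarrow>
        locally_restricts {L. affine_map L \<and> inj_on L (affine hull S)} (S \<inter> f -` U) (\<psi> \<circ> f)"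
    using f by (auto simp: nondegenerate_affine_map_on_def subset_affine_map_def)
  have fG: "f y \<in> carrier G" if "y \<in> S" for y
    using f_cont that topspace_X by (auto simp: continuous_map_def)
  let ?g = "f c"
  have g: "?g \<in> carrier G" using fG cS by blast
  have f1: "continuous_map (top_of_set S) X (\<lambda>y. inv ?g \<otimes> f y)"
    using continuous_map_compose[OF f_cont mult_left_cont[of "inv ?g"]] g by (simp add: o_def)
  have e1: "eone \<in> topspace etop" "fst eone = inv ?g \<otimes> f c"
    using g H.eone_H by (simp_all add: topspace_etop) (simp add: eone_def)
  obtain F where F: "continuous_map (top_of_set S) etop F" "F c = eone" "\<And>y. y \<in> S \<Longrightarrow> fst (F y) = inv ?g \<otimes> f y"
    by (rule covering_starlike_lift[OF covering_fst cS star f1 e1], assumption) (rule that)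
  have FH: "F y \<in> H" if "y \<in> S" for y
    using F(1) that by (auto simp: continuous_map_def topspace_etop)
  have fF: "f y = ?g \<otimes> fst (F y)" if "y \<in> S" for y
    using F(3)[OF that] g fG[OF that] by (simp flip: m_assoc)
  let ?D = "\<lambda>y. snd (F y) x0"
  have loc: "\<exists>M L. open M \<and> y \<in> M \<and> (affine_map L \<and> inj_on L (affine hull S)) \<and> (\<forall>y'\<in>M \<inter> S. ?D y' = L y')"
    if y: "y \<in> S" for y
  proof -
    let ?e = "F y"
    obtain W where W: "openin etop W" "?e \<in> W"
      "\<And>d. d \<in> W \<Longrightarrow> ?g \<otimes> fst d \<in> chart_dom (?g \<otimes> fst ?e) \<and> snd d x0 = chart_fun (?g \<otimes> fst ?e) (snd ?e) (?g \<otimes> fst d)"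
      using FH[OF y] g by (rule dev_in_chart) (rule that)
    have cA: "(chart_dom (?g \<otimes> fst ?e), chart_fun (?g \<otimes> fst ?e) (snd ?e)) \<in> A"
      using chart_in_A H_carrier[OF FH[OF y]] H_aut[OF FH[OF y]] g by blast
    have "y \<in> S \<inter> f -` chart_dom (?g \<otimes> fst ?e)" using y W(2,3) fF[OF y] by auto
    with f_loc[OF cA] obtain M L where M: "open M" "y \<in> M" "affine_map L \<and> inj_on L (affine hull S)"
      "\<And>y'. y' \<in> M \<Longrightarrow> y' \<in> S \<inter> f -` chart_dom (?g \<otimes> fst ?e) \<Longrightarrow> (chart_fun (?g \<otimes> fst ?e) (snd ?e) \<circ> f) y' = L y'"
      by (rule locally_restrictsE) (rule that)
    have "openin (top_of_set S) {y' \<in> topspace (top_of_set S). F y' \<in> W}"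
      using openin_continuous_map_preimage[OF F(1) W(1)] .
    then obtain M' where M': "open M'" "{y' \<in> topspace (top_of_set S). F y' \<in> W} = S \<inter> M'"
      unfolding openin_open by blast
    have "y \<in> M'" using M'(2) y W(2) by auto
    moreover have "?D y' = L y'" if y': "y' \<in> (M \<inter> M') \<inter> S" for y'
    proof -
      have FW: "F y' \<in> W" using M'(2) y' by auto
      then have "?D y' = chart_fun (?g \<otimes> fst ?e) (snd ?e) (f y')" using W(3)[OF FW] fF[of y'] y' by simp
      also have "\<dots> = L y'" using M(4)[of y'] W(3)[OF FW] fF[of y'] y' by auto
      finally show ?thesis .
    qed
    ultimately show ?thesis using M M'(1) by (intro exI[of _ "M \<inter> M'"] exI[of _ L]) auto
  qed
  have "locally_restricts {L. affine_map L} (interior T) ?D"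
  proof (rule locally_restrictsI)
    fix y assume "y \<in> interior T"
    then obtain M L where "open M" "y \<in> M" "affine_map L" "\<forall>y'\<in>M \<inter> S. ?D y' = L y'"
      using loc[of y] S by blast
    then show "\<exists>M L. open M \<and> y \<in> M \<and> affine_map L \<and> (\<forall>y'\<in>M \<inter> interior T. ?D y' = L y')"
      using S by (intro exI[of _ M] exI[of _ L]) auto
  qed
  moreover have "connected (interior T)" using conv by (simp add: convex_connected convex_interior)
  ultimately obtain L where L: "affine_map L" "\<And>y. y \<in> interior T \<Longrightarrow> ?D y = L y"
    using locally_affine_imp_affine[OF open_interior] by blast
  have LS: "?D y = L y \<and> inj_on L (affine hull S)" if y: "y \<in> S" for y
  proof -
    obtain M L' where M: "open M" "y \<in> M" "affine_map L'" "inj_on L' (affine hull S)" "\<forall>y'\<in>M \<inter> S. ?D y' = L' y'"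
      using loc[OF y] by blast
    have "y \<in> closure (interior T)" using y S clT by blast
    then obtain v where v: "v \<in> M \<inter> interior T"
      using M(1,2) open_Int_closure_eq_empty by (metis disjoint_iff Int_commute IntI all_not_in_conv)
    have "L' = L"
    proof (rule affine_map_eq_on_open[OF M(3) L(1)])
      show "open (M \<inter> interior T)" using M(1) by blast
      show "v \<in> M \<inter> interior T" by (rule v)
      show "L' z = L z" if "z \<in> M \<inter> interior T" for z
        using M(5) L(2)[of z] that S by auto
    qed
    then show ?thesis using M y by blast
  qed
  have "inj_on L (interior T)"
    using LS[OF cS] S(1) hull_subset[of S affine] by (meson inj_on_subset order_trans)
  then have "affine_automorphism L" using affine_map_inj_on_open[OF L(1) open_interior c] by blast
  then show ?thesis using that F(1,2) fF LS by blast
qed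

text \<open>Once \<open>L\<close> maps all of \<open>T\<close> into \<Omega> it lifts through the
  developing map. The lift projected to \<open>G\<close> and translated back by \<open>g\<close> is
  the extension; over \<open>S\<close> it is \<open>F\<close> by unique lifting.\<close>

lemma extend_affine_map:
  assumes conv: "convex T" and c: "c \<in> S" "S \<subseteq> T"
    and star: "\<And>y. y \<in> S \<Longrightarrow> closed_segment c y \<subseteq> S"
    and F: "continuous_map (top_of_set S) etop F" "F c = eone" "\<And>y. y \<in> S \<Longrightarrow> f y = g \<otimes> fst (F y)"
    and g: "g \<in> carrier G"
    and L: "affine_automorphism L" "\<And>y. y \<in> S \<Longrightarrow> snd (F y) x0 = L y" and LT: "L ` T \<subseteq> \<Omega>"
  obtains k where "affine_map_on T X A k" "\<And>y. y \<in> S \<Longrightarrow> k y = f y"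
proof -
  have cT: "c \<in> T" using c by blast
  have starT: "closed_segment c y \<subseteq> T" if "y \<in> T" for y using cT that conv by (rule closed_segment_subset)
  have Lc: "continuous_map (top_of_set T) (top_of_set \<Omega>) L"
    using affine_automorphism_continuous_on[OF L(1)] LT by (auto simp: continuous_map_in_subtopology)
  have "snd eone x0 = L c" using L(2)[OF c(1)] F(2) by simp
  then obtain K where K: "continuous_map (top_of_set T) etop K" "K c = eone" "\<And>y. y \<in> T \<Longrightarrow> snd (K y) x0 = L y"
    using covering_starlike_lift[OF covering_dev cT starT Lc, of eone] H.eone_H
    by (auto simp: topspace_etop)
  have KH: "K y \<in> H" if "y \<in> T" for y
    using K(1) that by (auto simp: continuous_map_def topspace_etop)
  have connS: "connected_space (top_of_set S)"
  proof -
    have "starlike S" unfolding starlike_def using c(1) star by blast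
    then show ?thesis using starlike_imp_connected
      by (metis connectedin_absolute connectedin_def connectedin_iff_connected topspace_euclidean_subtopology)
  qed
  have KF: "K y = F y" if y: "y \<in> S" for y
  proof (rule covering_lift_unique[OF covering_dev connS _ F(1)])
    show "continuous_map (top_of_set S) etop K"
      using K(1) c(2) by (rule continuous_map_from_subtopology_mono)
    show "c \<in> topspace (top_of_set S)" "K c = F c" "y \<in> topspace (top_of_set S)" using c K F y by auto
    show "snd (K z) x0 = snd (F z) x0" if "z \<in> topspace (top_of_set S)" for z
      using that K(3) L(2) c(2) by auto
  qed
  define k where "k y = g \<otimes> fst (K y)" for y
  have kc: "continuous_map (top_of_set T) X k"
    using continuous_map_compose[OF K(1) continuous_map_compose[OF continuous_map_fst_etop mult_left_cont[OF g]]]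
    by (simp add: k_def[abs_def] o_def)
  \<comment> \<open>Near \<open>t\<close> the chart \<open>?\<eta>\<close> turns \<open>k\<close>
    into \<open>L\<close>, so in any other chart \<open>k\<close> is \<open>L\<close> followed by a
    transition map of the atlas.\<close>
  have "locally_restricts {L. affine_map L} (T \<inter> k -` V) (\<psi> \<circ> k)" if V: "(V, \<psi>) \<in> A" for V \<psi>
  proof (rule locally_restrictsI)
    fix t assume "t \<in> T \<inter> k -` V"
    then have t: "t \<in> T" "k t \<in> V" by auto
    let ?e = "K t"
    let ?W = "chart_dom (g \<otimes> fst ?e)" and ?\<eta> = "chart_fun (g \<otimes> fst ?e) (snd ?e)"
    obtain W where W: "openin etop W" "?e \<in> W"
      "\<And>d. d \<in> W \<Longrightarrow> g \<otimes> fst d \<in> ?W \<and> snd d x0 = ?\<eta> (g \<otimes> fst d)"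
      using KH[OF t(1)] g by (rule dev_in_chart) (rule that)
    have cA: "(?W, ?\<eta>) \<in> A"
      using chart_in_A H_carrier[OF KH[OF t(1)]] H_aut[OF KH[OF t(1)]] g by blast
    have inj: "inj_on ?\<eta> ?W" using chart_onD(4)[OF affine_structureD(2)[OF affine_A cA]] .
    have k\<eta>: "k t' \<in> ?W" "?\<eta> (k t') = L t'" if "t' \<in> T" "K t' \<in> W" for t'
      using W(3)[OF that(2)] K(3)[OF that(1)] by (auto simp: k_def)
    have "locally_restricts {L. affine_automorphism L} (?\<eta> ` (?W \<inter> V)) (\<psi> \<circ> inv_into ?W ?\<eta>)"
      using affine_structureD(4)[OF affine_A cA V] by (simp add: compatible_def)
    moreover have "L t \<in> ?\<eta> ` (?W \<inter> V)" using k\<eta>[OF t(1) W(2)] t(2) by (metis IntI imageI)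
    ultimately obtain M L' where M: "open M" "L t \<in> M" "affine_automorphism L'"
      "\<And>z. z \<in> M \<Longrightarrow> z \<in> ?\<eta> ` (?W \<inter> V) \<Longrightarrow> (\<psi> \<circ> inv_into ?W ?\<eta>) z = L' z"
      by (rule locally_restrictsE) (rule that)
    have "openin (top_of_set T) {t' \<in> topspace (top_of_set T). K t' \<in> W}"
      using openin_continuous_map_preimage[OF K(1) W(1)] .
    then obtain M' where M': "open M'" "{t' \<in> topspace (top_of_set T). K t' \<in> W} = T \<inter> M'"
      unfolding openin_open by blast
    have oL: "open (L -` M)" using affine_automorphism_continuous_on[OF L(1), of UNIV] M(1) by (auto intro: open_vimage)
    show "\<exists>M L. open M \<and> t \<in> M \<and> affine_map L \<and> (\<forall>y\<in>M \<inter> (T \<inter> k -` V). (\<psi> \<circ> k) y = L y)"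
    proof (intro exI[of _ "M' \<inter> L -` M"] exI[of _ "L' \<circ> L"] conjI ballI)
      show "open (M' \<inter> L -` M)" using M'(1) oL by blast
      have "t \<in> M'" using M'(2) t(1) W(2) by auto
      then show "t \<in> M' \<inter> L -` M" using M(2) by simp
      show "affine_map (L' \<circ> L)" using affine_automorphism_imp_affine_map affine_automorphism_compose M(3) L(1) by blast
      fix t' assume t': "t' \<in> M' \<inter> L -` M \<inter> (T \<inter> k -` V)"
      then have KW: "K t' \<in> W" using M'(2) by auto
      have kt: "k t' \<in> ?W \<inter> V" "?\<eta> (k t') = L t'" using k\<eta>[OF _ KW] t' by auto
      then have "L t' \<in> ?\<eta> ` (?W \<inter> V)" by (metis imageI)
      then have "(\<psi> \<circ> inv_into ?W ?\<eta>) (L t') = L' (L t')" using M(4)[of "L t'"] t' by blast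
      moreover have "inv_into ?W ?\<eta> (L t') = k t'"
        unfolding kt(2)[symmetric] using inv_into_f_f[OF inj] kt(1) by blast
      ultimately show "(\<psi> \<circ> k) t' = (L' \<circ> L) t'" by simp
    qed
  qed
  then have "affine_map_on T X A k"
    unfolding affine_map_on_def subset_affine_map_def using kc by blast
  moreover have "k y = f y" if "y \<in> S" for y using KF[OF that] F(3)[OF that] by (simp add: k_def)
  ultimately show ?thesis by (rule that)
qed

text \<open>If \<open>f\<close> has no extension, its developed form \<open>L\<close> must miss
  \<Omega> somewhere on \<open>T\<close>. The simplex is described by a minimal system of
  half-spaces, which makes its facets explicit, and its image under \<open>L\<close> becomes the
  punctured polytope.\<close>

theorem convex_complement_if_not_m_convex:
  assumes dim: "DIM('v) \<ge> 2" and nc: "\<not> m_convex (DIM('v) - 1) X A"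
  shows "convex (- \<Omega>)"
proof -
  obtain T :: "'v set" and F1 f S where T: "int (DIM('v)) simplex T" and F1: "F1 facet_of T"
    and S_def: "S = rel_interior T \<union> \<Union>{F. F facet_of T \<and> F \<noteq> F1}"
    and f: "nondegenerate_affine_map_on S X A f"
    and next_f: "\<not> (\<exists>k. affine_map_on T X A k \<and> (\<forall>x\<in>S. k x = f x))"
    using nc dim unfolding m_convex_def Let_def by auto
  have conv: "convex T" and comp: "compact T" and poly: "polyhedron T"
    using T by (auto intro: convex_simplex compact_simplex simplex_imp_polyhedron)
  have hull: "affine hull T = UNIV" using aff_dim_simplex[OF T] aff_dim_eq_full by metis
  have ri: "rel_interior T = interior T" using rel_interior_interior[OF hull] .
  have "T \<noteq> {}" using hull by auto
  then obtain c where c: "c \<in> interior T" using rel_interior_eq_empty[OF conv] ri by auto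
  have S1: "interior T \<subseteq> S" using S_def ri by blast
  have S2: "S \<subseteq> T" unfolding S_def using rel_interior_subset facet_of_imp_subset by blast
  have cS: "c \<in> S" using c S1 by blast
  have star: "closed_segment c y \<subseteq> S" if y: "y \<in> S" for y
    using in_interior_closure_convex_segment[OF conv c, of y] y cS S1 S2 closure_subset
    by (auto simp: closed_segment_eq_open)
  obtain F L where F: "continuous_map (top_of_set S) etop F" "F c = eone"
    "\<And>y. y \<in> S \<Longrightarrow> f y = f c \<otimes> fst (F y)" and L: "affine_automorphism L" "\<And>y. y \<in> S \<Longrightarrow> snd (F y) x0 = L y"
    by (rule develop_affine_map[OF conv c S1 S2 f]) (rule that)
  have fc: "f c \<in> carrier G"
    using f cS topspace_X by (auto simp: nondegenerate_affine_map_on_def subset_affine_map_def continuous_map_def)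
  have "\<not> L ` T \<subseteq> \<Omega>"
    using extend_affine_map[OF conv cS S2 star F fc L] next_f by metis
  then obtain p where p: "p \<in> T" "L p \<notin> \<Omega>" by blast
  have LS: "L y \<in> \<Omega>" if "y \<in> S" for y
  proof -
    have "F y \<in> H" using F(1) that by (auto simp: continuous_map_def topspace_etop)
    then show ?thesis using L(2)[OF that] unfolding \<Omega>_def by (metis imageI)
  qed
  obtain \<F> where \<F>: "finite \<F>" "T = affine hull T \<inter> \<Inter>\<F>"
    "\<forall>K\<in>\<F>. \<exists>a b. a \<noteq> 0 \<and> K = {x. a \<bullet> x \<le> b}" "\<forall>\<F>'. \<F>' \<subset> \<F> \<longrightarrow> T \<subset> affine hull T \<inter> \<Inter>\<F>'"
    using poly[unfolded polyhedron_Int_affine_minimal] by (elim exE conjE) (rule that)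
  then obtain a b where ab: "\<And>K. K \<in> \<F> \<Longrightarrow> a K \<noteq> 0 \<and> K = {x. a K \<bullet> x \<le> b K}" by metis
  have facets: "C facet_of T \<longleftrightarrow> (\<exists>K. K \<in> \<F> \<and> C = T \<inter> {x. a K \<bullet> x = b K})" for C
    by (rule facet_of_polyhedron_explicit[OF \<F>(1,2) ab]) (use \<F>(4) in auto)
  have T_eq: "T = {x. \<forall>K\<in>\<F>. a K \<bullet> x \<le> b K}"
    using \<F>(2) ab unfolding hull by auto
  have c_in: "a K \<bullet> c < b K" if K: "K \<in> \<F>" for K
  proof -
    have "T \<subseteq> {x. a K \<bullet> x \<le> b K}" using T_eq K by blast
    then have "c \<in> interior {x. a K \<bullet> x \<le> b K}" using c interior_mono by blast
    moreover have "a K \<noteq> 0" using ab[OF K] by blast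
    ultimately show ?thesis by simp
  qed
  obtain K1 where K1: "K1 \<in> \<F>" "F1 = T \<inter> {x. a K1 \<bullet> x = b K1}"
    using F1[unfolded facets] by (elim exE conjE) (rule that)
  \<comment> \<open>In a minimal system different members give different facets. By minimality some
    \<open>x\<close> violates only \<open>K\<close>; the segment to it from the interior point
    \<open>c\<close> crosses the wall of \<open>K\<close> at a point \<open>w\<close> that lies on
    no other wall.\<close>
  have ne_F1: "T \<inter> {x. a K \<bullet> x = b K} \<noteq> F1" if K: "K \<in> \<F>" "K \<noteq> K1" for K
  proof -
    have "\<F> - {K} \<subset> \<F>" using K(1) by blast
    with \<F>(4) have "T \<subset> affine hull T \<inter> \<Inter>(\<F> - {K})" by simp
    then obtain x where x: "x \<in> affine hull T \<inter> \<Inter>(\<F> - {K})" "x \<notin> T"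
      using psubset_imp_ex_mem by (metis Diff_iff)
    have xle: "a K' \<bullet> x \<le> b K'" if "K' \<in> \<F> - {K}" for K'
    proof -
      have "x \<in> \<Inter>(\<F> - {K})" using x(1) by (rule IntD2)
      then have "x \<in> K'" using that by (rule InterD)
      then show ?thesis using ab[of K'] that by auto
    qed
    have xgt: "a K \<bullet> x > b K"
    proof (rule ccontr)
      assume "\<not> ?thesis"
      then have "a K' \<bullet> x \<le> b K'" if "K' \<in> \<F>" for K'
        using xle[of K'] that by (cases "K' = K") auto
      then have "x \<in> T" unfolding T_eq by simp
      then show False using x(2) by simp
    qed
    define t where "t = (b K - a K \<bullet> c) / (a K \<bullet> x - a K \<bullet> c)"
    have t: "0 < t" "t < 1" using xgt c_in[OF K(1)] by (auto simp: t_def field_simps)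
    define w where "w = (1 - t) *\<^sub>R c + t *\<^sub>R x"
    have aw: "a K' \<bullet> w = (1 - t) * (a K' \<bullet> c) + t * (a K' \<bullet> x)" for K'
      by (simp add: w_def inner_add_right)
    have "a K \<bullet> w = a K \<bullet> c + t * (a K \<bullet> x - a K \<bullet> c)" unfolding aw by (simp add: algebra_simps)
    also have "\<dots> = b K" using xgt c_in[OF K(1)] by (simp add: t_def)
    finally have awK: "a K \<bullet> w = b K" .
    have awlt: "a K' \<bullet> w < b K'" if K': "K' \<in> \<F> - {K}" for K'
    proof -
      have "(1 - t) * (a K' \<bullet> c) < (1 - t) * b K'" using c_in[of K'] t K' by simp
      moreover have "t * (a K' \<bullet> x) \<le> t * b K'" using xle[OF K'] t by simp
      ultimately have "a K' \<bullet> w < (1 - t) * b K' + t * b K'" unfolding aw by linarith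
      then show ?thesis by (simp add: algebra_simps)
    qed
    have "w \<in> T" unfolding T_eq
    proof (intro CollectI ballI)
      fix K' assume "K' \<in> \<F>"
      then show "a K' \<bullet> w \<le> b K'" using awK awlt[of K'] by (cases "K' = K") auto
    qed
    moreover have "w \<notin> F1" using awlt[of K1] K1 K by auto
    ultimately show ?thesis using awK by blast
  qed
  \<comment> \<open>A missing point avoids \<open>S\<close>, that is the interior and every facet
    except \<open>F1\<close>. What remains is the relative interior of \<open>F1\<close>.\<close>
  have puncture_T: "a K1 \<bullet> y = b K1 \<and> (\<forall>K\<in>\<F> - {K1}. a K \<bullet> y < b K)" if y: "y \<in> T" "L y \<notin> \<Omega>" for y
  proof -
    have yS: "y \<notin> S" using LS y(2) by blast
    have le: "a K \<bullet> y \<le> b K" if "K \<in> \<F>" for K using y(1) that unfolding T_eq by blast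
    have lt: "a K \<bullet> y < b K" if K: "K \<in> \<F> - {K1}" for K
    proof (rule ccontr)
      assume "\<not> ?thesis"
      then have "y \<in> T \<inter> {x. a K \<bullet> x = b K}" using le[of K] K y(1) by simp
      moreover have "(T \<inter> {x. a K \<bullet> x = b K}) facet_of T" using facets K by blast
      moreover have "T \<inter> {x. a K \<bullet> x = b K} \<noteq> F1" using ne_F1 K by blast
      ultimately have "y \<in> S" unfolding S_def by blast
      then show False using yS by blast
    qed
    have "a K1 \<bullet> y = b K1"
    proof (rule ccontr)
      assume "a K1 \<bullet> y \<noteq> b K1"
      then have "\<forall>K\<in>\<F>. a K \<bullet> y < b K" using le[OF K1(1)] lt by (metis DiffI less_le singletonD)
      then have "y \<in> (\<Inter>K\<in>\<F>. {x. a K \<bullet> x < b K})" by blast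
      moreover have "open (\<Inter>K\<in>\<F>. {x. a K \<bullet> x < b K})"
        using \<F>(1) by (intro open_INT ballI open_halfspace_lt)
      moreover have "(\<Inter>K\<in>\<F>. {x. a K \<bullet> x < b K}) \<subseteq> T" unfolding T_eq by (auto simp: less_imp_le)
      ultimately have "y \<in> interior T" by (meson interiorI)
      then show False using yS S1 by blast
    qed
    then show ?thesis using lt by blast
  qed
  let ?M = "inv_into UNIV L"
  have M: "affine_map ?M" using affine_automorphism_imp_affine_map[OF affine_automorphism_inverse[OF L(1)]] .
  \<comment> \<open>The inequalities for the image of \<open>T\<close> are those of \<open>T\<close>
    composed with the inverse of \<open>L\<close>; the member \<open>K1\<close> takes the role of
    \<open>l\<close>.\<close>
  let ?\<mu> = "\<lambda>K x. b K - a K \<bullet> ?M x"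
  have \<mu>_aff: "affine_map (?\<mu> K)" for K
  proof -
    have "affine_map (\<lambda>x. b K - a K \<bullet> x)"
      unfolding affine_map_def
    proof (intro exI[of _ "\<lambda>x. (- a K) \<bullet> x"] exI[of _ "b K"] conjI)
      show "linear (\<lambda>x. (- a K) \<bullet> x)" by (rule bounded_linear.linear[OF bounded_linear_inner_right])
    qed auto
    from affine_map_compose[OF this M] show ?thesis by (simp add: o_def)
  qed
  have LT: "L ` T = {x. \<forall>K\<in>\<F>. ?\<mu> K x \<ge> 0}"
  proof
    show "L ` T \<subseteq> {x. \<forall>K\<in>\<F>. ?\<mu> K x \<ge> 0}" using L(1) unfolding T_eq by auto
    show "{x. \<forall>K\<in>\<F>. ?\<mu> K x \<ge> 0} \<subseteq> L ` T"
    proof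
      fix x assume "x \<in> {x. \<forall>K\<in>\<F>. ?\<mu> K x \<ge> 0}"
      then have "?M x \<in> T" unfolding T_eq by auto
      then show "x \<in> L ` T" using L(1) by (metis affine_automorphism_inv2 imageI)
    qed
  qed
  interpret punctured_polytope G X N \<phi> x0 r h "\<F> - {K1}" ?\<mu> "?\<mu> K1" "L ` T" "L c" "L p"
  proof unfold_locales
    show "L ` T = {x. 0 \<le> ?\<mu> K1 x \<and> (\<forall>j\<in>\<F> - {K1}. 0 \<le> ?\<mu> j x)}"
      unfolding LT using K1(1) by blast
    show "compact (L ` T)" using comp affine_automorphism_continuous_on[OF L(1)] by (intro compact_continuous_image)
    show "?\<mu> K1 x = 0 \<and> (\<forall>j\<in>\<F> - {K1}. 0 < ?\<mu> j x)" if x: "x \<in> L ` T" "x \<notin> \<Omega>" for x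
    proof -
      obtain y where y: "y \<in> T" "x = L y" using x(1) by blast
      then show ?thesis using puncture_T[of y] x(2) L(1) by simp
    qed
  qed (use dim \<F>(1) \<mu>_aff c_in K1(1) L(1) p in auto)
  show ?thesis by (rule convex_complement)
qed

end

theorem corollary1p3:
  fixes G :: "('a, 'm) monoid_scheme"
    and X :: "'a topology"
    and S A :: "('a, real ^ 'n) atlas"
  assumes "CARD('n) \<ge> 2"
    and "lie_group G X S"
    and "affine_structure X A"
    and "A \<subseteq> S"
    and "left_invariant G X A"
  shows "m_convex (CARD('n) - 1) X A \<or>
    (\<exists>(C :: (real ^ 'n) set) y. closed C \<and> convex C \<and> connected (- C) \<and> y \<in> - C \<and>
       affinely_diffeomorphic
         (ucover_topology X \<one>\<^bsub>G\<^esub>) (ucover_atlas X \<one>\<^bsub>G\<^esub> A)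
         (ucover_topology (top_of_set (- C)) y)
         (ucover_atlas (top_of_set (- C)) y (open_subset_atlas (- C))))"
proof (rule disjCI)
  assume *: "\<not> (\<exists>(C :: (real ^ 'n) set) y. closed C \<and> convex C \<and> connected (- C) \<and> y \<in> - C \<and>
       affinely_diffeomorphic
         (ucover_topology X \<one>\<^bsub>G\<^esub>) (ucover_atlas X \<one>\<^bsub>G\<^esub> A)
         (ucover_topology (top_of_set (- C)) y)
         (ucover_atlas (top_of_set (- C)) y (open_subset_atlas (- C))))"
  have G: "group G" "topspace X = carrier G"
    "continuous_map (prod_topology X X) X (\<lambda>(x, y). x \<otimes>\<^bsub>G\<^esub> y)"
    "continuous_map X X (\<lambda>x. inv\<^bsub>G\<^esub> x)"
    using assms(2) by (auto simp: lie_group_def chartwise_map_def)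
  obtain U \<phi> N r h where U: "(U, \<phi>) \<in> A" "N \<subseteq> U" and e: "etale_group G X N \<phi> (\<phi> \<one>\<^bsub>G\<^esub>) r h"
    using etale_group_exists[OF G assms(3,5)] by blast
  interpret developed_group G X N \<phi> "\<phi> \<one>\<^bsub>G\<^esub>" r h A U
    using e U assms(3,5) by (intro developed_group.intro developed_group_axioms.intro)
  show "m_convex (CARD('n) - 1) X A"
  proof (rule ccontr)
    assume "\<not> m_convex (CARD('n) - 1) X A"
    then have "convex (- \<Omega>)" using convex_complement_if_not_m_convex assms(1) by simp
    moreover have "closed (- \<Omega>)" using open_\<Omega> by (simp add: closed_Compl)
    \<comment> \<open>\<open>C\<close> is \<open>- \<Omega>\<close>, whose complement is \<Omega>,
      and the base point is the chart image of the unit.\<close>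
    ultimately show False
      using * connected_\<Omega> x0_\<Omega> ucover_affinely_diffeomorphic by (metis double_complement)
  qed
qed

end
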